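(* Let $(B,\beta)$ be a monoidal Hom-bialgebra, let $(A,\alpha)$ be a right $(B,\beta)$-Hom-comodule algebra with Hom-coaction $\rho^A:A\to A\otimes B$, $a\mapsto a_{(0)}\otimes a_{(1)}$, and let $(C,\gamma)$ be a right $(B,\beta)$-Hom-module coalgebra with Hom-action $\rho_C:C\otimes B\to C$, $c\otimes b\mapsto cb$. Define $$\psi:C\otimes A\to A\otimes C,\quad c\otimes a\mapsto\alpha(a_{(0)})\otimes\gamma^{-1}(c)a_{(1)}=a_\kappa\otimes c^\kappa.$$ Then the following hold. (1) $[(A,\alpha),(C,\gamma)]_\psi$ is a Hom-entwining structure. (2) $(M,\mu)$ is an $[(A,\alpha),(C,\gamma)]_\psi$-entwined Hom-module if and only if it is a right $(A,\alpha)$-Hom-module with $\rho_M:M\otimes A\to M$, $m\otimes a\mapsto ma$, and a right $(C,\gamma)$-Hom-comodule with $\rho^M:M\to M\otimes C$, $m\mapsto m_{(0)}\otimes m_{(1)}$, such that $$\rho^M(ma)=m_{(0)}a_{(0)}\otimes m_{(1)}a_{(1)}$$ for all $m\in M$, $a\in A$. (3) $(\mathcal{C},\chi)=(A\otimes C,\alpha\otimes\gamma)$ is an $(A,\alpha)$-Hom-coring with comultiplication $\Delta_{\mathcal{C}}(a\otimes c)=(\alpha^{-1}(a)\otimes c_1)\otimes_A(1\otimes c_2)$ and counit $\varepsilon_{\mathcal{C}}(a\otimes c)=\alpha(a)\varepsilon(c)$, and it has the $(A,\alpha)$-Hom-bimodule structure $a(a'\otimes c)=\alpha^{-1}(a)a'\otimes\gamma(c)$,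 $(a'\otimes c)a=a'a_{(0)}\otimes ca_{(1)}$ for $a,a'\in A$, $c\in C$. (4) $Hom^{\mathcal{H}}(C,A)$, the $k$-module of morphisms $(C,\gamma)\to(A,\alpha)$ in $\widetilde{\mathcal{H}}(\mathcal{M}_k)$, is an associative algebra with unit $\eta\varepsilon:c\mapsto\varepsilon(c)1_A$ and multiplication $*_\psi$ defined by $$(f*_\psi g)(c)=\alpha(f(c_2)_{(0)})\,g(\gamma^{-1}(c_1)f(c_2)_{(1)})=\alpha(f(c_2))_{(0)}\,\alpha^{-1}\big(g(c_1\,\alpha(f(c_2))_{(1)})\big)$$ for all $f,g\in Hom^{\mathcal{H}}(C,A)$ and $c\in C$.
   Context: $k$ is a commutative ring with unit; unadorned $\otimes$ is over $k$. The category $\widetilde{\mathcal{H}}(\mathcal{M}_k)$ has as objects pairs $(M,\mu)$ with $M$ a $k$-module and $\mu$ a $k$-linear automorphism of $M$; morphisms $(M,\mu)\to(N,\nu)$ are $k$-linear maps $f$ with $\nu\circ f=f\circ\mu$; $(M,\mu)\otimes(N,\nu)=(M\otimes N,\mu\otimes\nu)$. A monoidal Hom-algebra $(A,\alpha)$ is an object of $\widetilde{\mathcal{H}}(\mathcal{M}_k)$ with a $k$-linear multiplication and an element $1=1_A$ such that $\alpha(a)(bc)=(ab)\alpha(c)$, $a1_A=1_Aa=\alpha(a)$, $\alpha(ab)=\alpha(a)\alpha(b)$, $\alpha(1_A)=1_A$. A monoidal Hom-coalgebra $(C,\gamma)$ is an object with $k$-linear maps $\Delta(c)=c_1\otimes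 c_2$ (summation understood) and $\varepsilon:C\to k$ such that $\gamma^{-1}(c_1)\otimes\Delta(c_2)=c_{11}\otimes(c_{12}\otimes\gamma^{-1}(c_2))$, $\varepsilon(c_1)c_2=\gamma^{-1}(c)=c_1\varepsilon(c_2)$ (ordinary scalar multiplication), $\Delta(\gamma(c))=\gamma(c_1)\otimes\gamma(c_2)$, $\varepsilon(\gamma(c))=\varepsilon(c)$. A right $(C,\gamma)$-Hom-comodule is an object $(M,\mu)$ with a $k$-linear map $\rho^M:M\to M\otimes C$, $m\mapsto m_{(0)}\otimes m_{(1)}$, such that $\mu^{-1}(m_{(0)})\otimes\Delta(m_{(1)})=m_{(0)(0)}\otimes(m_{(0)(1)}\otimes\gamma^{-1}(m_{(1)}))$, $m_{(0)}\varepsilon(m_{(1)})=\mu^{-1}(m)$, $\rho^M(\mu(m))=\mu(m_{(0)})\otimes\gamma(m_{(1)})$. A right $(A,\alpha)$-Hom-module is an object $(M,\mu)$ with a $k$-linear map $m\otimes a\mapsto ma$ such that $\mu(m)(ab)=(ma)\alpha(b)$, $m1_A=\mu(m)$, $\mu(ma)=\mu(m)\alpha(a)$. A left one satisfies $\alpha(a)(bm)=(ab)\mu(m)$, $1_Am=\mu(m)$, $\mu(am)=\alpha(a)\mu(m)$. An $(A,\alpha)$-Hom-bimodule is both, with $(am)\alpha(b)=\alpha(a)(mb)$. Bilinear maps are morphisms in $\widetilde{\mathcal{H}}(\mathcal{M}_k)$ commuting with both actions. $(A,\alpha)$ is a Hom-bimodule over itself. For a right Hom-module $(M,\mu)$ and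 a left Hom-module $(N,\nu)$, $M\otimes_AN$ is the quotient of $M\otimes N$ by the relations $ma\otimes n=\mu(m)\otimes a\nu^{-1}(n)$; for Hom-bimodules it is a Hom-bimodule with automorphism $\mu\otimes\nu$ and actions $a(m\otimes_An)=\alpha^{-1}(a)m\otimes_A\nu(n)$, $(m\otimes_An)a=\mu(m)\otimes_An\alpha^{-1}(a)$. An $(A,\alpha)$-Hom-coring is an $(A,\alpha)$-Hom-bimodule $(\mathcal{C},\chi)$ with $(A,\alpha)$-bilinear maps $\Delta_{\mathcal{C}}:\mathcal{C}\to\mathcal{C}\otimes_A\mathcal{C}$, $x\mapsto x_1\otimes_Ax_2$, and $\varepsilon_{\mathcal{C}}:\mathcal{C}\to A$, such that $x_1\otimes_A\Delta_{\mathcal{C}}(x_2)=\chi(x_{11})\otimes_A(x_{12}\otimes_A\chi^{-1}(x_2))$, $\varepsilon_{\mathcal{C}}(x_1)x_2=x=x_1\varepsilon_{\mathcal{C}}(x_2)$, $\Delta_{\mathcal{C}}(\chi(x))=\chi(x_1)\otimes_A\chi(x_2)$, $\varepsilon_{\mathcal{C}}(\chi(x))=\alpha(\varepsilon_{\mathcal{C}}(x))$. A monoidal Hom-bialgebra $(B,\beta)$ is a monoidal Hom-algebra and monoidal Hom-coalgebra (same $\beta$) with $\Delta(bb')=\Delta(b)\Delta(b')$, $\Delta(1)=1\otimes1$, $\varepsilon(bb')=\varepsilon(b)\varepsilon(b')$, $\varepsilon(1)=1$. A right $(B,\beta)$-Hom-comodule algebra $(A,\alpha)$ is a monoidal Hom-algebra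 and right $(B,\beta)$-Hom-comodule with $(aa')_{(0)}\otimes(aa')_{(1)}=a_{(0)}a'_{(0)}\otimes a_{(1)}a'_{(1)}$, $\rho^A(1_A)=1_A\otimes1_B$ (and $\rho^A\circ\alpha=(\alpha\otimes\beta)\circ\rho^A$). A right $(B,\beta)$-Hom-module coalgebra $(C,\gamma)$ is a monoidal Hom-coalgebra and right $(B,\beta)$-Hom-module with $(cb)_1\otimes(cb)_2=c_1b_1\otimes c_2b_2$, $\varepsilon_C(cb)=\varepsilon_C(c)\varepsilon_B(b)$ (and $\gamma(cb)=\gamma(c)\beta(b)$). A (right-right) Hom-entwining structure $[(A,\alpha),(C,\gamma)]_\psi$ consists of a monoidal Hom-algebra $(A,\alpha)$, a monoidal Hom-coalgebra $(C,\gamma)$ and a morphism $\psi:C\otimes A\to A\otimes C$ in $\widetilde{\mathcal{H}}(\mathcal{M}_k)$, written $\psi(c\otimes a)=a_\kappa\otimes c^\kappa$ (further letters for further applications of $\psi$), such that for all $a,a'\in A$, $c\in C$: $(aa')_\kappa\otimes\gamma(c)^\kappa=a_\kappa a'_\lambda\otimes\gamma(c^{\kappa\lambda})$; $\alpha^{-1}(a_\kappa)\otimes c^\kappa{}_1\otimes c^\kappa{}_2=\alpha^{-1}(a)_{\kappa\lambda}\otimes c_1{}^\lambda\otimes c_2{}^\kappa$; $1_\kappa\otimes c^\kappa=1\otimes c$; $a_\kappa\varepsilon(c^\kappa)=a\varepsilon(c)$. An $[(A,\alpha),(C,\gamma)]_\psi$-entwined Hom-module is an object $(M,\mu)$ that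 is a right $(A,\alpha)$-Hom-module and a right $(C,\gamma)$-Hom-comodule with $\rho^M(ma)=m_{(0)}\alpha^{-1}(a)_\kappa\otimes\gamma(m_{(1)}{}^\kappa)$ for all $m\in M$, $a\in A$. *)

theory Defs
  imports "HOL-Algebra.Module" "HOL-Algebra.AbelCoset"
begin

section \<open>Tensor products of modules over a commutative ring\<close>

text \<open>
  An object \<open>(M, \<mu>)\<close> is one record, with \<open>\<mu>\<close> stored as \<open>aut M\<close>.  The fields \<open>mult\<close> and \<open>one\<close>,
  which every module record inherits from the ring record, carry the multiplication and unit of
  a Hom-algebra; for other objects they are ignored.
\<close>

record ('k, 'm) hom_object = "('k, 'm) module" +
  aut :: "'m \<Rightarrow> 'm"

record ('k, 'm, 'a) hom_bimodule = "('k, 'm) hom_object" +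
  lact :: "'a \<Rightarrow> 'm \<Rightarrow> 'm"
  ract :: "'m \<Rightarrow> 'a \<Rightarrow> 'm"

definition linear_map ::
  "'k ring \<Rightarrow> ('k, 'm, 'x) module_scheme \<Rightarrow> ('k, 'n, 'y) module_scheme \<Rightarrow> ('m \<Rightarrow> 'n) set" where
  "linear_map K M N =
    {f \<in> carrier M \<rightarrow> carrier N.
      (\<forall>x\<in>carrier M. \<forall>y\<in>carrier M. f (x \<oplus>\<^bsub>M\<^esub> y) = f x \<oplus>\<^bsub>N\<^esub> f y) \<and>
      (\<forall>r\<in>carrier K. \<forall>x\<in>carrier M. f (r \<odot>\<^bsub>M\<^esub> x) = r \<odot>\<^bsub>N\<^esub> f x)}"

definition bilinear_map ::
  "'k ring \<Rightarrow> ('k, 'm, 'x) module_scheme \<Rightarrow> ('k, 'n, 'y) module_scheme \<Rightarrow>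
    ('k, 'p, 'z) module_scheme \<Rightarrow> ('m \<Rightarrow> 'n \<Rightarrow> 'p) set" where
  "bilinear_map K M N P =
    {\<phi>. (\<forall>x\<in>carrier M. \<phi> x \<in> linear_map K N P) \<and>
        (\<forall>y\<in>carrier N. (\<lambda>x. \<phi> x y) \<in> linear_map K M P)}"

definition free_module :: "'k ring \<Rightarrow> 's set \<Rightarrow> ('k, 's \<Rightarrow> 'k) module" where
  "free_module K S =
    \<lparr>carrier = {f. f \<in> S \<rightarrow> carrier K \<and> (\<forall>s. s \<notin> S \<longrightarrow> f s = \<zero>\<^bsub>K\<^esub>) \<and> finite {s. f s \<noteq> \<zero>\<^bsub>K\<^esub>}},
     mult = undefined, one = undefined,
     zero = (\<lambda>s. \<zero>\<^bsub>K\<^esub>),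
     add = (\<lambda>f g s. f s \<oplus>\<^bsub>K\<^esub> g s),
     smult = (\<lambda>r f s. r \<otimes>\<^bsub>K\<^esub> f s)\<rparr>"

definition basis_vector :: "'k ring \<Rightarrow> 's \<Rightarrow> 's \<Rightarrow> 'k" where
  "basis_vector K s = (\<lambda>t. if t = s then \<one>\<^bsub>K\<^esub> else \<zero>\<^bsub>K\<^esub>)"

definition generated_submodule :: "'k ring \<Rightarrow> ('k, 'm, 'x) module_scheme \<Rightarrow> 'm set \<Rightarrow> 'm set" where
  "generated_submodule K M X = \<Inter>{H. submodule H K M \<and> X \<subseteq> H}"

definition quotient_module ::
  "('k, 'm, 'x) module_scheme \<Rightarrow> 'm set \<Rightarrow> ('k, 'm set) module" where
  "quotient_module M H =
    \<lparr>carrier = a_rcosets\<^bsub>M\<^esub> H,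
     mult = undefined, one = undefined,
     zero = H,
     add = set_add M,
     smult = (\<lambda>r X. \<Union>x\<in>X. H +>\<^bsub>M\<^esub> (r \<odot>\<^bsub>M\<^esub> x))\<rparr>"

type_synonym ('k, 'm, 'n) tensor = "('m \<times> 'n \<Rightarrow> 'k) set"

definition tensor_relations ::
  "'k ring \<Rightarrow> ('k, 'm, 'x) module_scheme \<Rightarrow> ('k, 'n, 'y) module_scheme \<Rightarrow> ('m \<times> 'n \<Rightarrow> 'k) set" where
  "tensor_relations K M N =
    (let F = free_module K (carrier M \<times> carrier N); e = (\<lambda>m n. basis_vector K (m, n)) in
      {e (m \<oplus>\<^bsub>M\<^esub> m') n \<ominus>\<^bsub>F\<^esub> (e m n \<oplus>\<^bsub>F\<^esub> e m' n) | m m' n.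
          m \<in> carrier M \<and> m' \<in> carrier M \<and> n \<in> carrier N} \<union>
      {e m (n \<oplus>\<^bsub>N\<^esub> n') \<ominus>\<^bsub>F\<^esub> (e m n \<oplus>\<^bsub>F\<^esub> e m n') | m n n'.
          m \<in> carrier M \<and> n \<in> carrier N \<and> n' \<in> carrier N} \<union>
      {e (r \<odot>\<^bsub>M\<^esub> m) n \<ominus>\<^bsub>F\<^esub> r \<odot>\<^bsub>F\<^esub> e m n | r m n.
          r \<in> carrier K \<and> m \<in> carrier M \<and> n \<in> carrier N} \<union>
      {e m (r \<odot>\<^bsub>N\<^esub> n) \<ominus>\<^bsub>F\<^esub> r \<odot>\<^bsub>F\<^esub> e m n | r m n.
          r \<in> carrier K \<and> m \<in> carrier M \<and> n \<in> carrier N})"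

definition tensor_kernel ::
  "'k ring \<Rightarrow> ('k, 'm, 'x) module_scheme \<Rightarrow> ('k, 'n, 'y) module_scheme \<Rightarrow> ('m \<times> 'n \<Rightarrow> 'k) set" where
  "tensor_kernel K M N =
    generated_submodule K (free_module K (carrier M \<times> carrier N)) (tensor_relations K M N)"

definition tensor_module ::
  "'k ring \<Rightarrow> ('k, 'm, 'x) module_scheme \<Rightarrow> ('k, 'n, 'y) module_scheme \<Rightarrow>
    ('k, ('k, 'm, 'n) tensor) module" where
  "tensor_module K M N =
    quotient_module (free_module K (carrier M \<times> carrier N)) (tensor_kernel K M N)"

text \<open>\<open>pure_tensor K M N m n\<close> is \<open>m \<otimes> n\<close> in \<open>M \<otimes> N\<close>.\<close>

definition pure_tensor ::
  "'k ring \<Rightarrow> ('k, 'm, 'x) module_scheme \<Rightarrow> ('k, 'n, 'y) module_scheme \<Rightarrow>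
    'm \<Rightarrow> 'n \<Rightarrow> ('k, 'm, 'n) tensor" where
  "pure_tensor K M N m n =
    tensor_kernel K M N +>\<^bsub>free_module K (carrier M \<times> carrier N)\<^esub> basis_vector K (m, n)"

text \<open>
  \<open>sweedler K P \<phi> t\<close> is what Sweedler notation abbreviates: write the tensor \<open>t\<close> as a finite sum
  of multiples \<open>r\<^sub>i (m\<^sub>i \<otimes> n\<^sub>i)\<close> and form the sum of the \<open>r\<^sub>i \<phi>(m\<^sub>i, n\<^sub>i)\<close> in the module \<open>P\<close>.
  For bilinear \<open>\<phi>\<close> this does not depend on the chosen expression, and it is
  the linear map out of the tensor product that \<open>\<phi>\<close> induces.
\<close>

definition sweedler ::
  "'k ring \<Rightarrow> ('k, 'p, 'x) module_scheme \<Rightarrow> ('m \<Rightarrow> 'n \<Rightarrow> 'p) \<Rightarrow> ('k, 'm, 'n) tensor \<Rightarrow> 'p" where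
  "sweedler K P \<phi> t =
    (let f = (SOME f. f \<in> t)
     in \<Oplus>\<^bsub>P\<^esub>s\<in>{s. f s \<noteq> \<zero>\<^bsub>K\<^esub>}. f s \<odot>\<^bsub>P\<^esub> \<phi> (fst s) (snd s))"

definition tensor ::
  "'k ring \<Rightarrow> ('k, 'm, 'x) hom_object_scheme \<Rightarrow> ('k, 'n, 'y) hom_object_scheme \<Rightarrow>
    ('k, ('k, 'm, 'n) tensor) hom_object" where
  "tensor K M N =
    module.extend (tensor_module K M N)
      (hom_object.fields
        (sweedler K (tensor_module K M N) (\<lambda>m n. pure_tensor K M N (aut M m) (aut N n))))"


section \<open>The category of modules with an automorphism\<close>

abbreviation aut_inv :: "('k, 'm, 'x) hom_object_scheme \<Rightarrow> 'm \<Rightarrow> 'm" where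
  "aut_inv M \<equiv> inv_into (carrier M) (aut M)"

locale hom_object = module K M
  for K :: "'k ring" and M :: "('k, 'm, 'x) hom_object_scheme" +
  assumes aut_linear: "aut M \<in> linear_map K M M"
    and aut_bij: "bij_betw (aut M) (carrier M) (carrier M)"

definition hom_morphism ::
  "'k ring \<Rightarrow> ('k, 'm, 'x) hom_object_scheme \<Rightarrow> ('k, 'n, 'y) hom_object_scheme \<Rightarrow> ('m \<Rightarrow> 'n) set" where
  "hom_morphism K M N =
    {f \<in> linear_map K M N. \<forall>x\<in>carrier M. aut N (f x) = f (aut M x)}"

definition base_module :: "'k ring \<Rightarrow> ('k, 'k) module" where
  "base_module K = ring.extend K (module.fields (mult K))"


section \<open>Monoidal Hom-algebras and Hom-modules\<close>

locale hom_algebra = hom_object K A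
  for K :: "'k ring" and A :: "('k, 'a) hom_object" +
  assumes mult_bilinear: "mult A \<in> bilinear_map K A A A"
    and one_closed: "\<one>\<^bsub>A\<^esub> \<in> carrier A"
    and hom_assoc: "\<lbrakk>a \<in> carrier A; b \<in> carrier A; c \<in> carrier A\<rbrakk> \<Longrightarrow>
      aut A a \<otimes>\<^bsub>A\<^esub> (b \<otimes>\<^bsub>A\<^esub> c) = (a \<otimes>\<^bsub>A\<^esub> b) \<otimes>\<^bsub>A\<^esub> aut A c"
    and mult_one: "a \<in> carrier A \<Longrightarrow> a \<otimes>\<^bsub>A\<^esub> \<one>\<^bsub>A\<^esub> = aut A a"
    and one_mult: "a \<in> carrier A \<Longrightarrow> \<one>\<^bsub>A\<^esub> \<otimes>\<^bsub>A\<^esub> a = aut A a"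
    and aut_mult: "\<lbrakk>a \<in> carrier A; b \<in> carrier A\<rbrakk> \<Longrightarrow>
      aut A (a \<otimes>\<^bsub>A\<^esub> b) = aut A a \<otimes>\<^bsub>A\<^esub> aut A b"
    and aut_one: "aut A \<one>\<^bsub>A\<^esub> = \<one>\<^bsub>A\<^esub>"

locale right_hom_module = A: hom_algebra K A + M: hom_object K M
  for K :: "'k ring" and A :: "('k, 'a) hom_object"
    and M :: "('k, 'm, 'x) hom_object_scheme" and act :: "'m \<Rightarrow> 'a \<Rightarrow> 'm" +
  assumes act_bilinear: "act \<in> bilinear_map K M A M"
    and act_assoc: "\<lbrakk>m \<in> carrier M; a \<in> carrier A; b \<in> carrier A\<rbrakk> \<Longrightarrow>
      act (aut M m) (a \<otimes>\<^bsub>A\<^esub> b) = act (act m a) (aut A b)"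
    and act_one: "m \<in> carrier M \<Longrightarrow> act m \<one>\<^bsub>A\<^esub> = aut M m"
    and aut_act: "\<lbrakk>m \<in> carrier M; a \<in> carrier A\<rbrakk> \<Longrightarrow>
      aut M (act m a) = act (aut M m) (aut A a)"

locale left_hom_module = A: hom_algebra K A + M: hom_object K M
  for K :: "'k ring" and A :: "('k, 'a) hom_object"
    and M :: "('k, 'm, 'x) hom_object_scheme" and act :: "'a \<Rightarrow> 'm \<Rightarrow> 'm" +
  assumes act_bilinear: "act \<in> bilinear_map K A M M"
    and act_assoc: "\<lbrakk>m \<in> carrier M; a \<in> carrier A; b \<in> carrier A\<rbrakk> \<Longrightarrow>
      act (aut A a) (act b m) = act (a \<otimes>\<^bsub>A\<^esub> b) (aut M m)"
    and one_act: "m \<in> carrier M \<Longrightarrow> act \<one>\<^bsub>A\<^esub> m = aut M m"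
    and aut_act: "\<lbrakk>m \<in> carrier M; a \<in> carrier A\<rbrakk> \<Longrightarrow>
      aut M (act a m) = act (aut A a) (aut M m)"

locale hom_bimodule =
  left: left_hom_module K A M "lact M" + right: right_hom_module K A M "ract M"
  for K :: "'k ring" and A :: "('k, 'a) hom_object" and M :: "('k, 'm, 'a) hom_bimodule" +
  assumes bimodule_assoc: "\<lbrakk>m \<in> carrier M; a \<in> carrier A; b \<in> carrier A\<rbrakk> \<Longrightarrow>
      ract M (lact M a m) (aut A b) = lact M (aut A a) (ract M m b)"

definition hom_bimodule_morphism ::
  "'k ring \<Rightarrow> ('k, 'a) hom_object \<Rightarrow> ('k, 'm, 'a) hom_bimodule \<Rightarrow> ('k, 'n, 'a) hom_bimodule \<Rightarrow>
    ('m \<Rightarrow> 'n) set" where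
  "hom_bimodule_morphism K A M N =
    {f \<in> hom_morphism K M N. \<forall>a\<in>carrier A. \<forall>m\<in>carrier M.
      f (lact M a m) = lact N a (f m) \<and> f (ract M m a) = ract N (f m) a}"

definition regular_bimodule :: "('k, 'a) hom_object \<Rightarrow> ('k, 'a, 'a) hom_bimodule" where
  "regular_bimodule A = hom_object.extend A (hom_bimodule.fields (mult A) (mult A))"


section \<open>Tensor products over a Hom-algebra\<close>

type_synonym ('k, 'm, 'n) tensor_over = "('k, 'm, 'n) tensor set"

definition balancing_kernel ::
  "'k ring \<Rightarrow> ('k, 'a) hom_object \<Rightarrow> ('k, 'm, 'a) hom_bimodule \<Rightarrow> ('k, 'n, 'a) hom_bimodule \<Rightarrow>
    ('k, 'm, 'n) tensor set" where
  "balancing_kernel K A M N =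
    generated_submodule K (tensor K M N)
      {pure_tensor K M N (ract M m a) n
          \<ominus>\<^bsub>tensor K M N\<^esub> pure_tensor K M N (aut M m) (lact N a (aut_inv N n)) | m a n.
        m \<in> carrier M \<and> a \<in> carrier A \<and> n \<in> carrier N}"

definition tensor_over_module ::
  "'k ring \<Rightarrow> ('k, 'a) hom_object \<Rightarrow> ('k, 'm, 'a) hom_bimodule \<Rightarrow> ('k, 'n, 'a) hom_bimodule \<Rightarrow>
    ('k, ('k, 'm, 'n) tensor_over) module" where
  "tensor_over_module K A M N = quotient_module (tensor K M N) (balancing_kernel K A M N)"

definition pure_tensor_over ::
  "'k ring \<Rightarrow> ('k, 'a) hom_object \<Rightarrow> ('k, 'm, 'a) hom_bimodule \<Rightarrow> ('k, 'n, 'a) hom_bimodule \<Rightarrow>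
    'm \<Rightarrow> 'n \<Rightarrow> ('k, 'm, 'n) tensor_over" where
  "pure_tensor_over K A M N m n =
    balancing_kernel K A M N +>\<^bsub>tensor K M N\<^esub> pure_tensor K M N m n"

text \<open>\<open>sweedler\<close> for elements of \<open>M \<otimes>\<^sub>A N\<close>: choose a representative in \<open>M \<otimes> N\<close> first.\<close>

definition sweedler_over ::
  "'k ring \<Rightarrow> ('k, 'p, 'x) module_scheme \<Rightarrow> ('m \<Rightarrow> 'n \<Rightarrow> 'p) \<Rightarrow> ('k, 'm, 'n) tensor_over \<Rightarrow> 'p" where
  "sweedler_over K P \<phi> t = sweedler K P \<phi> (SOME u. u \<in> t)"

definition tensor_over ::
  "'k ring \<Rightarrow> ('k, 'a) hom_object \<Rightarrow> ('k, 'm, 'a) hom_bimodule \<Rightarrow> ('k, 'n, 'a) hom_bimodule \<Rightarrow>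
    ('k, ('k, 'm, 'n) tensor_over, 'a) hom_bimodule" where
  "tensor_over K A M N =
    (let T = tensor_over_module K A M N; tens = pure_tensor_over K A M N in
     hom_object.extend
      (module.extend T (hom_object.fields
        (sweedler_over K T (\<lambda>m n. tens (aut M m) (aut N n)))))
      (hom_bimodule.fields
        (\<lambda>a. sweedler_over K T (\<lambda>m n. tens (lact M (aut_inv A a) m) (aut N n)))
        (\<lambda>t a. sweedler_over K T (\<lambda>m n. tens (aut M m) (ract N n (aut_inv A a))) t)))"


section \<open>Monoidal Hom-coalgebras, Hom-comodules and Hom-corings\<close>

locale hom_coalgebra = hom_object K C
  for K :: "'k ring" and C :: "('k, 'c) hom_object"
    and \<Delta> :: "'c \<Rightarrow> ('k, 'c, 'c) tensor" and \<epsilon> :: "'c \<Rightarrow> 'k" +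
  assumes comul_linear: "\<Delta> \<in> linear_map K C (tensor K C C)"
    and counit_linear: "\<epsilon> \<in> linear_map K C (base_module K)"
    and hom_coassoc: "c \<in> carrier C \<Longrightarrow>
      (let CC = tensor K C C; T = tensor K C CC in
        sweedler K T (\<lambda>c1 c2. pure_tensor K C CC (aut_inv C c1) (\<Delta> c2)) (\<Delta> c) =
        sweedler K T (\<lambda>c1 c2. sweedler K T (\<lambda>c11 c12.
          pure_tensor K C CC c11 (pure_tensor K C C c12 (aut_inv C c2))) (\<Delta> c1)) (\<Delta> c))"
    and counit_left: "c \<in> carrier C \<Longrightarrow>
      sweedler K C (\<lambda>c1 c2. \<epsilon> c1 \<odot>\<^bsub>C\<^esub> c2) (\<Delta> c) = aut_inv C c"
    and counit_right: "c \<in> carrier C \<Longrightarrow>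
      sweedler K C (\<lambda>c1 c2. \<epsilon> c2 \<odot>\<^bsub>C\<^esub> c1) (\<Delta> c) = aut_inv C c"
    and comul_aut: "c \<in> carrier C \<Longrightarrow>
      \<Delta> (aut C c) =
        sweedler K (tensor K C C) (\<lambda>c1 c2. pure_tensor K C C (aut C c1) (aut C c2)) (\<Delta> c)"
    and counit_aut: "c \<in> carrier C \<Longrightarrow> \<epsilon> (aut C c) = \<epsilon> c"

locale right_hom_comodule = C: hom_coalgebra K C \<Delta> \<epsilon> + M: hom_object K M
  for K :: "'k ring" and C :: "('k, 'c) hom_object"
    and \<Delta> :: "'c \<Rightarrow> ('k, 'c, 'c) tensor" and \<epsilon> :: "'c \<Rightarrow> 'k"
    and M :: "('k, 'm) hom_object" and \<rho> :: "'m \<Rightarrow> ('k, 'm, 'c) tensor" +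
  assumes coact_linear: "\<rho> \<in> linear_map K M (tensor K M C)"
    and coact_coassoc: "m \<in> carrier M \<Longrightarrow>
      (let CC = tensor K C C; T = tensor K M CC in
        sweedler K T (\<lambda>m0 m1. pure_tensor K M CC (aut_inv M m0) (\<Delta> m1)) (\<rho> m) =
        sweedler K T (\<lambda>m0 m1. sweedler K T (\<lambda>m00 m01.
          pure_tensor K M CC m00 (pure_tensor K C C m01 (aut_inv C m1))) (\<rho> m0)) (\<rho> m))"
    and coact_counit: "m \<in> carrier M \<Longrightarrow>
      sweedler K M (\<lambda>m0 m1. \<epsilon> m1 \<odot>\<^bsub>M\<^esub> m0) (\<rho> m) = aut_inv M m"
    and coact_aut: "m \<in> carrier M \<Longrightarrow>
      \<rho> (aut M m) =
        sweedler K (tensor K M C) (\<lambda>m0 m1. pure_tensor K M C (aut M m0) (aut C m1)) (\<rho> m)"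

text \<open>
  \<open>comul_aut\<close> and \<open>counit_aut\<close> are already part of being a bimodule morphism; the customary list of
  axioms states them separately.
\<close>

locale hom_coring = A: hom_algebra K A + \<C>: hom_bimodule K A \<C>
  for K :: "'k ring" and A :: "('k, 'a) hom_object" and \<C> :: "('k, 'c, 'a) hom_bimodule"
    and \<Delta> :: "'c \<Rightarrow> ('k, 'c, 'c) tensor_over" and \<epsilon> :: "'c \<Rightarrow> 'a" +
  assumes comul_bilinear: "\<Delta> \<in> hom_bimodule_morphism K A \<C> (tensor_over K A \<C> \<C>)"
    and counit_bilinear: "\<epsilon> \<in> hom_bimodule_morphism K A \<C> (regular_bimodule A)"
    and hom_coassoc: "x \<in> carrier \<C> \<Longrightarrow>
      (let CC = tensor_over K A \<C> \<C>; T = tensor_over K A \<C> CC in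
        sweedler_over K T (\<lambda>x1 x2. pure_tensor_over K A \<C> CC x1 (\<Delta> x2)) (\<Delta> x) =
        sweedler_over K T (\<lambda>x1 x2. sweedler_over K T (\<lambda>x11 x12.
          pure_tensor_over K A \<C> CC (aut \<C> x11)
            (pure_tensor_over K A \<C> \<C> x12 (aut_inv \<C> x2))) (\<Delta> x1)) (\<Delta> x))"
    and counit_left: "x \<in> carrier \<C> \<Longrightarrow>
      sweedler_over K \<C> (\<lambda>x1 x2. lact \<C> (\<epsilon> x1) x2) (\<Delta> x) = x"
    and counit_right: "x \<in> carrier \<C> \<Longrightarrow>
      sweedler_over K \<C> (\<lambda>x1 x2. ract \<C> x1 (\<epsilon> x2)) (\<Delta> x) = x"
    and comul_aut: "x \<in> carrier \<C> \<Longrightarrow>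
      \<Delta> (aut \<C> x) = sweedler_over K (tensor_over K A \<C> \<C>)
        (\<lambda>x1 x2. pure_tensor_over K A \<C> \<C> (aut \<C> x1) (aut \<C> x2)) (\<Delta> x)"
    and counit_aut: "x \<in> carrier \<C> \<Longrightarrow> \<epsilon> (aut \<C> x) = aut A (\<epsilon> x)"


section \<open>Hom-bialgebras, comodule algebras and module coalgebras\<close>

locale hom_bialgebra = hom_algebra K B + hom_coalgebra K B \<Delta> \<epsilon>
  for K :: "'k ring" and B :: "('k, 'b) hom_object"
    and \<Delta> :: "'b \<Rightarrow> ('k, 'b, 'b) tensor" and \<epsilon> :: "'b \<Rightarrow> 'k" +
  assumes comul_mult: "\<lbrakk>b \<in> carrier B; b' \<in> carrier B\<rbrakk> \<Longrightarrow>
      (let T = tensor K B B in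
        \<Delta> (b \<otimes>\<^bsub>B\<^esub> b') = sweedler K T (\<lambda>b1 b2. sweedler K T (\<lambda>b'1 b'2.
          pure_tensor K B B (b1 \<otimes>\<^bsub>B\<^esub> b'1) (b2 \<otimes>\<^bsub>B\<^esub> b'2)) (\<Delta> b')) (\<Delta> b))"
    and comul_one: "\<Delta> \<one>\<^bsub>B\<^esub> = pure_tensor K B B \<one>\<^bsub>B\<^esub> \<one>\<^bsub>B\<^esub>"
    and counit_mult: "\<lbrakk>b \<in> carrier B; b' \<in> carrier B\<rbrakk> \<Longrightarrow> \<epsilon> (b \<otimes>\<^bsub>B\<^esub> b') = \<epsilon> b \<otimes>\<^bsub>K\<^esub> \<epsilon> b'"
    and counit_one: "\<epsilon> \<one>\<^bsub>B\<^esub> = \<one>\<^bsub>K\<^esub>"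

locale hom_comodule_algebra =
  B: hom_bialgebra K B \<Delta> \<epsilon> + A: hom_algebra K A + comod: right_hom_comodule K B \<Delta> \<epsilon> A \<rho>
  for K :: "'k ring" and B :: "('k, 'b) hom_object"
    and \<Delta> :: "'b \<Rightarrow> ('k, 'b, 'b) tensor" and \<epsilon> :: "'b \<Rightarrow> 'k"
    and A :: "('k, 'a) hom_object" and \<rho> :: "'a \<Rightarrow> ('k, 'a, 'b) tensor" +
  assumes coact_mult: "\<lbrakk>a \<in> carrier A; a' \<in> carrier A\<rbrakk> \<Longrightarrow>
      (let T = tensor K A B in
        \<rho> (a \<otimes>\<^bsub>A\<^esub> a') = sweedler K T (\<lambda>a0 a1. sweedler K T (\<lambda>a'0 a'1.
          pure_tensor K A B (a0 \<otimes>\<^bsub>A\<^esub> a'0) (a1 \<otimes>\<^bsub>B\<^esub> a'1)) (\<rho> a')) (\<rho> a))"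
    and coact_one: "\<rho> \<one>\<^bsub>A\<^esub> = pure_tensor K A B \<one>\<^bsub>A\<^esub> \<one>\<^bsub>B\<^esub>"

locale hom_module_coalgebra =
  B: hom_bialgebra K B \<Delta>\<^sub>B \<epsilon>\<^sub>B + C: hom_coalgebra K C \<Delta> \<epsilon> + mod: right_hom_module K B C act
  for K :: "'k ring" and B :: "('k, 'b) hom_object"
    and \<Delta>\<^sub>B :: "'b \<Rightarrow> ('k, 'b, 'b) tensor" and \<epsilon>\<^sub>B :: "'b \<Rightarrow> 'k"
    and C :: "('k, 'c) hom_object"
    and \<Delta> :: "'c \<Rightarrow> ('k, 'c, 'c) tensor" and \<epsilon> :: "'c \<Rightarrow> 'k"
    and act :: "'c \<Rightarrow> 'b \<Rightarrow> 'c" +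
  assumes comul_act: "\<lbrakk>c \<in> carrier C; b \<in> carrier B\<rbrakk> \<Longrightarrow>
      (let T = tensor K C C in
        \<Delta> (act c b) = sweedler K T (\<lambda>c1 c2. sweedler K T (\<lambda>b1 b2.
          pure_tensor K C C (act c1 b1) (act c2 b2)) (\<Delta>\<^sub>B b)) (\<Delta> c))"
    and counit_act: "\<lbrakk>c \<in> carrier C; b \<in> carrier B\<rbrakk> \<Longrightarrow> \<epsilon> (act c b) = \<epsilon> c \<otimes>\<^bsub>K\<^esub> \<epsilon>\<^sub>B b"


section \<open>Entwining structures and entwined modules\<close>

locale hom_entwining = A: hom_algebra K A + C: hom_coalgebra K C \<Delta> \<epsilon>
  for K :: "'k ring" and A :: "('k, 'a) hom_object" and C :: "('k, 'c) hom_object"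
    and \<Delta> :: "'c \<Rightarrow> ('k, 'c, 'c) tensor" and \<epsilon> :: "'c \<Rightarrow> 'k"
    and \<psi> :: "('k, 'c, 'a) tensor \<Rightarrow> ('k, 'a, 'c) tensor" +
  assumes psi_morphism: "\<psi> \<in> hom_morphism K (tensor K C A) (tensor K A C)"
    and psi_mult: "\<lbrakk>a \<in> carrier A; a' \<in> carrier A; c \<in> carrier C\<rbrakk> \<Longrightarrow>
      (let T = tensor K A C in
        \<psi> (pure_tensor K C A (aut C c) (a \<otimes>\<^bsub>A\<^esub> a')) =
        sweedler K T (\<lambda>a\<^sub>k c\<^sub>k. sweedler K T (\<lambda>a'\<^sub>l c\<^sub>k\<^sub>l.
          pure_tensor K A C (a\<^sub>k \<otimes>\<^bsub>A\<^esub> a'\<^sub>l) (aut C c\<^sub>k\<^sub>l))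
            (\<psi> (pure_tensor K C A c\<^sub>k a'))) (\<psi> (pure_tensor K C A c a)))"
    and psi_comul: "\<lbrakk>a \<in> carrier A; c \<in> carrier C\<rbrakk> \<Longrightarrow>
      (let CC = tensor K C C; T = tensor K A CC in
        sweedler K T (\<lambda>a\<^sub>k c\<^sub>k. pure_tensor K A CC (aut_inv A a\<^sub>k) (\<Delta> c\<^sub>k))
          (\<psi> (pure_tensor K C A c a)) =
        sweedler K T (\<lambda>c1 c2. sweedler K T (\<lambda>a\<^sub>k c2\<^sub>k. sweedler K T (\<lambda>a\<^sub>k\<^sub>l c1\<^sub>l.
          pure_tensor K A CC a\<^sub>k\<^sub>l (pure_tensor K C C c1\<^sub>l c2\<^sub>k))
            (\<psi> (pure_tensor K C A c1 a\<^sub>k))) (\<psi> (pure_tensor K C A c2 (aut_inv A a)))) (\<Delta> c))"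
    and psi_one: "c \<in> carrier C \<Longrightarrow>
      \<psi> (pure_tensor K C A c \<one>\<^bsub>A\<^esub>) = pure_tensor K A C \<one>\<^bsub>A\<^esub> c"
    and psi_counit: "\<lbrakk>a \<in> carrier A; c \<in> carrier C\<rbrakk> \<Longrightarrow>
      sweedler K A (\<lambda>a\<^sub>k c\<^sub>k. \<epsilon> c\<^sub>k \<odot>\<^bsub>A\<^esub> a\<^sub>k) (\<psi> (pure_tensor K C A c a)) = \<epsilon> c \<odot>\<^bsub>A\<^esub> a"

locale entwined_hom_module =
  ent: hom_entwining K A C \<Delta> \<epsilon> \<psi> + mod: right_hom_module K A M act +
  comod: right_hom_comodule K C \<Delta> \<epsilon> M \<rho>
  for K :: "'k ring" and A :: "('k, 'a) hom_object" and C :: "('k, 'c) hom_object"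
    and \<Delta> :: "'c \<Rightarrow> ('k, 'c, 'c) tensor" and \<epsilon> :: "'c \<Rightarrow> 'k"
    and \<psi> :: "('k, 'c, 'a) tensor \<Rightarrow> ('k, 'a, 'c) tensor"
    and M :: "('k, 'm) hom_object" and act :: "'m \<Rightarrow> 'a \<Rightarrow> 'm"
    and \<rho> :: "'m \<Rightarrow> ('k, 'm, 'c) tensor" +
  assumes coact_act: "\<lbrakk>m \<in> carrier M; a \<in> carrier A\<rbrakk> \<Longrightarrow>
      (let T = tensor K M C in
        \<rho> (act m a) = sweedler K T (\<lambda>m0 m1. sweedler K T (\<lambda>a\<^sub>k m1\<^sub>k.
          pure_tensor K M C (act m0 a\<^sub>k) (aut C m1\<^sub>k))
            (\<psi> (pure_tensor K C A m1 (aut_inv A a)))) (\<rho> m))"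

text \<open>
  \<open>\<psi>(c \<otimes> a) = \<alpha>(a\<^sub>0) \<otimes> \<gamma>\<^sup>-\<^sup>1(c) a\<^sub>1\<close>, where \<open>\<rho>\<close> is the coaction of \<open>B\<close> on \<open>A\<close> and \<open>act\<close> the action
  of \<open>B\<close> on \<open>C\<close>.  The maps below are given by their values on pure tensors and extended with
  \<open>sweedler\<close> in the same way.
\<close>

definition induced_psi ::
  "'k ring \<Rightarrow> ('k, 'a) hom_object \<Rightarrow> ('k, 'c) hom_object \<Rightarrow> ('a \<Rightarrow> ('k, 'a, 'b) tensor) \<Rightarrow>
    ('c \<Rightarrow> 'b \<Rightarrow> 'c) \<Rightarrow> ('k, 'c, 'a) tensor \<Rightarrow> ('k, 'a, 'c) tensor" where
  "induced_psi K A C \<rho> act =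
    sweedler K (tensor K A C) (\<lambda>c a. sweedler K (tensor K A C) (\<lambda>a0 a1.
      pure_tensor K A C (aut A a0) (act (aut_inv C c) a1)) (\<rho> a))"

definition induced_bimodule ::
  "'k ring \<Rightarrow> ('k, 'a) hom_object \<Rightarrow> ('k, 'c) hom_object \<Rightarrow> ('a \<Rightarrow> ('k, 'a, 'b) tensor) \<Rightarrow>
    ('c \<Rightarrow> 'b \<Rightarrow> 'c) \<Rightarrow> ('k, ('k, 'a, 'c) tensor, 'a) hom_bimodule" where
  "induced_bimodule K A C \<rho> act =
    (let T = tensor K A C in
     hom_object.extend T (hom_bimodule.fields
      (\<lambda>a. sweedler K T (\<lambda>a' c. pure_tensor K A C (aut_inv A a \<otimes>\<^bsub>A\<^esub> a') (aut C c)))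
      (\<lambda>t a. sweedler K T (\<lambda>a' c. sweedler K T (\<lambda>a0 a1.
        pure_tensor K A C (a' \<otimes>\<^bsub>A\<^esub> a0) (act c a1)) (\<rho> a)) t)))"

definition induced_comul ::
  "'k ring \<Rightarrow> ('k, 'a) hom_object \<Rightarrow> ('k, 'c) hom_object \<Rightarrow> ('c \<Rightarrow> ('k, 'c, 'c) tensor) \<Rightarrow>
    ('a \<Rightarrow> ('k, 'a, 'b) tensor) \<Rightarrow> ('c \<Rightarrow> 'b \<Rightarrow> 'c) \<Rightarrow>
    ('k, 'a, 'c) tensor \<Rightarrow> ('k, ('k, 'a, 'c) tensor, ('k, 'a, 'c) tensor) tensor_over" where
  "induced_comul K A C \<Delta> \<rho> act =
    (let \<C> = induced_bimodule K A C \<rho> act; T = tensor_over K A \<C> \<C> in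
     sweedler K T (\<lambda>a c. sweedler K T (\<lambda>c1 c2.
       pure_tensor_over K A \<C> \<C>
         (pure_tensor K A C (aut_inv A a) c1) (pure_tensor K A C \<one>\<^bsub>A\<^esub> c2)) (\<Delta> c)))"

definition induced_counit ::
  "'k ring \<Rightarrow> ('k, 'a) hom_object \<Rightarrow> ('c \<Rightarrow> 'k) \<Rightarrow> ('k, 'a, 'c) tensor \<Rightarrow> 'a" where
  "induced_counit K A \<epsilon> = sweedler K A (\<lambda>a c. \<epsilon> c \<odot>\<^bsub>A\<^esub> aut A a)"


section \<open>The convolution algebra of morphisms\<close>

text \<open>Not the locale \<^locale>\<open>algebra\<close> of the library, which is restricted to commutative algebras.\<close>

locale associative_algebra = module K H + ring H
  for K :: "'k ring" and H :: "('k, 'h) module" +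
  assumes smult_mult_left: "\<lbrakk>r \<in> carrier K; x \<in> carrier H; y \<in> carrier H\<rbrakk> \<Longrightarrow>
      (r \<odot>\<^bsub>H\<^esub> x) \<otimes>\<^bsub>H\<^esub> y = r \<odot>\<^bsub>H\<^esub> (x \<otimes>\<^bsub>H\<^esub> y)"
    and smult_mult_right: "\<lbrakk>r \<in> carrier K; x \<in> carrier H; y \<in> carrier H\<rbrakk> \<Longrightarrow>
      x \<otimes>\<^bsub>H\<^esub> (r \<odot>\<^bsub>H\<^esub> y) = r \<odot>\<^bsub>H\<^esub> (x \<otimes>\<^bsub>H\<^esub> y)"

text \<open>
  Morphisms \<open>C \<rightarrow> A\<close> are only determined on \<open>carrier C\<close>; taking them extensional makes each morphism
  a single element.
\<close>

definition hom_convolution_algebra ::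
  "'k ring \<Rightarrow> ('k, 'c) hom_object \<Rightarrow> ('c \<Rightarrow> ('k, 'c, 'c) tensor) \<Rightarrow> ('c \<Rightarrow> 'k) \<Rightarrow>
    ('k, 'a) hom_object \<Rightarrow> ('a \<Rightarrow> ('k, 'a, 'b) tensor) \<Rightarrow> ('c \<Rightarrow> 'b \<Rightarrow> 'c) \<Rightarrow>
    ('k, 'c \<Rightarrow> 'a) module" where
  "hom_convolution_algebra K C \<Delta> \<epsilon> A \<rho> act =
    \<lparr>carrier = hom_morphism K C A \<inter> extensional (carrier C),
     mult = (\<lambda>f g. \<lambda>c\<in>carrier C.
       sweedler K A (\<lambda>c1 c2. sweedler K A (\<lambda>f0 f1.
         aut A f0 \<otimes>\<^bsub>A\<^esub> g (act (aut_inv C c1) f1)) (\<rho> (f c2))) (\<Delta> c)),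
     one = (\<lambda>c\<in>carrier C. \<epsilon> c \<odot>\<^bsub>A\<^esub> \<one>\<^bsub>A\<^esub>),
     zero = (\<lambda>c\<in>carrier C. \<zero>\<^bsub>A\<^esub>),
     add = (\<lambda>f g. \<lambda>c\<in>carrier C. f c \<oplus>\<^bsub>A\<^esub> g c),
     smult = (\<lambda>r f. \<lambda>c\<in>carrier C. r \<odot>\<^bsub>A\<^esub> f c)\<rparr>"

end

theory Submission
  imports Defs
begin

text \<open>
  All claims are identities between multilinear expressions in Sweedler notation, and they are proved
  the way one proves them on paper. The free module on \<open>M \<times> N\<close> modulo the tensor relations has the
  universal property of the tensor product, so \<open>sweedler\<close> of a bilinear map is a well-defined linear
  map that takes the prescribed values on pure tensors. The same holds over a Hom-algebra for
  balanced maps and \<open>sweedler_over\<close>. Hence a Sweedler sum may be rewritten termwise, two independent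
  sums commute, linear maps pass under the sum, and every structure axiom becomes a rule that replaces
  a sum over the components of a compound element by a sum over the components of its parts, for an
  arbitrary multilinear summand. After these rules have been applied and all automorphisms have been
  moved to the variables, two sides of a claim differ at most by coassociativity.

  Coassociativity is therefore what carries each part. For the entwining, multiplicativity of \<open>\<psi>\<close> is
  multiplicativity of the coaction of \<open>A\<close>, and compatibility of \<open>\<psi>\<close> with \<open>\<Delta>\<close> is coassociativity of that
  coaction, the two components \<open>a\<^sub>1\<^sub>1\<close> and \<open>a\<^sub>1\<^sub>2\<close> acting on \<open>c\<^sub>1\<close> and \<open>c\<^sub>2\<close> (\<open>psi_mult\<close>, \<open>psi_comul\<close>). For entwined
  modules the twists in the compatibility condition cancel (\<open>entwined_compatibility\<close>). For the coring
  \<open>A \<otimes> C\<close>, right linearity of the comultiplication uses coassociativity of the coaction again, together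
  with the relation of the tensor product over \<open>A\<close> (\<open>comul_morphism\<close>); coassociativity and the counit laws
  are those of \<open>C\<close> (\<open>coring_coassoc\<close>, \<open>coring_counit\<close>). For the convolution product, associativity combines
  coassociativity of the coaction on the values of the first function with coassociativity of \<open>C\<close>
  (\<open>conv_assoc\<close>).
\<close>


section \<open>Linear maps\<close>

lemma linear_mapI:
  assumes "\<And>x. x \<in> carrier M \<Longrightarrow> f x \<in> carrier N"
    and "\<And>x y. \<lbrakk>x \<in> carrier M; y \<in> carrier M\<rbrakk> \<Longrightarrow> f (x \<oplus>\<^bsub>M\<^esub> y) = f x \<oplus>\<^bsub>N\<^esub> f y"
    and "\<And>r x. \<lbrakk>r \<in> carrier K; x \<in> carrier M\<rbrakk> \<Longrightarrow> f (r \<odot>\<^bsub>M\<^esub> x) = r \<odot>\<^bsub>N\<^esub> f x"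
  shows "f \<in> linear_map K M N"
  using assms by (auto simp: linear_map_def)

lemma
  assumes "f \<in> linear_map K M N" "x \<in> carrier M"
  shows linear_map_closed: "f x \<in> carrier N"
    and linear_map_add: "y \<in> carrier M \<Longrightarrow> f (x \<oplus>\<^bsub>M\<^esub> y) = f x \<oplus>\<^bsub>N\<^esub> f y"
    and linear_map_smult: "r \<in> carrier K \<Longrightarrow> f (r \<odot>\<^bsub>M\<^esub> x) = r \<odot>\<^bsub>N\<^esub> f x"
  using assms by (auto simp: linear_map_def)

lemma linear_map_cong:
  assumes "module K M" "f \<in> linear_map K M N" "\<And>x. x \<in> carrier M \<Longrightarrow> f x = g x"
  shows "g \<in> linear_map K M N"
proof -
  interpret module K M by fact
  show ?thesis using assms(2,3) by (auto simp: linear_map_def Pi_iff)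
qed

lemma linear_map_ident: "(\<lambda>x. x) \<in> linear_map K M M"
  by (auto simp: linear_map_def)

lemma linear_map_comp:
  assumes "f \<in> linear_map K M N" "g \<in> linear_map K X M"
  shows "(\<lambda>x. f (g x)) \<in> linear_map K X N"
  using assms by (auto simp: linear_map_def Pi_def)

lemma bilinear_mapI:
  assumes "\<And>x. x \<in> carrier M \<Longrightarrow> (\<lambda>y. \<phi> x y) \<in> linear_map K N P"
    and "\<And>y. y \<in> carrier N \<Longrightarrow> (\<lambda>x. \<phi> x y) \<in> linear_map K M P"
  shows "\<phi> \<in> bilinear_map K M N P"
  using assms by (auto simp: bilinear_map_def)

lemma
  assumes "\<phi> \<in> bilinear_map K M N P"
  shows bilinear_map_right: "x \<in> carrier M \<Longrightarrow> \<phi> x \<in> linear_map K N P"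
    and bilinear_map_left: "y \<in> carrier N \<Longrightarrow> (\<lambda>x. \<phi> x y) \<in> linear_map K M P"
    and bilinear_map_closed: "x \<in> carrier M \<Longrightarrow> y \<in> carrier N \<Longrightarrow> \<phi> x y \<in> carrier P"
  using assms by (auto simp: bilinear_map_def linear_map_def)

lemma linear_map_zero:
  assumes "f \<in> linear_map K M N" "module K M" "module K N"
  shows "f \<zero>\<^bsub>M\<^esub> = \<zero>\<^bsub>N\<^esub>"
proof -
  interpret M: module K M by fact
  interpret N: module K N by fact
  have "f (\<zero>\<^bsub>K\<^esub> \<odot>\<^bsub>M\<^esub> \<zero>\<^bsub>M\<^esub>) = \<zero>\<^bsub>K\<^esub> \<odot>\<^bsub>N\<^esub> f \<zero>\<^bsub>M\<^esub>"
    using assms(1) by (intro linear_map_smult) auto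
  with assms(1) show ?thesis
    by (simp add: linear_map_closed M.smult_r_null N.smult_l_null)
qed

lemma module_minus_eq_smult:
  assumes "module K M" "x \<in> carrier M"
  shows "\<ominus>\<^bsub>M\<^esub> x = (\<ominus>\<^bsub>K\<^esub> \<one>\<^bsub>K\<^esub>) \<odot>\<^bsub>M\<^esub> x"
proof -
  interpret M: module K M by fact
  show ?thesis using assms(2) M.smult_l_minus[of "\<one>\<^bsub>K\<^esub>" x] by simp
qed

lemma linear_map_minus:
  assumes f: "f \<in> linear_map K M N" and M: "module K M" and N: "module K N"
    and xy: "x \<in> carrier M" "y \<in> carrier M"
  shows "f (x \<ominus>\<^bsub>M\<^esub> y) = f x \<ominus>\<^bsub>N\<^esub> f y"
proof -
  interpret M: module K M by fact
  interpret N: module K N by fact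
  show ?thesis
    using f xy by (simp add: a_minus_def module_minus_eq_smult[OF M] module_minus_eq_smult[OF N]
        linear_map_add linear_map_smult linear_map_closed)
qed

lemma linear_map_finsum:
  assumes f: "f \<in> linear_map K M N" and M: "module K M" and N: "module K N"
    and "finite I" "g \<in> I \<rightarrow> carrier M"
  shows "f (\<Oplus>\<^bsub>M\<^esub>i\<in>I. g i) = (\<Oplus>\<^bsub>N\<^esub>i\<in>I. f (g i))"
proof -
  interpret M: module K M by fact
  interpret N: module K N by fact
  from assms(4,5) show ?thesis
  proof (induction I)
    case empty
    then show ?case using linear_map_zero[OF f M N] by simp
  next
    case (insert i I)
    then have "g \<in> I \<rightarrow> carrier M" "g i \<in> carrier M" "(\<lambda>i. f (g i)) \<in> I \<rightarrow> carrier N"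
      using f by (auto simp: linear_map_closed Pi_def)
    with insert f show ?case
      by (simp add: linear_map_add linear_map_closed)
  qed
qed

lemma linear_map_sum:
  assumes "module K P" "f \<in> linear_map K M P" "g \<in> linear_map K M P" "module K M"
  shows "(\<lambda>x. f x \<oplus>\<^bsub>P\<^esub> g x) \<in> linear_map K M P"
proof -
  interpret P: module K P by fact
  interpret M: module K M by fact
  show ?thesis
    using assms(2,3)
    by (auto intro!: linear_mapI simp: linear_map_closed linear_map_add linear_map_smult
        P.smult_r_distr P.a_ac)
qed

lemma linear_map_scale:
  assumes "module K P" "f \<in> linear_map K M P" "r \<in> carrier K"
  shows "(\<lambda>x. r \<odot>\<^bsub>P\<^esub> f x) \<in> linear_map K M P"
proof -
  interpret P: module K P by fact
  have "r \<odot>\<^bsub>P\<^esub> (s \<odot>\<^bsub>P\<^esub> y) = s \<odot>\<^bsub>P\<^esub> (r \<odot>\<^bsub>P\<^esub> y)" if "s \<in> carrier K" "y \<in> carrier P" for s y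
    using that assms(3) by (metis P.R.m_comm P.smult_assoc1)
  then show ?thesis
    using assms(2,3)
    by (auto intro!: linear_mapI simp: linear_map_closed linear_map_add linear_map_smult
        P.smult_r_distr)
qed

lemma linear_map_kernel_submodule:
  assumes f: "f \<in> linear_map K M N" and M: "module K M" and N: "module K N"
  shows "submodule {x \<in> carrier M. f x = \<zero>\<^bsub>N\<^esub>} K M"
proof -
  interpret M: module K M by fact
  interpret N: module K N by fact
  show ?thesis
    using f linear_map_zero[OF f M N]
    by (intro M.submoduleI)
       (auto simp: linear_map_add linear_map_smult module_minus_eq_smult[OF M])
qed

text \<open>Extensionality of linear maps is reduced to this: if the equalizer contains generators, it is
  everything.\<close>
lemma linear_map_equalizer_submodule:
  assumes f: "f \<in> linear_map K M N" and g: "g \<in> linear_map K M N"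
    and M: "module K M" and N: "module K N"
  shows "submodule {x \<in> carrier M. f x = g x} K M"
proof -
  interpret M: module K M by fact
  interpret N: module K N by fact
  show ?thesis
    using f g linear_map_zero[OF f M N] linear_map_zero[OF g M N]
    by (intro M.submoduleI)
       (auto simp: linear_map_add linear_map_smult module_minus_eq_smult[OF M])
qed

lemma generated_submodule_is_submodule:
  assumes "module K M" "X \<subseteq> carrier M"
  shows "submodule (generated_submodule K M X) K M"
proof -
  interpret M: module K M by fact
  have "carrier M \<in> {H. submodule H K M \<and> X \<subseteq> H}"
    using assms(2) M.carrier_is_submodule by auto
  then show ?thesis
    unfolding generated_submodule_def
    by (intro M.submoduleI) (auto simp: M.submoduleE dest: M.submoduleE(1) submodule.axioms(1)[THEN subgroup.one_closed])
qed

lemma generated_submodule_least: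
  "submodule H K M \<Longrightarrow> X \<subseteq> H \<Longrightarrow> generated_submodule K M X \<subseteq> H"
  by (auto simp: generated_submodule_def)

lemma generated_submodule_contains: "X \<subseteq> generated_submodule K M X"
  by (auto simp: generated_submodule_def)

section \<open>Free modules\<close>

lemma free_module_simps:
  "carrier (free_module K S) =
     {f. f \<in> S \<rightarrow> carrier K \<and> (\<forall>s. s \<notin> S \<longrightarrow> f s = \<zero>\<^bsub>K\<^esub>) \<and> finite {s. f s \<noteq> \<zero>\<^bsub>K\<^esub>}}"
  "zero (free_module K S) = (\<lambda>s. \<zero>\<^bsub>K\<^esub>)"
  "f \<oplus>\<^bsub>free_module K S\<^esub> g = (\<lambda>s. f s \<oplus>\<^bsub>K\<^esub> g s)"
  "r \<odot>\<^bsub>free_module K S\<^esub> f = (\<lambda>s. r \<otimes>\<^bsub>K\<^esub> f s)"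
  by (simp_all add: free_module_def)

lemma free_module_is_module:
  assumes "cring K"
  shows "module K (free_module K S)"
proof -
  interpret cring K by fact
  let ?F = "free_module K S"
  have cl: "f s \<in> carrier K" if "f \<in> carrier ?F" for f s
    using that by (cases "s \<in> S") (auto simp: free_module_simps)
  have fin2: "finite {s. f s \<oplus>\<^bsub>K\<^esub> g s \<noteq> \<zero>\<^bsub>K\<^esub>}"
    if "finite {s. f s \<noteq> \<zero>\<^bsub>K\<^esub>}" "finite {s. g s \<noteq> \<zero>\<^bsub>K\<^esub>}" for f g :: "'b \<Rightarrow> 'a"
    by (rule finite_subset[of _ "{s. f s \<noteq> \<zero>\<^bsub>K\<^esub>} \<union> {s. g s \<noteq> \<zero>\<^bsub>K\<^esub>}"]) (use that in auto)
  have fin1: "finite {s. r \<otimes>\<^bsub>K\<^esub> f s \<noteq> \<zero>\<^bsub>K\<^esub>}"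
    if "finite {s. f s \<noteq> \<zero>\<^bsub>K\<^esub>}" "r \<in> carrier K" for r and f :: "'b \<Rightarrow> 'a"
    by (rule finite_subset[of _ "{s. f s \<noteq> \<zero>\<^bsub>K\<^esub>}"]) (use that in auto)
  have add: "f \<oplus>\<^bsub>?F\<^esub> g \<in> carrier ?F" if "f \<in> carrier ?F" "g \<in> carrier ?F" for f g
    using that fin2[of f g] by (auto simp: free_module_simps Pi_def)
  have smult: "r \<odot>\<^bsub>?F\<^esub> f \<in> carrier ?F" if "f \<in> carrier ?F" "r \<in> carrier K" for f r
    using that fin1[of f r] by (auto simp: free_module_simps Pi_def)
  have zero: "\<zero>\<^bsub>?F\<^esub> \<in> carrier ?F" by (auto simp: free_module_simps)
  show ?thesis
  proof (rule moduleI)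
    show "abelian_group ?F"
    proof (rule abelian_groupI)
      fix f assume f: "f \<in> carrier ?F"
      show "\<exists>g\<in>carrier ?F. g \<oplus>\<^bsub>?F\<^esub> f = \<zero>\<^bsub>?F\<^esub>"
      proof
        show "(\<ominus>\<^bsub>K\<^esub> \<one>\<^bsub>K\<^esub>) \<odot>\<^bsub>?F\<^esub> f \<in> carrier ?F" using f smult by simp
        show "((\<ominus>\<^bsub>K\<^esub> \<one>\<^bsub>K\<^esub>) \<odot>\<^bsub>?F\<^esub> f) \<oplus>\<^bsub>?F\<^esub> f = \<zero>\<^bsub>?F\<^esub>"
          using cl[OF f] by (simp add: free_module_simps l_minus l_neg)
      qed
    next
      show "f \<oplus>\<^bsub>?F\<^esub> g \<oplus>\<^bsub>?F\<^esub> h = f \<oplus>\<^bsub>?F\<^esub> (g \<oplus>\<^bsub>?F\<^esub> h)"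
        if "f \<in> carrier ?F" "g \<in> carrier ?F" "h \<in> carrier ?F" for f g h
        using that cl by (simp add: free_module_simps(2-) a_assoc)
      show "f \<oplus>\<^bsub>?F\<^esub> g = g \<oplus>\<^bsub>?F\<^esub> f" if "f \<in> carrier ?F" "g \<in> carrier ?F" for f g
        using that cl by (simp add: free_module_simps(2-) a_comm)
      show "\<zero>\<^bsub>?F\<^esub> \<oplus>\<^bsub>?F\<^esub> f = f" if "f \<in> carrier ?F" for f
        using that cl by (simp add: free_module_simps(2-))
    qed (auto intro: add simp del: free_module_simps(3) simp: zero)
  qed (use cl smult[unfolded free_module_simps(4)] in \<open>auto intro: assms simp: free_module_simps(2-) l_distr r_distr m_assoc\<close>)
qed

lemma basis_vector_closed:
  assumes "cring K" "s \<in> S"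
  shows "basis_vector K s \<in> carrier (free_module K S)"
proof -
  interpret cring K by fact
  have "finite {t. basis_vector K s t \<noteq> \<zero>\<^bsub>K\<^esub>}"
    by (rule finite_subset[of _ "{s}"]) (auto simp: basis_vector_def)
  with assms(2) show ?thesis
    by (auto simp: free_module_simps basis_vector_def)
qed

text \<open>Induction on the size of the support: subtracting the coefficient at one basis element
  shrinks the support.\<close>
lemma free_module_span:
  assumes K: "cring K" and H: "submodule H K (free_module K S)"
    and basis: "\<And>s. s \<in> S \<Longrightarrow> basis_vector K s \<in> H"
  shows "carrier (free_module K S) \<subseteq> H"
proof
  interpret cring K by fact
  interpret F: module K "free_module K S" by (rule free_module_is_module[OF K])
  fix f assume "f \<in> carrier (free_module K S)"
  then show "f \<in> H"
  proof (induction "card {s. f s \<noteq> \<zero>\<^bsub>K\<^esub>}" arbitrary: f rule: less_induct)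
    case (less f)
    have fin: "finite {s. f s \<noteq> \<zero>\<^bsub>K\<^esub>}"
      using less.prems by (auto simp: free_module_simps)
    show ?case
    proof (cases "\<exists>s. f s \<noteq> \<zero>\<^bsub>K\<^esub>")
      case False
      then have "f = \<zero>\<^bsub>free_module K S\<^esub>" by (auto simp: free_module_simps)
      then show ?thesis
        using submodule.axioms(1)[OF H, THEN subgroup.one_closed] by simp
    next
      case True
      then obtain s where s: "f s \<noteq> \<zero>\<^bsub>K\<^esub>" by blast
      with less.prems have sS: "s \<in> S" and fs: "f s \<in> carrier K"
        by (auto simp: free_module_simps)
      let ?g = "f(s := \<zero>\<^bsub>K\<^esub>)"
      have sub: "{t. ?g t \<noteq> \<zero>\<^bsub>K\<^esub>} \<subset> {t. f t \<noteq> \<zero>\<^bsub>K\<^esub>}" using s by auto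
      then have "card {t. ?g t \<noteq> \<zero>\<^bsub>K\<^esub>} < card {t. f t \<noteq> \<zero>\<^bsub>K\<^esub>}"
        using fin by (rule psubset_card_mono[rotated])
      moreover have "finite {t. ?g t \<noteq> \<zero>\<^bsub>K\<^esub>}"
        using fin sub by (meson finite_subset psubset_imp_subset)
      then have g: "?g \<in> carrier (free_module K S)"
        using less.prems by (auto simp: free_module_simps Pi_def)
      ultimately have "?g \<in> H" by (rule less.hyps)
      moreover have "f s \<odot>\<^bsub>free_module K S\<^esub> basis_vector K s \<in> H"
        using fs basis[OF sS] F.submoduleE(4)[OF H] by blast
      moreover have "f t \<in> carrier K" for t
        using less.prems by (cases "t \<in> S") (auto simp: free_module_simps)
      then have "f = ?g \<oplus>\<^bsub>free_module K S\<^esub> (f s \<odot>\<^bsub>free_module K S\<^esub> basis_vector K s)"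
        by (auto simp: free_module_simps basis_vector_def)
      ultimately show ?thesis using F.submoduleE(5)[OF H] by metis
    qed
  qed
qed

text \<open>The linear extension of a function on the basis. The sum ranges over the support, so that it is
  literally the sum in the definition of \<open>sweedler\<close>.\<close>
definition free_lift :: "'k ring \<Rightarrow> ('k, 'p, 'x) module_scheme \<Rightarrow> ('s \<Rightarrow> 'p) \<Rightarrow> ('s \<Rightarrow> 'k) \<Rightarrow> 'p" where
  "free_lift K P \<phi> f = (\<Oplus>\<^bsub>P\<^esub>s\<in>{s. f s \<noteq> \<zero>\<^bsub>K\<^esub>}. f s \<odot>\<^bsub>P\<^esub> \<phi> s)"

lemma free_module_support:
  assumes "f \<in> carrier (free_module K S)"
  shows "finite {s. f s \<noteq> \<zero>\<^bsub>K\<^esub>}" "{s. f s \<noteq> \<zero>\<^bsub>K\<^esub>} \<subseteq> S" "s \<in> S \<Longrightarrow> f s \<in> carrier K"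
  using assms by (auto simp: free_module_simps)

text \<open>The supports of \<open>f\<close>, \<open>g\<close> and \<open>f + g\<close> differ; enlarging the index set to a common one is
  what makes additivity a termwise statement.\<close>
lemma free_lift_superset:
  assumes P: "module K P" and f: "f \<in> carrier (free_module K S)" and \<phi>: "\<phi> \<in> S \<rightarrow> carrier P"
    and T: "finite T" "{s. f s \<noteq> \<zero>\<^bsub>K\<^esub>} \<subseteq> T" "T \<subseteq> S"
  shows "free_lift K P \<phi> f = (\<Oplus>\<^bsub>P\<^esub>s\<in>T. f s \<odot>\<^bsub>P\<^esub> \<phi> s)"
proof -
  interpret P: module K P by fact
  note cl = free_module_support(3)[OF f]
  show ?thesis
    unfolding free_lift_def using T \<phi> cl
    by (intro P.add.finprod_mono_neutral_cong_left) (auto intro!: P.smult_l_null P.smult_closed)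
qed

lemma free_lift_linear:
  assumes P: "module K P" and \<phi>: "\<phi> \<in> S \<rightarrow> carrier P"
  shows "free_lift K P \<phi> \<in> linear_map K (free_module K S) P"
proof (rule linear_mapI)
  interpret P: module K P by fact
  interpret F: module K "free_module K S" by (rule free_module_is_module) (rule P.R.is_cring)
  note sup = free_module_support
  show "free_lift K P \<phi> f \<in> carrier P" if f: "f \<in> carrier (free_module K S)" for f
    unfolding free_lift_def
    by (rule P.finsum_closed) (use sup[OF f] \<phi> in blast)
  show "free_lift K P \<phi> (f \<oplus>\<^bsub>free_module K S\<^esub> g) = free_lift K P \<phi> f \<oplus>\<^bsub>P\<^esub> free_lift K P \<phi> g"
    if f: "f \<in> carrier (free_module K S)" and g: "g \<in> carrier (free_module K S)" for f g
  proof -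
    let ?h = "f \<oplus>\<^bsub>free_module K S\<^esub> g"
    have h: "?h \<in> carrier (free_module K S)" using f g by simp
    define T where "T = {s. f s \<noteq> \<zero>\<^bsub>K\<^esub>} \<union> {s. g s \<noteq> \<zero>\<^bsub>K\<^esub>}"
    have T: "finite T" "T \<subseteq> S" "{s. f s \<noteq> \<zero>\<^bsub>K\<^esub>} \<subseteq> T" "{s. g s \<noteq> \<zero>\<^bsub>K\<^esub>} \<subseteq> T"
      "{s. ?h s \<noteq> \<zero>\<^bsub>K\<^esub>} \<subseteq> T"
      using sup[OF f] sup[OF g] by (auto simp: T_def free_module_simps(3))
    have cl: "\<phi> s \<in> carrier P" "f s \<in> carrier K" "g s \<in> carrier K" if "s \<in> T" for s
      using that T(2) sup(3)[OF f] sup(3)[OF g] \<phi> by auto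
    have "(\<Oplus>\<^bsub>P\<^esub>s\<in>T. ?h s \<odot>\<^bsub>P\<^esub> \<phi> s) = (\<Oplus>\<^bsub>P\<^esub>s\<in>T. (f s \<odot>\<^bsub>P\<^esub> \<phi> s) \<oplus>\<^bsub>P\<^esub> (g s \<odot>\<^bsub>P\<^esub> \<phi> s))"
      by (rule P.finsum_cong') (auto simp: free_module_simps(3) P.smult_l_distr cl)
    also have "\<dots> = (\<Oplus>\<^bsub>P\<^esub>s\<in>T. f s \<odot>\<^bsub>P\<^esub> \<phi> s) \<oplus>\<^bsub>P\<^esub> (\<Oplus>\<^bsub>P\<^esub>s\<in>T. g s \<odot>\<^bsub>P\<^esub> \<phi> s)"
      by (rule P.finsum_addf) (auto simp: cl)
    finally show ?thesis
      unfolding free_lift_superset[OF P f \<phi> T(1,3,2)] free_lift_superset[OF P g \<phi> T(1,4,2)]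
        free_lift_superset[OF P h \<phi> T(1,5,2)] .
  qed
  show "free_lift K P \<phi> (r \<odot>\<^bsub>free_module K S\<^esub> f) = r \<odot>\<^bsub>P\<^esub> free_lift K P \<phi> f"
    if r: "r \<in> carrier K" and f: "f \<in> carrier (free_module K S)" for r f
  proof -
    let ?h = "r \<odot>\<^bsub>free_module K S\<^esub> f"
    have h: "?h \<in> carrier (free_module K S)" using f r by simp
    define T where "T = {s. f s \<noteq> \<zero>\<^bsub>K\<^esub>}"
    have T: "finite T" "T \<subseteq> S" "{s. f s \<noteq> \<zero>\<^bsub>K\<^esub>} \<subseteq> T" "{s. ?h s \<noteq> \<zero>\<^bsub>K\<^esub>} \<subseteq> T"
      using sup[OF f] r by (auto simp: T_def free_module_simps(4))
    have cl: "\<phi> s \<in> carrier P" "f s \<in> carrier K" if "s \<in> T" for s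
      using that T(2) sup(3)[OF f] \<phi> by auto
    show ?thesis
      unfolding free_lift_superset[OF P f \<phi> T(1,3,2)] free_lift_superset[OF P h \<phi> T(1,4,2)]
      by (subst P.finsum_smult_ldistr)
         (auto intro!: P.finsum_cong' simp: free_module_simps(4) P.smult_assoc1 cl r T)
  qed
qed

lemma free_lift_basis:
  assumes P: "module K P" and \<phi>: "\<phi> \<in> S \<rightarrow> carrier P" and s: "s \<in> S"
  shows "free_lift K P \<phi> (basis_vector K s) = \<phi> s"
proof -
  interpret P: module K P by fact
  have "free_lift K P \<phi> (basis_vector K s) = (\<Oplus>\<^bsub>P\<^esub>t\<in>{s}. basis_vector K s t \<odot>\<^bsub>P\<^esub> \<phi> t)"
    by (rule free_lift_superset[OF P basis_vector_closed[OF P.R.is_cring s] \<phi>])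
       (use s in \<open>auto simp: basis_vector_def\<close>)
  also have "\<dots> = \<phi> s"
    using \<phi> s by (simp add: P.add.finprod_insert[of "{}", simplified] basis_vector_def Pi_iff)
  finally show ?thesis .
qed

section \<open>Quotient modules\<close>

lemma quotient_module_simps:
  "carrier (quotient_module M H) = a_rcosets\<^bsub>M\<^esub> H"
  "zero (quotient_module M H) = H"
  "X \<oplus>\<^bsub>quotient_module M H\<^esub> Y = X <+>\<^bsub>M\<^esub> Y"
  "r \<odot>\<^bsub>quotient_module M H\<^esub> X = (\<Union>x\<in>X. H +>\<^bsub>M\<^esub> (r \<odot>\<^bsub>M\<^esub> x))"
  by (simp_all add: quotient_module_def)

locale module_quotient = module K M for K :: "'k ring" and M :: "('k, 'm, 'x) module_scheme" +
  fixes H assumes submodule: "submodule H K M"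
begin

sublocale abelian_subgroup H M
  by (intro abelian_subgroupI3 additive_subgroupI abelian_group_axioms
      submodule.axioms(1)[OF submodule])


lemma rcosets_eq: "a_rcosets\<^bsub>M\<^esub> H = (\<lambda>x. H +>\<^bsub>M\<^esub> x) ` carrier M"
  by (auto simp: A_RCOSETS_def')

lemma coset_eqI:
  assumes "x \<in> carrier M" "y \<in> carrier M" "x \<ominus>\<^bsub>M\<^esub> y \<in> H"
  shows "H +>\<^bsub>M\<^esub> x = H +>\<^bsub>M\<^esub> y"
proof -
  have "x \<in> H +>\<^bsub>M\<^esub> y"
    using assms a_rcos_module[of y x] by (simp add: a_minus_def)
  then show ?thesis
    by (rule a_repr_independence[OF _ assms(2) a_subgroup, symmetric])
qed

lemma coset_memD:
  assumes "y \<in> H +>\<^bsub>M\<^esub> x" "x \<in> carrier M"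
  shows "y \<in> carrier M" "y \<ominus>\<^bsub>M\<^esub> x \<in> H"
proof -
  show y: "y \<in> carrier M"
    using assms a_subset a_r_coset_subset_G by blast
  show "y \<ominus>\<^bsub>M\<^esub> x \<in> H"
    using assms y a_rcos_module[of x y] by (simp add: a_minus_def)
qed

lemma quotient_smult_coset:
  assumes "r \<in> carrier K" "x \<in> carrier M"
  shows "r \<odot>\<^bsub>quotient_module M H\<^esub> (H +>\<^bsub>M\<^esub> x) = H +>\<^bsub>M\<^esub> (r \<odot>\<^bsub>M\<^esub> x)"
proof -
  have "H +>\<^bsub>M\<^esub> (r \<odot>\<^bsub>M\<^esub> y) = H +>\<^bsub>M\<^esub> (r \<odot>\<^bsub>M\<^esub> x)" if y: "y \<in> H +>\<^bsub>M\<^esub> x" for y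
  proof (rule coset_eqI)
    note D = coset_memD[OF y assms(2)]
    have "r \<odot>\<^bsub>M\<^esub> y \<ominus>\<^bsub>M\<^esub> r \<odot>\<^bsub>M\<^esub> x = r \<odot>\<^bsub>M\<^esub> (y \<ominus>\<^bsub>M\<^esub> x)"
      using assms D(1) by (simp add: a_minus_def smult_r_distr smult_r_minus)
    then show "r \<odot>\<^bsub>M\<^esub> y \<ominus>\<^bsub>M\<^esub> r \<odot>\<^bsub>M\<^esub> x \<in> H"
      using submodule.smult_closed[OF submodule assms(1) D(2)] by simp
  qed (use assms coset_memD(1)[OF y assms(2)] in auto)
  moreover have "H +>\<^bsub>M\<^esub> x \<noteq> {}" using a_rcos_self[OF assms(2)] by blast
  ultimately show ?thesis unfolding quotient_module_simps by (intro SUP_eq_const)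
qed

lemma quotient_add_coset:
  assumes "x \<in> carrier M" "y \<in> carrier M"
  shows "(H +>\<^bsub>M\<^esub> x) \<oplus>\<^bsub>quotient_module M H\<^esub> (H +>\<^bsub>M\<^esub> y) = H +>\<^bsub>M\<^esub> (x \<oplus>\<^bsub>M\<^esub> y)"
  using assms by (simp add: quotient_module_simps a_rcos_sum)

lemma coset_closed: "x \<in> carrier M \<Longrightarrow> H +>\<^bsub>M\<^esub> x \<in> carrier (quotient_module M H)"
  by (auto simp: quotient_module_simps rcosets_eq)

lemma quotient_zero_coset: "\<zero>\<^bsub>quotient_module M H\<^esub> = H +>\<^bsub>M\<^esub> \<zero>\<^bsub>M\<^esub>"
  using a_subset by (simp add: quotient_module_simps)

lemma quotient_carrierE:
  assumes "X \<in> carrier (quotient_module M H)"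
  shows "\<exists>x\<in>carrier M. X = H +>\<^bsub>M\<^esub> x"
  using assms by (auto simp: quotient_module_simps rcosets_eq)

lemma quotient_module_is_module: "module K (quotient_module M H)"
proof (rule moduleI)
  let ?Q = "quotient_module M H"
  note qs = quotient_add_coset quotient_smult_coset quotient_zero_coset coset_closed
  have E: thesis if "X \<in> carrier ?Q" "\<And>x. \<lbrakk>x \<in> carrier M; X = H +>\<^bsub>M\<^esub> x\<rbrakk> \<Longrightarrow> thesis" for X thesis
    using that quotient_carrierE by metis
  show "cring K" by (rule R.is_cring)
  show "abelian_group ?Q"
  proof (rule abelian_groupI)
    fix X assume X: "X \<in> carrier ?Q"
    then show "\<zero>\<^bsub>?Q\<^esub> \<oplus>\<^bsub>?Q\<^esub> X = X" by (elim E) (simp add: qs)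
    show "\<exists>Y\<in>carrier ?Q. Y \<oplus>\<^bsub>?Q\<^esub> X = \<zero>\<^bsub>?Q\<^esub>"
      using X
    proof (rule E)
      fix x assume "x \<in> carrier M" "X = H +>\<^bsub>M\<^esub> x"
      then show ?thesis by (intro bexI[of _ "H +>\<^bsub>M\<^esub> (\<ominus>\<^bsub>M\<^esub> x)"]) (simp_all add: qs M.l_neg)
    qed
    fix Y assume Y: "Y \<in> carrier ?Q"
    show "X \<oplus>\<^bsub>?Q\<^esub> Y \<in> carrier ?Q" "X \<oplus>\<^bsub>?Q\<^esub> Y = Y \<oplus>\<^bsub>?Q\<^esub> X"
      by (rule E[OF X], rule E[OF Y], simp add: qs M.a_comm)+
    fix Z assume Z: "Z \<in> carrier ?Q"
    show "X \<oplus>\<^bsub>?Q\<^esub> Y \<oplus>\<^bsub>?Q\<^esub> Z = X \<oplus>\<^bsub>?Q\<^esub> (Y \<oplus>\<^bsub>?Q\<^esub> Z)"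
      using X Y Z by (elim E) (simp add: qs M.a_assoc)
  qed (simp add: qs)
  fix X assume X: "X \<in> carrier ?Q"
  then show "\<one>\<^bsub>K\<^esub> \<odot>\<^bsub>?Q\<^esub> X = X" by (elim E) (simp add: qs)
  fix r assume r: "r \<in> carrier K"
  with X show "r \<odot>\<^bsub>?Q\<^esub> X \<in> carrier ?Q" by (elim E) (simp add: qs)
  show "r \<odot>\<^bsub>?Q\<^esub> (X \<oplus>\<^bsub>?Q\<^esub> Y) = r \<odot>\<^bsub>?Q\<^esub> X \<oplus>\<^bsub>?Q\<^esub> r \<odot>\<^bsub>?Q\<^esub> Y" if "Y \<in> carrier ?Q" for Y
    using X r that by (elim E) (simp add: qs smult_r_distr)
  fix s assume s: "s \<in> carrier K"
  show "(r \<oplus>\<^bsub>K\<^esub> s) \<odot>\<^bsub>?Q\<^esub> X = r \<odot>\<^bsub>?Q\<^esub> X \<oplus>\<^bsub>?Q\<^esub> s \<odot>\<^bsub>?Q\<^esub> X"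
    "(r \<otimes>\<^bsub>K\<^esub> s) \<odot>\<^bsub>?Q\<^esub> X = r \<odot>\<^bsub>?Q\<^esub> (s \<odot>\<^bsub>?Q\<^esub> X)"
    by (rule E[OF X], simp add: qs smult_l_distr smult_assoc1 r s)+
qed

lemma coset_linear: "(\<lambda>x. H +>\<^bsub>M\<^esub> x) \<in> linear_map K M (quotient_module M H)"
  by (rule linear_mapI) (simp_all add: quotient_add_coset quotient_smult_coset coset_closed)

lemma quotient_rep:
  assumes "t \<in> carrier (quotient_module M H)"
  shows "(SOME x. x \<in> t) \<in> carrier M" "H +>\<^bsub>M\<^esub> (SOME x. x \<in> t) = t"
proof -
  obtain x where x: "x \<in> carrier M" "t = H +>\<^bsub>M\<^esub> x"
    using assms by (auto simp: quotient_module_simps rcosets_eq)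
  then have "x \<in> t" using a_rcos_self by simp
  then have "(SOME x. x \<in> t) \<in> t" by (rule someI)
  then have y: "(SOME x. x \<in> t) \<in> H +>\<^bsub>M\<^esub> x" using x(2) by simp
  show "(SOME x. x \<in> t) \<in> carrier M" by (rule coset_memD(1)[OF y x(1)])
  show "H +>\<^bsub>M\<^esub> (SOME x. x \<in> t) = t"
    using a_repr_independence[OF y x(1) a_subgroup] x(2) by simp
qed

text \<open>A linear map that kills the submodule takes the same value on all representatives of a
  coset, so evaluating it at a chosen representative is the induced map.\<close>
lemma
  assumes P: "module K P" and L: "L \<in> linear_map K M P"
    and kills: "\<And>h. h \<in> H \<Longrightarrow> L h = \<zero>\<^bsub>P\<^esub>"
  shows quotient_lift_coset: "x \<in> carrier M \<Longrightarrow> L (SOME y. y \<in> H +>\<^bsub>M\<^esub> x) = L x"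
    and quotient_lift_linear: "(\<lambda>t. L (SOME y. y \<in> t)) \<in> linear_map K (quotient_module M H) P"
proof -
  interpret P: module K P by fact
  show eval: "L (SOME y. y \<in> H +>\<^bsub>M\<^esub> x) = L x" if x: "x \<in> carrier M" for x
  proof -
    let ?y = "SOME y. y \<in> H +>\<^bsub>M\<^esub> x"
    have "?y \<in> H +>\<^bsub>M\<^esub> x" by (rule someI, rule a_rcos_self) fact
    note D = coset_memD[OF this x]
    have "L ?y \<ominus>\<^bsub>P\<^esub> L x = \<zero>\<^bsub>P\<^esub>"
      using kills[OF D(2)] linear_map_minus[OF L module_axioms P D(1) x] by simp
    then show ?thesis
      using linear_map_closed[OF L x] linear_map_closed[OF L D(1)]
        P.minus_equality[of "L ?y" "\<ominus>\<^bsub>P\<^esub> L x"] by (simp add: a_minus_def)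
  qed
  show "(\<lambda>t. L (SOME y. y \<in> t)) \<in> linear_map K (quotient_module M H) P"
  proof (rule linear_mapI)
    fix X assume "X \<in> carrier (quotient_module M H)"
    then obtain x where x: "x \<in> carrier M" "X = H +>\<^bsub>M\<^esub> x" using quotient_carrierE by blast
    then show "L (SOME y. y \<in> X) \<in> carrier P"
      by (simp add: eval linear_map_closed[OF L])
    show "L (SOME y. y \<in> r \<odot>\<^bsub>quotient_module M H\<^esub> X) = r \<odot>\<^bsub>P\<^esub> L (SOME y. y \<in> X)"
      if "r \<in> carrier K" for r
      using x that by (simp add: quotient_smult_coset eval linear_map_smult[OF L])
    fix Y assume "Y \<in> carrier (quotient_module M H)"
    then obtain y where y: "y \<in> carrier M" "Y = H +>\<^bsub>M\<^esub> y" using quotient_carrierE by blast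
    show "L (SOME y. y \<in> X \<oplus>\<^bsub>quotient_module M H\<^esub> Y) = L (SOME y. y \<in> X) \<oplus>\<^bsub>P\<^esub> L (SOME y. y \<in> Y)"
      using x y by (simp add: quotient_add_coset eval linear_map_add[OF L])
  qed
qed

end


section \<open>Tensor products\<close>

text \<open>The value of the fold depends on the factors alone, whether or not they lie in the carrier. A
  congruence rule free of carrier conditions lets the simplifier rewrite inside Sweedler sums.\<close>
lemma foldSetD_cong:
  assumes "(A, y) \<in> foldSetD D f e" "\<And>x. x \<in> A \<Longrightarrow> f x = g x"
  shows "(A, y) \<in> foldSetD D g e"
  using assms by (induction rule: foldSetD.induct) (metis foldSetD.intros insertCI)+

lemma finprod_cong_pointwise:
  assumes "\<And>x. x \<in> A \<Longrightarrow> f x = g x"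
  shows "finprod G f A = finprod G g A"
proof -
  have "(A, y) \<in> foldSetD (carrier G) (mult G \<circ> f) \<one>\<^bsub>G\<^esub> \<longleftrightarrow>
      (A, y) \<in> foldSetD (carrier G) (mult G \<circ> g) \<one>\<^bsub>G\<^esub>" for y
    using assms foldSetD_cong[of A y "carrier G" "mult G \<circ> f" "\<one>\<^bsub>G\<^esub>" "mult G \<circ> g"]
      foldSetD_cong[of A y "carrier G" "mult G \<circ> g" "\<one>\<^bsub>G\<^esub>" "mult G \<circ> f"]
    by auto
  then show ?thesis by (simp add: finprod_def foldD_def)
qed

lemma free_lift_cong:
  assumes "f \<in> carrier (free_module K S)" "\<And>s. s \<in> S \<Longrightarrow> \<phi> s = \<phi>' s"
  shows "free_lift K P \<phi> f = free_lift K P \<phi>' f"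
  unfolding free_lift_def finsum_def
  by (rule finprod_cong_pointwise) (use assms free_module_support(2) in fastforce)

lemma linear_free_lift:
  assumes "module K P" "module K Q" "g \<in> linear_map K P Q" and f: "f \<in> carrier (free_module K S)"
    and "\<phi> \<in> S \<rightarrow> carrier P"
  shows "g (free_lift K P \<phi> f) = free_lift K Q (\<lambda>s. g (\<phi> s)) f"
proof -
  interpret P: module K P by fact
  interpret Q: module K Q by fact
  note sup = free_module_support[OF f]
  have cl: "s \<in> {s. f s \<noteq> \<zero>\<^bsub>K\<^esub>} \<Longrightarrow> \<phi> s \<in> carrier P \<and> f s \<in> carrier K" for s
    using sup assms(5) by auto
  have "g (free_lift K P \<phi> f) = (\<Oplus>\<^bsub>Q\<^esub>s\<in>{s. f s \<noteq> \<zero>\<^bsub>K\<^esub>}. g (f s \<odot>\<^bsub>P\<^esub> \<phi> s))"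
    unfolding free_lift_def
    by (rule linear_map_finsum[OF assms(3,1,2) sup(1)]) (use cl in auto)
  also have "\<dots> = free_lift K Q (\<lambda>s. g (\<phi> s)) f"
    unfolding free_lift_def finsum_def
    by (rule finprod_cong_pointwise) (use cl linear_map_smult[OF assms(3)] in blast)
  finally show ?thesis .
qed

lemma free_lift_linear_in_function:
  assumes P: "module K P" and X: "module K X" and f: "f \<in> carrier (free_module K S)"
    and \<phi>: "\<And>s. s \<in> S \<Longrightarrow> (\<lambda>x. \<phi> x s) \<in> linear_map K X P"
  shows "(\<lambda>x. free_lift K P (\<phi> x) f) \<in> linear_map K X P"
proof -
  interpret P: module K P by fact
  interpret X: module K X by fact
  note sup = free_module_support[OF f]
  have step: "(\<lambda>x. \<Oplus>\<^bsub>P\<^esub>s\<in>T. f s \<odot>\<^bsub>P\<^esub> \<phi> x s) \<in> linear_map K X P" if "finite T" "T \<subseteq> S" for T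
    using that
  proof (induction T)
    case empty
    then show ?case by (auto intro!: linear_mapI)
  next
    case (insert s T)
    then have "s \<in> S" "f s \<in> carrier K" using sup(3) by auto
    then have lin: "(\<lambda>x. f s \<odot>\<^bsub>P\<^esub> \<phi> x s) \<in> linear_map K X P"
      by (intro linear_map_scale[OF P \<phi>])
    show ?case
    proof (rule linear_map_cong[OF X linear_map_sum[OF P lin insert.IH X]])
      fix x assume x: "x \<in> carrier X"
      have "f t \<odot>\<^bsub>P\<^esub> \<phi> x t \<in> carrier P" if "t \<in> insert s T" for t
        using that insert.prems sup(3) linear_map_closed[OF \<phi> x] by (intro P.smult_closed) auto
      then show "f s \<odot>\<^bsub>P\<^esub> \<phi> x s \<oplus>\<^bsub>P\<^esub> (\<Oplus>\<^bsub>P\<^esub>s\<in>T. f s \<odot>\<^bsub>P\<^esub> \<phi> x s) =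
          (\<Oplus>\<^bsub>P\<^esub>s\<in>insert s T. f s \<odot>\<^bsub>P\<^esub> \<phi> x s)"
        using insert.hyps by (subst P.finsum_insert) auto
    qed (use insert.prems in auto)
  qed
  show ?thesis unfolding free_lift_def by (rule step[OF sup(1,2)])
qed

text \<open>Both sides are linear in \<open>g\<close>, so it is enough to compare them on basis vectors.\<close>
lemma free_lift_swap:
  assumes P: "module K P" and f: "f \<in> carrier (free_module K S)" and g: "g \<in> carrier (free_module K T)"
    and \<phi>: "\<And>s t. s \<in> S \<Longrightarrow> t \<in> T \<Longrightarrow> \<phi> s t \<in> carrier P"
  shows "free_lift K P (\<lambda>s. free_lift K P (\<phi> s) g) f = free_lift K P (\<lambda>t. free_lift K P (\<lambda>s. \<phi> s t) f) g"
proof -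
  interpret P: module K P by fact
  let ?l = "\<lambda>g. free_lift K P (\<lambda>s. free_lift K P (\<phi> s) g) f"
  let ?r = "\<lambda>g. free_lift K P (\<lambda>t. free_lift K P (\<lambda>s. \<phi> s t) f) g"
  note K = P.R.is_cring
  note F = free_module_is_module[OF K]
  have r: "(\<lambda>t. free_lift K P (\<lambda>s. \<phi> s t) f) \<in> T \<rightarrow> carrier P"
  proof
    fix t assume "t \<in> T"
    with \<phi> show "free_lift K P (\<lambda>s. \<phi> s t) f \<in> carrier P"
      by (intro linear_map_closed[OF free_lift_linear[OF P] f]) auto
  qed
  have "?l \<in> linear_map K (free_module K T) P"
    by (rule free_lift_linear_in_function[OF P F f free_lift_linear[OF P]]) (use \<phi> in auto)
  moreover have "?r \<in> linear_map K (free_module K T) P"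
    by (rule free_lift_linear[OF P r])
  ultimately have "submodule {g \<in> carrier (free_module K T). ?l g = ?r g} K (free_module K T)"
    by (rule linear_map_equalizer_submodule[OF _ _ F P])
  then have "carrier (free_module K T) \<subseteq> {g \<in> carrier (free_module K T). ?l g = ?r g}"
  proof (rule free_module_span[OF K])
    fix t assume t: "t \<in> T"
    have "free_lift K P (\<phi> s) (basis_vector K t) = \<phi> s t" if "s \<in> S" for s
      by (rule free_lift_basis[OF P _ t]) (use \<phi> that in auto)
    then have "?l (basis_vector K t) = free_lift K P (\<lambda>s. \<phi> s t) f"
      by (rule free_lift_cong[OF f])
    then show "basis_vector K t \<in> {g \<in> carrier (free_module K T). ?l g = ?r g}"
      using free_lift_basis[OF P r t] t by (simp add: basis_vector_closed[OF K])
  qed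
  with g show ?thesis by blast
qed

lemma sweedler_eq_free_lift:
  "sweedler K P \<phi> = (\<lambda>t. free_lift K P (\<lambda>s. \<phi> (fst s) (snd s)) (SOME f. f \<in> t))"
  by (simp add: fun_eq_iff sweedler_def free_lift_def Let_def)

locale tensor_product = M: module K M + N: module K N
  for K :: "'k ring" and M :: "('k, 'm, 'x) module_scheme" and N :: "('k, 'n, 'y) module_scheme"
begin

abbreviation "Fr \<equiv> free_module K (carrier M \<times> carrier N)"
abbreviation "ker \<equiv> tensor_kernel K M N"
abbreviation "e m n \<equiv> basis_vector K (m, n)"

sublocale F: module K Fr by (rule free_module_is_module) (rule M.R.is_cring)

lemma basis_closed: "m \<in> carrier M \<Longrightarrow> n \<in> carrier N \<Longrightarrow> e m n \<in> carrier Fr"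
  by (rule basis_vector_closed) (auto intro: M.R.is_cring)

lemma relations_closed: "tensor_relations K M N \<subseteq> carrier Fr"
  unfolding tensor_relations_def Let_def
  by (auto intro!: F.minus_closed F.a_closed F.smult_closed basis_closed)

sublocale Q: module_quotient K Fr ker
  by (intro module_quotient.intro module_quotient_axioms.intro F.module_axioms)
     (simp add: tensor_kernel_def generated_submodule_is_submodule F.module_axioms relations_closed)

lemma tensor_module_is_module: "module K (tensor_module K M N)"
  unfolding tensor_module_def by (rule Q.quotient_module_is_module)

lemma relation_in_kernel: "x \<in> tensor_relations K M N \<Longrightarrow> x \<in> ker"
  using generated_submodule_contains[of "tensor_relations K M N"] by (auto simp: tensor_kernel_def)

lemma pure_tensor_module_bilinear: "pure_tensor K M N \<in> bilinear_map K M N (tensor_module K M N)"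
proof (rule bilinear_mapI; rule linear_mapI)
  have coset: "ker +>\<^bsub>Fr\<^esub> x = ker +>\<^bsub>Fr\<^esub> y"
    if "x \<ominus>\<^bsub>Fr\<^esub> y \<in> tensor_relations K M N" "x \<in> carrier Fr" "y \<in> carrier Fr" for x y
    using that by (intro Q.coset_eqI relation_in_kernel)
  note simps = pure_tensor_def tensor_module_def basis_closed Q.quotient_add_coset Q.quotient_smult_coset
    Q.coset_closed
  fix m n assume mn: "m \<in> carrier M" "n \<in> carrier N"
  then show "pure_tensor K M N m n \<in> carrier (tensor_module K M N)" by (simp add: simps)
  then show "pure_tensor K M N m n \<in> carrier (tensor_module K M N)" .
  show "pure_tensor K M N m (n \<oplus>\<^bsub>N\<^esub> n') =
      pure_tensor K M N m n \<oplus>\<^bsub>tensor_module K M N\<^esub> pure_tensor K M N m n'"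
    if n': "n' \<in> carrier N" for n'
  proof -
    have "e m (n \<oplus>\<^bsub>N\<^esub> n') \<ominus>\<^bsub>Fr\<^esub> (e m n \<oplus>\<^bsub>Fr\<^esub> e m n') \<in> tensor_relations K M N"
      unfolding tensor_relations_def Let_def using mn n' by blast
    from coset[OF this] mn n' show ?thesis by (simp add: simps)
  qed
  show "pure_tensor K M N (m \<oplus>\<^bsub>M\<^esub> m') n =
      pure_tensor K M N m n \<oplus>\<^bsub>tensor_module K M N\<^esub> pure_tensor K M N m' n"
    if m': "m' \<in> carrier M" for m'
  proof -
    have "e (m \<oplus>\<^bsub>M\<^esub> m') n \<ominus>\<^bsub>Fr\<^esub> (e m n \<oplus>\<^bsub>Fr\<^esub> e m' n) \<in> tensor_relations K M N"
      unfolding tensor_relations_def Let_def using mn m' by blast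
    from coset[OF this] mn m' show ?thesis by (simp add: simps)
  qed
  fix r assume r: "r \<in> carrier K"
  have "e m (r \<odot>\<^bsub>N\<^esub> n) \<ominus>\<^bsub>Fr\<^esub> r \<odot>\<^bsub>Fr\<^esub> e m n \<in> tensor_relations K M N"
    unfolding tensor_relations_def Let_def using mn r by blast
  from coset[OF this] mn r
  show "pure_tensor K M N m (r \<odot>\<^bsub>N\<^esub> n) = r \<odot>\<^bsub>tensor_module K M N\<^esub> pure_tensor K M N m n"
    by (simp add: simps)
  have "e (r \<odot>\<^bsub>M\<^esub> m) n \<ominus>\<^bsub>Fr\<^esub> r \<odot>\<^bsub>Fr\<^esub> e m n \<in> tensor_relations K M N"
    unfolding tensor_relations_def Let_def using mn r by blast
  from coset[OF this] mn r
  show "pure_tensor K M N (r \<odot>\<^bsub>M\<^esub> m) n = r \<odot>\<^bsub>tensor_module K M N\<^esub> pure_tensor K M N m n"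
    by (simp add: simps)
qed

text \<open>Composed with the quotient map, both maps become linear maps on the free module, where the basis
  decides.\<close>
lemma tensor_module_linear_ext:
  assumes P: "module K P" and f: "f \<in> linear_map K (tensor_module K M N) P"
    and g: "g \<in> linear_map K (tensor_module K M N) P"
    and eq: "\<And>m n. m \<in> carrier M \<Longrightarrow> n \<in> carrier N \<Longrightarrow> f (pure_tensor K M N m n) = g (pure_tensor K M N m n)"
    and t: "t \<in> carrier (tensor_module K M N)"
  shows "f t = g t"
proof -
  let ?c = "\<lambda>x. ker +>\<^bsub>Fr\<^esub> x"
  note lin = linear_map_comp[OF f[unfolded tensor_module_def] Q.coset_linear]
    linear_map_comp[OF g[unfolded tensor_module_def] Q.coset_linear]
  have "carrier Fr \<subseteq> {x \<in> carrier Fr. f (?c x) = g (?c x)}"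
    by (rule free_module_span[OF M.R.is_cring linear_map_equalizer_submodule[OF lin F.module_axioms P]])
       (use eq in \<open>auto simp: basis_closed pure_tensor_def\<close>)
  moreover obtain x where "x \<in> carrier Fr" "t = ?c x"
    using Q.quotient_carrierE t unfolding tensor_module_def by blast
  ultimately show ?thesis by blast
qed

context
  fixes P :: "('k, 'p, 'z) module_scheme" and \<phi>
  assumes P: "module K P" and \<phi>: "\<phi> \<in> bilinear_map K M N P"
begin

interpretation P: module K P by (rule P)

text \<open>Bilinearity of \<open>\<phi>\<close> says exactly that its linear extension vanishes on the four families of
  relations; the kernel of a linear map is a submodule, so it contains what they generate.\<close>
lemma lift_kills_kernel:
  assumes "h \<in> ker"
  shows "free_lift K P (\<lambda>s. \<phi> (fst s) (snd s)) h = \<zero>\<^bsub>P\<^esub>"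
proof -
  let ?L = "free_lift K P (\<lambda>s. \<phi> (fst s) (snd s))"
  have cl: "(\<lambda>s. \<phi> (fst s) (snd s)) \<in> carrier M \<times> carrier N \<rightarrow> carrier P"
    using \<phi> by (auto simp: bilinear_map_closed)
  note L = free_lift_linear[OF P cl]
  have L_e: "?L (e m n) = \<phi> m n" if "m \<in> carrier M" "n \<in> carrier N" for m n
    using free_lift_basis[OF P cl] that by simp
  note simps = linear_map_minus[OF L F.module_axioms P] linear_map_add[OF L] linear_map_smult[OF L]
    L_e basis_closed bilinear_map_closed[OF \<phi>]
    linear_map_add[OF bilinear_map_right[OF \<phi>]] linear_map_smult[OF bilinear_map_right[OF \<phi>]]
    linear_map_add[OF bilinear_map_left[OF \<phi>]] linear_map_smult[OF bilinear_map_left[OF \<phi>]]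
    P.minus_eq P.r_neg
  have "ker \<subseteq> {x \<in> carrier Fr. ?L x = \<zero>\<^bsub>P\<^esub>}"
    unfolding tensor_kernel_def
  proof (rule generated_submodule_least[OF linear_map_kernel_submodule[OF L F.module_axioms P]])
    have "?L x = \<zero>\<^bsub>P\<^esub>" if "x \<in> tensor_relations K M N" for x
      using that unfolding tensor_relations_def Let_def
      by (elim UnE) (auto simp: simps)
    then show "tensor_relations K M N \<subseteq> {x \<in> carrier Fr. ?L x = \<zero>\<^bsub>P\<^esub>}"
      using relations_closed by auto
  qed
  with assms show ?thesis by auto
qed

lemma lift_function_closed: "(\<lambda>s. \<phi> (fst s) (snd s)) \<in> carrier M \<times> carrier N \<rightarrow> carrier P"
  using \<phi> by (auto simp: bilinear_map_closed)

lemma sweedler_linear: "sweedler K P \<phi> \<in> linear_map K (tensor_module K M N) P"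
  unfolding sweedler_eq_free_lift tensor_module_def
  by (rule Q.quotient_lift_linear[OF P free_lift_linear[OF P lift_function_closed] lift_kills_kernel])

lemma sweedler_pure:
  assumes "m \<in> carrier M" "n \<in> carrier N"
  shows "sweedler K P \<phi> (pure_tensor K M N m n) = \<phi> m n"
  unfolding sweedler_eq_free_lift pure_tensor_def
  using assms free_lift_basis[OF P lift_function_closed]
  by (subst Q.quotient_lift_coset[OF P free_lift_linear[OF P lift_function_closed] lift_kills_kernel])
     (simp_all add: basis_closed)

end

end

text \<open>This is \<open>sweedler\<close> with the two factors as further arguments. Neither the function \<open>\<phi>\<close> nor the
  tensor \<open>t\<close> determines the factors, but the rules below need their carriers: only with \<open>M\<close> and \<open>N\<close>
  in the term can a conditional rewrite rule or a congruence rule find them.\<close>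
definition tensor_lift ::
  "'k ring \<Rightarrow> ('k, 'm, 'x) hom_object_scheme \<Rightarrow> ('k, 'n, 'y) hom_object_scheme \<Rightarrow>
    ('k, 'p, 'z) module_scheme \<Rightarrow> ('m \<Rightarrow> 'n \<Rightarrow> 'p) \<Rightarrow> ('k, 'm, 'n) tensor \<Rightarrow> 'p" where
  "tensor_lift K M N P \<phi> t = sweedler K P \<phi> t"

lemma tensor_simps:
  "carrier (tensor K M N) = carrier (tensor_module K M N)"
  "add (tensor K M N) = add (tensor_module K M N)"
  "zero (tensor K M N) = zero (tensor_module K M N)"
  "smult (tensor K M N) = smult (tensor_module K M N)"
  by (simp_all add: tensor_def module.defs hom_object.defs)

lemma linear_map_cong_modules:
  assumes "carrier M = carrier M'" "add M = add M'" "smult M = smult M'"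
    "carrier N = carrier N'" "add N = add N'" "smult N = smult N'"
  shows "linear_map K M N = linear_map K M' N'"
  using assms by (simp add: linear_map_def)

text \<open>Being a module depends on four fields of the record. The tensor products come with further
  fields that change along the constructions.\<close>
lemma module_cong_modules:
  assumes "module K M"
    and "carrier M = carrier M'" "add M = add M'" "zero M = zero M'" "smult M = smult M'"
  shows "module K M'"
proof -
  interpret module K M by fact
  note eqs = assms(2-5)[symmetric]
  have "abelian_group M'"
    by (intro abelian_groupI) (auto simp: eqs M.a_ac intro: M.l_neg)
  then show ?thesis
    by (intro moduleI R.is_cring) (simp_all add: eqs smult_l_distr smult_r_distr smult_assoc1)
qed

lemma finsum_cong_module:
  assumes "carrier P = carrier P'" "add P = add P'" "zero P = zero P'"
  shows "finsum P f A = finsum P' f A"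
  by (simp add: finsum_def finprod_def assms)

lemma sweedler_cong_module:
  assumes "carrier P = carrier P'" "add P = add P'" "zero P = zero P'" "smult P = smult P'"
  shows "sweedler K P = sweedler K P'"
  using assms by (simp add: sweedler_def fun_eq_iff Let_def finsum_cong_module[of P P'])


lemma linear_map_tensor:
  "linear_map K (tensor K M N) P = linear_map K (tensor_module K M N) P"
  "linear_map K P (tensor K M N) = linear_map K P (tensor_module K M N)"
  by (rule linear_map_cong_modules; simp add: tensor_simps)+

context
  fixes K :: "'k ring" and M :: "('k, 'm, 'x) hom_object_scheme" and N :: "('k, 'n, 'y) hom_object_scheme"
  assumes M: "module K M" and N: "module K N"
begin

interpretation tensor_product K M N
  by (intro tensor_product.intro M N)

lemma tensor_is_module: "module K (tensor K M N)"
  by (rule module_cong_modules[OF tensor_module_is_module]) (simp_all add: tensor_simps)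

lemma pure_tensor_bilinear: "pure_tensor K M N \<in> bilinear_map K M N (tensor K M N)"
  using pure_tensor_module_bilinear by (simp add: bilinear_map_def linear_map_tensor)

lemma pure_tensor_closed:
  "m \<in> carrier M \<Longrightarrow> n \<in> carrier N \<Longrightarrow> pure_tensor K M N m n \<in> carrier (tensor K M N)"
  by (rule bilinear_map_closed[OF pure_tensor_bilinear])

lemma tensor_linear_ext:
  assumes "module K P" "f \<in> linear_map K (tensor K M N) P" "g \<in> linear_map K (tensor K M N) P"
    and "\<And>m n. m \<in> carrier M \<Longrightarrow> n \<in> carrier N \<Longrightarrow> f (pure_tensor K M N m n) = g (pure_tensor K M N m n)"
    and "t \<in> carrier (tensor K M N)"
  shows "f t = g t"
  by (rule tensor_module_linear_ext[of P]) (use assms in \<open>simp_all add: tensor_simps linear_map_tensor\<close>)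

lemma tensor_rep:
  assumes "t \<in> carrier (tensor K M N)"
  shows "(SOME f. f \<in> t) \<in> carrier (free_module K (carrier M \<times> carrier N))"
  by (rule Q.quotient_rep) (use assms in \<open>simp add: tensor_simps tensor_module_def\<close>)

text \<open>Used as a congruence rule, this makes the carrier membership of the Sweedler components
  available while the summand is rewritten.\<close>
lemma tensor_lift_cong:
  assumes "t = t'" "t' \<in> carrier (tensor K M N)"
    and "\<And>m n. m \<in> carrier M \<Longrightarrow> n \<in> carrier N \<Longrightarrow> \<phi> m n = \<phi>' m n"
  shows "tensor_lift K M N P \<phi> t = tensor_lift K M N P \<phi>' t'"
  unfolding tensor_lift_def sweedler_eq_free_lift assms(1)
  by (rule free_lift_cong[OF tensor_rep]) (use assms in auto)

context
  fixes P :: "('k, 'p, 'z) module_scheme"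
  assumes P: "module K P"
begin

interpretation P: module K P by (rule P)

lemma linear_tensor_lift:
  assumes "module K Q" "g \<in> linear_map K P Q" "t \<in> carrier (tensor K M N)"
    and "\<And>m n. m \<in> carrier M \<Longrightarrow> n \<in> carrier N \<Longrightarrow> \<phi> m n \<in> carrier P"
  shows "g (tensor_lift K M N P \<phi> t) = tensor_lift K M N Q (\<lambda>m n. g (\<phi> m n)) t"
  unfolding tensor_lift_def sweedler_eq_free_lift
  by (rule linear_free_lift[OF P assms(1,2) tensor_rep[OF assms(3)]]) (use assms(4) in auto)

lemma tensor_lift_closed:
  assumes "t \<in> carrier (tensor K M N)"
    and "\<And>m n. m \<in> carrier M \<Longrightarrow> n \<in> carrier N \<Longrightarrow> \<phi> m n \<in> carrier P"
  shows "tensor_lift K M N P \<phi> t \<in> carrier P"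
  unfolding tensor_lift_def sweedler_eq_free_lift
  by (rule linear_map_closed[OF free_lift_linear[OF P] tensor_rep[OF assms(1)]]) (use assms(2) in auto)

text \<open>The tensor and hence its chosen representative stay fixed, so the sum is termwise linear in the
  parameter \<open>x\<close>.\<close>
lemma tensor_lift_linear_in_function:
  assumes "module K X" "t \<in> carrier (tensor K M N)"
    and "\<And>m n. m \<in> carrier M \<Longrightarrow> n \<in> carrier N \<Longrightarrow> (\<lambda>x. \<phi> x m n) \<in> linear_map K X P"
  shows "(\<lambda>x. tensor_lift K M N P (\<phi> x) t) \<in> linear_map K X P"
  unfolding tensor_lift_def sweedler_eq_free_lift
  by (rule free_lift_linear_in_function[OF P assms(1) tensor_rep[OF assms(2)]]) (use assms(3) in auto)

lemma tensor_lift_linear: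
  assumes "\<phi> \<in> bilinear_map K M N P" "g \<in> linear_map K X (tensor K M N)"
  shows "(\<lambda>x. tensor_lift K M N P \<phi> (g x)) \<in> linear_map K X P"
  unfolding tensor_lift_def
  by (rule linear_map_comp[OF sweedler_linear[OF P assms(1)] assms(2)[unfolded linear_map_tensor]])

lemma tensor_lift_pure:
  assumes "\<phi> \<in> bilinear_map K M N P" "m \<in> carrier M" "n \<in> carrier N"
  shows "tensor_lift K M N P \<phi> (pure_tensor K M N m n) = \<phi> m n"
  unfolding tensor_lift_def by (rule sweedler_pure[OF P assms])

end

lemma tensor_lift_pure_tensor:
  assumes "t \<in> carrier (tensor K M N)"
  shows "tensor_lift K M N (tensor K M N) (pure_tensor K M N) t = t"
  by (rule tensor_linear_ext[OF tensor_is_module _ linear_map_ident _ assms])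
     (simp_all add: tensor_lift_linear tensor_lift_pure tensor_is_module pure_tensor_bilinear linear_map_ident)

text \<open>This splits a component that occurs undivided, such as \<open>\<Delta>(c\<^sub>2)\<close>, into its Sweedler components.\<close>
lemma linear_eq_tensor_lift:
  assumes "module K Q" "g \<in> linear_map K (tensor K M N) Q" "t \<in> carrier (tensor K M N)"
  shows "g t = tensor_lift K M N Q (\<lambda>m n. g (pure_tensor K M N m n)) t"
  using linear_tensor_lift[OF tensor_is_module assms, of "pure_tensor K M N"]
  by (simp add: tensor_lift_pure_tensor assms(3) pure_tensor_closed)

end

lemma tensor_lift_swap:
  assumes M: "module K M" and N: "module K N" and M': "module K M'" and N': "module K N'" and P: "module K P"
    and s: "s \<in> carrier (tensor K M N)" and t: "t \<in> carrier (tensor K M' N')"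
    and cl: "\<And>m n m' n'. \<lbrakk>m \<in> carrier M; n \<in> carrier N; m' \<in> carrier M'; n' \<in> carrier N'\<rbrakk>
      \<Longrightarrow> \<phi> m n m' n' \<in> carrier P"
  shows "tensor_lift K M N P (\<lambda>m n. tensor_lift K M' N' P (\<phi> m n) t) s =
    tensor_lift K M' N' P (\<lambda>m' n'. tensor_lift K M N P (\<lambda>m n. \<phi> m n m' n') s) t"
  unfolding tensor_lift_def sweedler_eq_free_lift
  by (rule free_lift_swap[OF P tensor_rep[OF M N s] tensor_rep[OF M' N' t]]) (use cl in auto)

section \<open>Objects with an automorphism\<close>

context hom_object
begin

lemma aut_closed [simp]: "x \<in> carrier M \<Longrightarrow> aut M x \<in> carrier M"
  using aut_linear by (rule linear_map_closed)

lemma aut_inv_closed [simp]: "x \<in> carrier M \<Longrightarrow> aut_inv M x \<in> carrier M"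
  using aut_bij by (metis bij_betw_imp_surj_on inv_into_into)

lemma aut_aut_inv [simp]: "x \<in> carrier M \<Longrightarrow> aut M (aut_inv M x) = x"
  using aut_bij by (metis bij_betw_inv_into_right)

lemma aut_inv_aut [simp]: "x \<in> carrier M \<Longrightarrow> aut_inv M (aut M x) = x"
  using aut_bij by (metis bij_betw_inv_into_left)

lemma aut_inv_unique: "x \<in> carrier M \<Longrightarrow> aut M x = y \<Longrightarrow> aut_inv M y = x"
  by auto

lemma aut_inv_linear: "aut_inv M \<in> linear_map K M M"
proof (rule linear_mapI)
  fix x y assume "x \<in> carrier M" "y \<in> carrier M"
  then show "aut_inv M (x \<oplus>\<^bsub>M\<^esub> y) = aut_inv M x \<oplus>\<^bsub>M\<^esub> aut_inv M y"
    by (intro aut_inv_unique) (simp_all add: linear_map_add[OF aut_linear])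
next
  fix r x assume "r \<in> carrier K" "x \<in> carrier M"
  then show "aut_inv M (r \<odot>\<^bsub>M\<^esub> x) = r \<odot>\<^bsub>M\<^esub> aut_inv M x"
    by (intro aut_inv_unique) (simp_all add: linear_map_smult[OF aut_linear])
qed simp

end


text \<open>Rules that peel one operation off a linear map. They have the form: if \<open>g\<close> is linear, then so is
  \<open>x \<mapsto> f (g x)\<close>, with the identity as base case. A multilinear expression contains each
  of its variables once, so exactly one rule applies at each step.\<close>
named_theorems linear_intros

declare linear_map_ident [linear_intros]

lemma (in hom_object) aut_comp_linear [linear_intros]:
  "g \<in> linear_map K X M \<Longrightarrow> (\<lambda>x. aut M (g x)) \<in> linear_map K X M"
  "g \<in> linear_map K X M \<Longrightarrow> (\<lambda>x. aut_inv M (g x)) \<in> linear_map K X M"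
  by (rule linear_map_comp[OF aut_linear] linear_map_comp[OF aut_inv_linear]; assumption)+

lemma pure_tensor_linear:
  assumes "module K M" "module K N"
  shows "g \<in> linear_map K X M \<Longrightarrow> n \<in> carrier N \<Longrightarrow>
      (\<lambda>x. pure_tensor K M N (g x) n) \<in> linear_map K X (tensor K M N)"
    and "h \<in> linear_map K X N \<Longrightarrow> m \<in> carrier M \<Longrightarrow>
      (\<lambda>x. pure_tensor K M N m (h x)) \<in> linear_map K X (tensor K M N)"
  by (rule linear_map_comp[OF bilinear_map_left[OF pure_tensor_bilinear[OF assms]]]
      linear_map_comp[OF bilinear_map_right[OF pure_tensor_bilinear[OF assms]]]; assumption)+

text \<open>Restates the automorphism with values in \<open>tensor K M N\<close>, so that the plain module
  \<open>tensor_module K M N\<close> does not appear in calculations.\<close>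
lemma aut_tensor:
  "aut (tensor K M N) = tensor_lift K M N (tensor K M N) (\<lambda>m n. pure_tensor K M N (aut M m) (aut N n))"
proof -
  have "aut (tensor K M N) = sweedler K (tensor_module K M N) (\<lambda>m n. pure_tensor K M N (aut M m) (aut N n))"
    by (simp add: tensor_def module.defs hom_object.defs)
  then show ?thesis
    unfolding tensor_lift_def[abs_def]
    by (simp add: sweedler_cong_module[OF tensor_simps])
qed

locale hom_tensor = M: hom_object K M + N: hom_object K N
  for K :: "'k ring" and M :: "('k, 'm, 'x) hom_object_scheme" and N :: "('k, 'n, 'y) hom_object_scheme"
begin

lemmas MN = M.module_axioms N.module_axioms
lemmas T = tensor_is_module[OF MN]

lemma aut_tensor_linear: "aut (tensor K M N) \<in> linear_map K (tensor K M N) (tensor K M N)"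
  unfolding aut_tensor
  by (intro tensor_lift_linear[OF MN T] bilinear_mapI linear_intros pure_tensor_linear[OF MN] M.aut_closed N.aut_closed)

lemma aut_tensor_pure:
  "m \<in> carrier M \<Longrightarrow> n \<in> carrier N \<Longrightarrow>
    aut (tensor K M N) (pure_tensor K M N m n) = pure_tensor K M N (aut M m) (aut N n)"
  unfolding aut_tensor
  by (intro tensor_lift_pure[OF MN T] bilinear_mapI linear_intros pure_tensor_linear[OF MN] M.aut_closed N.aut_closed)

lemma aut_tensor_bij: "bij_betw (aut (tensor K M N)) (carrier (tensor K M N)) (carrier (tensor K M N))"
proof -
  let ?T = "tensor K M N"
  let ?i = "tensor_lift K M N ?T (\<lambda>m n. pure_tensor K M N (aut_inv M m) (aut_inv N n))"
  have bil: "(\<lambda>m n. pure_tensor K M N (aut_inv M m) (aut_inv N n)) \<in> bilinear_map K M N ?T"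
    by (intro bilinear_mapI linear_intros pure_tensor_linear[OF MN] M.aut_inv_closed N.aut_inv_closed)
  have i: "?i \<in> linear_map K ?T ?T"
    by (rule tensor_lift_linear[OF MN T bil linear_map_ident])
  note i_pure = tensor_lift_pure[OF MN T bil]
  note cl = pure_tensor_closed[OF MN]
  show ?thesis
  proof (rule bij_betw_byWitness[of _ ?i])
    show "\<forall>t\<in>carrier ?T. ?i (aut ?T t) = t"
      by (rule ballI, rule tensor_linear_ext[OF MN T linear_map_comp[OF i aut_tensor_linear] linear_map_ident])
         (simp_all add: aut_tensor_pure i_pure)
    show "\<forall>t\<in>carrier ?T. aut ?T (?i t) = t"
      by (rule ballI, rule tensor_linear_ext[OF MN T linear_map_comp[OF aut_tensor_linear i] linear_map_ident])
         (simp_all add: aut_tensor_pure i_pure)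
  qed (use linear_map_closed[OF i] linear_map_closed[OF aut_tensor_linear] in auto)
qed

lemma tensor_is_hom_object: "hom_object K (tensor K M N)"
  by (intro hom_object.intro hom_object_axioms.intro T aut_tensor_linear aut_tensor_bij)

lemma aut_inv_tensor_pure:
  assumes "m \<in> carrier M" "n \<in> carrier N"
  shows "aut_inv (tensor K M N) (pure_tensor K M N m n) = pure_tensor K M N (aut_inv M m) (aut_inv N n)"
  by (rule hom_object.aut_inv_unique[OF tensor_is_hom_object])
     (simp_all add: aut_tensor_pure pure_tensor_closed[OF MN] assms)

end

section \<open>Balanced tensor products\<close>

text \<open>The bilinear maps that factor through \<open>M \<otimes>\<^sub>A N\<close>. The condition is the defining relation of the
  Hom-tensor product, twists included.\<close>
definition balanced_map ::
  "'k ring \<Rightarrow> ('k, 'a) hom_object \<Rightarrow> ('k, 'm, 'a) hom_bimodule \<Rightarrow> ('k, 'n, 'a) hom_bimodule \<Rightarrow>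
    ('k, 'p, 'z) module_scheme \<Rightarrow> ('m \<Rightarrow> 'n \<Rightarrow> 'p) set" where
  "balanced_map K A M N P = {\<phi> \<in> bilinear_map K M N P.
    \<forall>m\<in>carrier M. \<forall>a\<in>carrier A. \<forall>n\<in>carrier N. \<phi> (ract M m a) n = \<phi> (aut M m) (lact N a (aut_inv N n))}"

lemma balanced_mapI:
  assumes "\<phi> \<in> bilinear_map K M N P"
    and "\<And>m a n. \<lbrakk>m \<in> carrier M; a \<in> carrier A; n \<in> carrier N\<rbrakk> \<Longrightarrow>
      \<phi> (ract M m a) n = \<phi> (aut M m) (lact N a (aut_inv N n))"
  shows "\<phi> \<in> balanced_map K A M N P"
  using assms by (simp add: balanced_map_def)

lemma
  assumes "\<phi> \<in> balanced_map K A M N P"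
  shows balanced_map_bilinear: "\<phi> \<in> bilinear_map K M N P"
    and balanced_map_swap: "\<lbrakk>m \<in> carrier M; a \<in> carrier A; n \<in> carrier N\<rbrakk> \<Longrightarrow>
      \<phi> (ract M m a) n = \<phi> (aut M m) (lact N a (aut_inv N n))"
  using assms by (simp_all add: balanced_map_def)

lemma tensor_over_simps:
  "carrier (tensor_over K A M N) = carrier (tensor_over_module K A M N)"
  "add (tensor_over K A M N) = add (tensor_over_module K A M N)"
  "zero (tensor_over K A M N) = zero (tensor_over_module K A M N)"
  "smult (tensor_over K A M N) = smult (tensor_over_module K A M N)"
  by (simp_all add: tensor_over_def Let_def module.defs hom_object.defs hom_bimodule.defs)

lemma linear_map_tensor_over:
  "linear_map K (tensor_over K A M N) P = linear_map K (tensor_over_module K A M N) P"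
  "linear_map K P (tensor_over K A M N) = linear_map K P (tensor_over_module K A M N)"
  by (rule linear_map_cong_modules; simp add: tensor_over_simps)+

text \<open>\<open>sweedler_over\<close> evaluates the map on \<open>M \<otimes> N\<close> at a representative, so its theory is that of
  \<open>tensor_lift\<close> followed by one more quotient.\<close>
lemma sweedler_over_eq_tensor_lift:
  "sweedler_over K P \<phi> t = tensor_lift K M N P \<phi> (SOME u. u \<in> t)"
  by (simp add: sweedler_over_def tensor_lift_def)

lemma sweedler_over_tensor_over:
  "sweedler_over K (tensor_over_module K A M N) = sweedler_over K (tensor_over K A M N)"
  by (simp add: sweedler_over_def fun_eq_iff sweedler_cong_module[OF tensor_over_simps])

lemma
  shows aut_tensor_over: "aut (tensor_over K A M N) = sweedler_over K (tensor_over K A M N)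
      (\<lambda>m n. pure_tensor_over K A M N (aut M m) (aut N n))"
    and lact_tensor_over: "lact (tensor_over K A M N) a = sweedler_over K (tensor_over K A M N)
      (\<lambda>m n. pure_tensor_over K A M N (lact M (aut_inv A a) m) (aut N n))"
    and ract_tensor_over: "ract (tensor_over K A M N) t a = sweedler_over K (tensor_over K A M N)
      (\<lambda>m n. pure_tensor_over K A M N (aut M m) (ract N n (aut_inv A a))) t"
  unfolding sweedler_over_tensor_over[symmetric]
  by (simp_all add: tensor_over_def Let_def module.defs hom_object.defs hom_bimodule.defs)

text \<open>The right factor will also be a tensor product over \<open>A\<close>, in the coassociativity law of a coring;
  closure under the actions is the property that it is known to have at that point.\<close>
locale balanced_tensor = MN: hom_tensor K M N
  for K :: "'k ring" and A :: "('k, 'a) hom_object"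
    and M :: "('k, 'm, 'a) hom_bimodule" and N :: "('k, 'n, 'a) hom_bimodule" +
  assumes ract_closed: "m \<in> carrier M \<Longrightarrow> a \<in> carrier A \<Longrightarrow> ract M m a \<in> carrier M"
    and lact_closed: "n \<in> carrier N \<Longrightarrow> a \<in> carrier A \<Longrightarrow> lact N a n \<in> carrier N"
begin

lemmas MN = MN.MN

interpretation T: module K "tensor K M N" by (rule MN.T)

abbreviation "relations \<equiv> {pure_tensor K M N (ract M m a) n
          \<ominus>\<^bsub>tensor K M N\<^esub> pure_tensor K M N (aut M m) (lact N a (aut_inv N n)) | m a n.
        m \<in> carrier M \<and> a \<in> carrier A \<and> n \<in> carrier N}"

lemma relations_closed: "relations \<subseteq> carrier (tensor K M N)"
  by (auto intro!: T.minus_closed pure_tensor_closed[OF MN] ract_closed lact_closed)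

sublocale Q: module_quotient K "tensor K M N" "balancing_kernel K A M N"
  by (intro module_quotient.intro module_quotient_axioms.intro MN.T)
     (simp add: balancing_kernel_def generated_submodule_is_submodule[OF MN.T relations_closed])

lemma tensor_over_is_module: "module K (tensor_over K A M N)"
  by (rule module_cong_modules[OF Q.quotient_module_is_module])
     (simp_all add: tensor_over_simps tensor_over_module_def)

lemma coset_linear_over:
  "(\<lambda>t. balancing_kernel K A M N +>\<^bsub>tensor K M N\<^esub> t) \<in> linear_map K (tensor K M N) (tensor_over K A M N)"
  using Q.coset_linear by (simp add: linear_map_tensor_over tensor_over_module_def)

lemma pure_tensor_over_bilinear: "pure_tensor_over K A M N \<in> bilinear_map K M N (tensor_over K A M N)"
  unfolding pure_tensor_over_def[abs_def]
  by (intro bilinear_mapI linear_map_comp[OF coset_linear_over] pure_tensor_linear[OF MN] linear_map_ident)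

lemma pure_tensor_over_balanced: "pure_tensor_over K A M N \<in> balanced_map K A M N (tensor_over K A M N)"
proof (rule balanced_mapI[OF pure_tensor_over_bilinear])
  fix m a n assume mem: "m \<in> carrier M" "a \<in> carrier A" "n \<in> carrier N"
  show "pure_tensor_over K A M N (ract M m a) n =
      pure_tensor_over K A M N (aut M m) (lact N a (aut_inv N n))"
    unfolding pure_tensor_over_def
  proof (rule Q.coset_eqI)
    show "pure_tensor K M N (ract M m a) n \<ominus>\<^bsub>tensor K M N\<^esub>
        pure_tensor K M N (aut M m) (lact N a (aut_inv N n)) \<in> balancing_kernel K A M N"
      unfolding balancing_kernel_def
      by (rule subsetD[OF generated_submodule_contains]) (use mem in blast)
  qed (simp_all add: mem pure_tensor_closed[OF MN] ract_closed lact_closed)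
qed

lemma pure_tensor_over_closed:
  "m \<in> carrier M \<Longrightarrow> n \<in> carrier N \<Longrightarrow> pure_tensor_over K A M N m n \<in> carrier (tensor_over K A M N)"
  by (rule bilinear_map_closed[OF pure_tensor_over_bilinear])

lemma tensor_over_linear_ext:
  assumes P: "module K P" and f: "f \<in> linear_map K (tensor_over K A M N) P"
    and g: "g \<in> linear_map K (tensor_over K A M N) P"
    and eq: "\<And>m n. m \<in> carrier M \<Longrightarrow> n \<in> carrier N \<Longrightarrow>
      f (pure_tensor_over K A M N m n) = g (pure_tensor_over K A M N m n)"
    and t: "t \<in> carrier (tensor_over K A M N)"
  shows "f t = g t"
proof -
  obtain u where u: "u \<in> carrier (tensor K M N)" "t = balancing_kernel K A M N +>\<^bsub>tensor K M N\<^esub> u"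
    using Q.quotient_carrierE t unfolding tensor_over_simps tensor_over_module_def by blast
  show ?thesis
    unfolding u(2)
    by (rule tensor_linear_ext[OF MN P linear_map_comp[OF f coset_linear_over]
          linear_map_comp[OF g coset_linear_over] _ u(1)])
       (rule eq[unfolded pure_tensor_over_def])
qed

context
  fixes P :: "('k, 'p, 'z) module_scheme"
  assumes P: "module K P"
begin

interpretation P: module K P by (rule P)

lemma lift_kills_balancing:
  assumes \<phi>: "\<phi> \<in> balanced_map K A M N P" and h: "h \<in> balancing_kernel K A M N"
  shows "tensor_lift K M N P \<phi> h = \<zero>\<^bsub>P\<^esub>"
proof -
  note bil = balanced_map_bilinear[OF \<phi>]
  note lin = tensor_lift_linear[OF MN P bil linear_map_ident]
  have "tensor_lift K M N P \<phi> x = \<zero>\<^bsub>P\<^esub>" if x: "x \<in> relations" for x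
    using x
    by (auto simp: linear_map_minus[OF lin MN.T P] pure_tensor_closed[OF MN] ract_closed lact_closed
        tensor_lift_pure[OF MN P bil] balanced_map_swap[OF \<phi>] bilinear_map_closed[OF bil] P.minus_eq P.r_neg)
  then have "balancing_kernel K A M N \<subseteq> {x \<in> carrier (tensor K M N). tensor_lift K M N P \<phi> x = \<zero>\<^bsub>P\<^esub>}"
    unfolding balancing_kernel_def using relations_closed
    by (intro generated_submodule_least linear_map_kernel_submodule[OF lin MN.T P]) blast
  with h show ?thesis by blast
qed

lemma sweedler_over_linear:
  assumes \<phi>: "\<phi> \<in> balanced_map K A M N P"
  shows "sweedler_over K P \<phi> \<in> linear_map K (tensor_over K A M N) P"
  unfolding sweedler_over_eq_tensor_lift[of K P \<phi> _ M N, abs_def] linear_map_tensor_over tensor_over_module_def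
  by (rule Q.quotient_lift_linear[OF P tensor_lift_linear[OF MN P balanced_map_bilinear[OF \<phi>] linear_map_ident]
        lift_kills_balancing[OF \<phi>]])

lemma sweedler_over_pure:
  assumes \<phi>: "\<phi> \<in> balanced_map K A M N P" and mn: "m \<in> carrier M" "n \<in> carrier N"
  shows "sweedler_over K P \<phi> (pure_tensor_over K A M N m n) = \<phi> m n"
  unfolding sweedler_over_eq_tensor_lift[of K P \<phi> _ M N] pure_tensor_over_def
  by (subst Q.quotient_lift_coset[OF P tensor_lift_linear[OF MN P balanced_map_bilinear[OF \<phi>] linear_map_ident]
        lift_kills_balancing[OF \<phi>]])
     (simp_all add: pure_tensor_closed[OF MN] mn tensor_lift_pure[OF MN P balanced_map_bilinear[OF \<phi>]])

lemma sweedler_over_linear_in_function: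
  assumes "module K X" "t \<in> carrier (tensor_over K A M N)"
    and "\<And>m n. m \<in> carrier M \<Longrightarrow> n \<in> carrier N \<Longrightarrow> (\<lambda>x. \<phi> x m n) \<in> linear_map K X P"
  shows "(\<lambda>x. sweedler_over K P (\<phi> x) t) \<in> linear_map K X P"
  unfolding sweedler_over_eq_tensor_lift[of K P _ t M N]
  by (rule tensor_lift_linear_in_function[OF MN P assms(1) Q.quotient_rep(1)])
     (use assms(2,3) in \<open>simp_all add: tensor_over_simps tensor_over_module_def\<close>)

end

end


section \<open>Sweedler calculus\<close>

definition trilinear_map ::
  "'k ring \<Rightarrow> ('k, 'm, 'x) module_scheme \<Rightarrow> ('k, 'n, 'y) module_scheme \<Rightarrow>
    ('k, 'q, 'w) module_scheme \<Rightarrow> ('k, 'p, 'z) module_scheme \<Rightarrow> ('m \<Rightarrow> 'n \<Rightarrow> 'q \<Rightarrow> 'p) set" where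
  "trilinear_map K M N Q P =
    {\<phi>. (\<forall>x\<in>carrier M. \<phi> x \<in> bilinear_map K N Q P) \<and>
        (\<forall>y\<in>carrier N. \<forall>z\<in>carrier Q. (\<lambda>x. \<phi> x y z) \<in> linear_map K M P)}"

text \<open>The rules that let the simplifier calculate in Sweedler notation: linearity and closure
  conditions, evaluation on pure tensors, and flattening of sums over sums. They are used
  together with the structure axioms in the form: a sum over \<open>\<Delta>(c b)\<close> or \<open>\<rho>(a a')\<close> of an arbitrary multilinear function is
  rewritten as a sum over the components of the factors.\<close>
named_theorems sweedler_simps

declare linear_map_ident [sweedler_simps] bilinear_map_def [sweedler_simps] trilinear_map_def [sweedler_simps]
  tensor_is_module [sweedler_simps] pure_tensor_closed [sweedler_simps] pure_tensor_linear [sweedler_simps]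
  tensor_lift_linear [sweedler_simps] tensor_lift_linear_in_function [sweedler_simps]
  tensor_lift_closed [sweedler_simps] tensor_lift_pure [sweedler_simps]

lemma tensor_lift_tensor_lift [sweedler_simps]:
  assumes "module K M" "module K N" "module K X" "module K Y" "module K P"
    and "\<phi> \<in> bilinear_map K M N P" "t \<in> carrier (tensor K X Y)"
    and "\<And>x y. \<lbrakk>x \<in> carrier X; y \<in> carrier Y\<rbrakk> \<Longrightarrow> f x y \<in> carrier (tensor K M N)"
  shows "tensor_lift K M N P \<phi> (tensor_lift K X Y (tensor K M N) f t) =
    tensor_lift K X Y P (\<lambda>x y. tensor_lift K M N P \<phi> (f x y)) t"
  by (rule linear_tensor_lift[OF assms(3,4) _ assms(5)])
     (use assms in \<open>simp_all add: tensor_is_module tensor_lift_linear linear_map_ident\<close>)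


lemma bilinear_map_comp:
  assumes "\<phi> \<in> bilinear_map K M N P" "f \<in> linear_map K X M" "g \<in> linear_map K Y N"
  shows "(\<lambda>x y. \<phi> (f x) (g y)) \<in> bilinear_map K X Y P"
  by (rule bilinear_mapI)
     (rule linear_map_comp[OF bilinear_map_right[OF assms(1)] assms(3)]
        linear_map_comp[OF bilinear_map_left[OF assms(1)] assms(2)],
      rule linear_map_closed[OF assms(2)] linear_map_closed[OF assms(3)], assumption)+

lemma tensor_lift_sum_of_pure:
  assumes "module K M" "module K N" "module K X" "module K Y" "module K P"
    and "\<phi> \<in> bilinear_map K M N P" "t \<in> carrier (tensor K X Y)"
    and "\<And>x y. \<lbrakk>x \<in> carrier X; y \<in> carrier Y\<rbrakk> \<Longrightarrow> f x y \<in> carrier M"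
    and "\<And>x y. \<lbrakk>x \<in> carrier X; y \<in> carrier Y\<rbrakk> \<Longrightarrow> h x y \<in> carrier N"
  shows "tensor_lift K M N P \<phi> (tensor_lift K X Y (tensor K M N) (\<lambda>x y. pure_tensor K M N (f x y) (h x y)) t) =
    tensor_lift K X Y P (\<lambda>x y. \<phi> (f x y) (h x y)) t"
proof -
  have "tensor_lift K M N P \<phi> (tensor_lift K X Y (tensor K M N) (\<lambda>x y. pure_tensor K M N (f x y) (h x y)) t) =
      tensor_lift K X Y P (\<lambda>x y. tensor_lift K M N P \<phi> (pure_tensor K M N (f x y) (h x y))) t"
    using assms by (intro tensor_lift_tensor_lift pure_tensor_closed)
  also have "\<dots> = tensor_lift K X Y P (\<lambda>x y. \<phi> (f x y) (h x y)) t"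
    by (rule tensor_lift_cong[OF assms(3,4) refl assms(7)]) (use assms in \<open>intro tensor_lift_pure\<close>)
  finally show ?thesis .
qed

text \<open>The form in which multiplicativity of a coaction is stated: components of a product are indexed
  by pairs of components.\<close>
lemma tensor_lift_double_sum_of_pure:
  assumes mods: "module K M" "module K N" "module K X" "module K Y" "module K X'" "module K Y'" "module K P"
    and "\<phi> \<in> bilinear_map K M N P" "t \<in> carrier (tensor K X Y)" "t' \<in> carrier (tensor K X' Y')"
    and "\<And>x y x' y'. \<lbrakk>x \<in> carrier X; y \<in> carrier Y; x' \<in> carrier X'; y' \<in> carrier Y'\<rbrakk> \<Longrightarrow> f x y x' y' \<in> carrier M"
    and "\<And>x y x' y'. \<lbrakk>x \<in> carrier X; y \<in> carrier Y; x' \<in> carrier X'; y' \<in> carrier Y'\<rbrakk> \<Longrightarrow> h x y x' y' \<in> carrier N"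
  shows "tensor_lift K M N P \<phi> (tensor_lift K X Y (tensor K M N) (\<lambda>x y.
      tensor_lift K X' Y' (tensor K M N) (\<lambda>x' y'. pure_tensor K M N (f x y x' y') (h x y x' y')) t') t) =
    tensor_lift K X Y P (\<lambda>x y. tensor_lift K X' Y' P (\<lambda>x' y'. \<phi> (f x y x' y') (h x y x' y')) t') t"
proof -
  have "tensor_lift K M N P \<phi> (tensor_lift K X Y (tensor K M N) (\<lambda>x y.
      tensor_lift K X' Y' (tensor K M N) (\<lambda>x' y'. pure_tensor K M N (f x y x' y') (h x y x' y')) t') t) =
    tensor_lift K X Y P (\<lambda>x y. tensor_lift K M N P \<phi>
      (tensor_lift K X' Y' (tensor K M N) (\<lambda>x' y'. pure_tensor K M N (f x y x' y') (h x y x' y')) t')) t"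
    using assms by (intro tensor_lift_tensor_lift tensor_lift_closed pure_tensor_closed tensor_is_module)
  also have "\<dots> = tensor_lift K X Y P (\<lambda>x y. tensor_lift K X' Y' P (\<lambda>x' y'. \<phi> (f x y x' y') (h x y x' y')) t') t"
    by (rule tensor_lift_cong[OF mods(3,4) refl assms(9)]) (use assms in \<open>intro tensor_lift_sum_of_pure\<close>)
  finally show ?thesis .
qed

lemma
  assumes "\<phi> \<in> trilinear_map K M N Q P"
  shows trilinear_map_bilinear: "x \<in> carrier M \<Longrightarrow> \<phi> x \<in> bilinear_map K N Q P"
    and trilinear_map_linear: "y \<in> carrier N \<Longrightarrow> z \<in> carrier Q \<Longrightarrow> (\<lambda>x. \<phi> x y z) \<in> linear_map K M P"
  using assms by (simp_all add: trilinear_map_def)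

lemma base_module_simps:
  "carrier (base_module K) = carrier K" "add (base_module K) = add K" "smult (base_module K) = mult K"
  by (simp_all add: base_module_def ring.defs module.defs)

lemma smult_linear [sweedler_simps]:
  assumes "module K P"
  shows "f \<in> linear_map K X (base_module K) \<Longrightarrow> p \<in> carrier P \<Longrightarrow> (\<lambda>x. f x \<odot>\<^bsub>P\<^esub> p) \<in> linear_map K X P"
    and "g \<in> linear_map K X P \<Longrightarrow> r \<in> carrier K \<Longrightarrow> (\<lambda>x. r \<odot>\<^bsub>P\<^esub> g x) \<in> linear_map K X P"
proof -
  interpret P: module K P by fact
  show "(\<lambda>x. f x \<odot>\<^bsub>P\<^esub> p) \<in> linear_map K X P" if "f \<in> linear_map K X (base_module K)" "p \<in> carrier P"
    using that by (auto simp: linear_map_def base_module_simps P.smult_l_distr P.smult_assoc1 Pi_iff)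
qed (rule linear_map_scale[OF assms])

context hom_object
begin

lemma is_module [simp]: "module K M" ..

lemmas aut_comp_linear [sweedler_simps]

end

context hom_algebra
begin

lemma mult_closed [simp]: "a \<in> carrier A \<Longrightarrow> b \<in> carrier A \<Longrightarrow> a \<otimes>\<^bsub>A\<^esub> b \<in> carrier A"
  using mult_bilinear by (rule bilinear_map_closed)

declare one_closed [simp] mult_one [simp] one_mult [simp] aut_mult [simp] aut_one [simp]

lemma aut_inv_mult [simp]:
  "a \<in> carrier A \<Longrightarrow> b \<in> carrier A \<Longrightarrow> aut_inv A (a \<otimes>\<^bsub>A\<^esub> b) = aut_inv A a \<otimes>\<^bsub>A\<^esub> aut_inv A b"
  by (rule aut_inv_unique) simp_all

lemma aut_inv_one [simp]: "aut_inv A \<one>\<^bsub>A\<^esub> = \<one>\<^bsub>A\<^esub>"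
  by (rule aut_inv_unique) simp_all

text \<open>Hom-associativity as a rewrite rule. With automorphisms moved to the variables and products
  bracketed to the right, words that are equal by the axioms become identical. The same
  orientation is used for the actions.\<close>
lemma mult_assoc: "\<lbrakk>a \<in> carrier A; b \<in> carrier A; c \<in> carrier A\<rbrakk> \<Longrightarrow>
    (a \<otimes>\<^bsub>A\<^esub> b) \<otimes>\<^bsub>A\<^esub> c = aut A a \<otimes>\<^bsub>A\<^esub> (b \<otimes>\<^bsub>A\<^esub> aut_inv A c)"
  by (simp add: hom_assoc)

lemma mult_linear [sweedler_simps]:
  "g \<in> linear_map K X A \<Longrightarrow> a \<in> carrier A \<Longrightarrow> (\<lambda>x. g x \<otimes>\<^bsub>A\<^esub> a) \<in> linear_map K X A"
  "g \<in> linear_map K X A \<Longrightarrow> a \<in> carrier A \<Longrightarrow> (\<lambda>x. a \<otimes>\<^bsub>A\<^esub> g x) \<in> linear_map K X A"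
  using linear_map_comp[OF bilinear_map_left[OF mult_bilinear]]
    linear_map_comp[OF bilinear_map_right[OF mult_bilinear]] by blast+

end

context right_hom_module
begin

lemma act_closed [simp]: "m \<in> carrier M \<Longrightarrow> a \<in> carrier A \<Longrightarrow> act m a \<in> carrier M"
  using act_bilinear by (rule bilinear_map_closed)

declare act_one [simp] aut_act [simp]

lemma aut_inv_act [simp]:
  "m \<in> carrier M \<Longrightarrow> a \<in> carrier A \<Longrightarrow> aut_inv M (act m a) = act (aut_inv M m) (aut_inv A a)"
  by (rule M.aut_inv_unique) simp_all

lemma act_act: "\<lbrakk>m \<in> carrier M; a \<in> carrier A; b \<in> carrier A\<rbrakk> \<Longrightarrow>
    act (act m a) b = act (aut M m) (a \<otimes>\<^bsub>A\<^esub> aut_inv A b)"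
  by (simp add: act_assoc)

lemma act_linear [sweedler_simps]:
  "g \<in> linear_map K X M \<Longrightarrow> a \<in> carrier A \<Longrightarrow> (\<lambda>x. act (g x) a) \<in> linear_map K X M"
  "h \<in> linear_map K X A \<Longrightarrow> m \<in> carrier M \<Longrightarrow> (\<lambda>x. act m (h x)) \<in> linear_map K X M"
  using linear_map_comp[OF bilinear_map_left[OF act_bilinear]]
    linear_map_comp[OF bilinear_map_right[OF act_bilinear]] by blast+

end

context right_hom_comodule
begin

lemma coact_closed [simp]: "m \<in> carrier M \<Longrightarrow> \<rho> m \<in> carrier (tensor K M C)"
  using coact_linear by (rule linear_map_closed)

lemma counit_closed [simp]: "c \<in> carrier C \<Longrightarrow> \<epsilon> c \<in> carrier K"
  using linear_map_closed[OF C.counit_linear] by (simp add: base_module_simps)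

lemma counit_comp_linear [sweedler_simps]:
  "g \<in> linear_map K X C \<Longrightarrow> (\<lambda>x. \<epsilon> (g x)) \<in> linear_map K X (base_module K)"
  by (rule linear_map_comp[OF C.counit_linear])

lemma coact_comp_linear [sweedler_simps]:
  "g \<in> linear_map K X M \<Longrightarrow> (\<lambda>x. \<rho> (g x)) \<in> linear_map K X (tensor K M C)"
  by (rule linear_map_comp[OF coact_linear])

lemma comul_closed [simp]: "c \<in> carrier C \<Longrightarrow> \<Delta> c \<in> carrier (tensor K C C)"
  using C.comul_linear by (rule linear_map_closed)

lemma comul_comp_linear [sweedler_simps]:
  "g \<in> linear_map K X C \<Longrightarrow> (\<lambda>x. \<Delta> (g x)) \<in> linear_map K X (tensor K C C)"
  by (rule linear_map_comp[OF C.comul_linear])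

context
  fixes P :: "('k, 'p, 'z) module_scheme"
  assumes P: "module K P"
begin

lemma coact_aut_lift:
  assumes m: "m \<in> carrier M" and \<phi>: "\<phi> \<in> bilinear_map K M C P"
  shows "tensor_lift K M C P \<phi> (\<rho> (aut M m)) = tensor_lift K M C P (\<lambda>m0 m1. \<phi> (aut M m0) (aut C m1)) (\<rho> m)"
proof -
  have "\<rho> (aut M m) = tensor_lift K M C (tensor K M C) (\<lambda>m0 m1. pure_tensor K M C (aut M m0) (aut C m1)) (\<rho> m)"
    unfolding tensor_lift_def using m by (rule coact_aut)
  then show ?thesis
    using m by (simp add: tensor_lift_sum_of_pure[OF _ _ _ _ P \<phi>])
qed

text \<open>Apply the rule for \<open>\<mu>\<close> at \<open>\<mu>\<^sup>-\<^sup>1(m)\<close>, to \<open>\<phi>\<close> precomposed with the inverse automorphisms.\<close>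
lemma coact_aut_inv_lift:
  assumes m: "m \<in> carrier M" and \<phi>: "\<phi> \<in> bilinear_map K M C P"
  shows "tensor_lift K M C P \<phi> (\<rho> (aut_inv M m)) =
    tensor_lift K M C P (\<lambda>m0 m1. \<phi> (aut_inv M m0) (aut_inv C m1)) (\<rho> m)"
proof -
  have "(\<lambda>m0 m1. \<phi> (aut_inv M m0) (aut_inv C m1)) \<in> bilinear_map K M C P"
    by (intro bilinear_map_comp[OF \<phi>] M.aut_inv_linear C.aut_inv_linear)
  from coact_aut_lift[OF M.aut_inv_closed[OF m] this]
  have "tensor_lift K M C P (\<lambda>m0 m1. \<phi> (aut_inv M m0) (aut_inv C m1)) (\<rho> m) =
      tensor_lift K M C P (\<lambda>m0 m1. \<phi> (aut_inv M (aut M m0)) (aut_inv C (aut C m1))) (\<rho> (aut_inv M m))"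
    using m by simp
  also have "\<dots> = tensor_lift K M C P \<phi> (\<rho> (aut_inv M m))"
    by (rule tensor_lift_cong) (use m in simp_all)
  finally show ?thesis by simp
qed

text \<open>A trilinear \<open>\<phi>\<close> induces a linear map on \<open>M \<otimes> (C \<otimes> C)\<close>; applying it to both sides of the
  coassociativity axiom gives this identity. It holds for trilinear functions with values in any
  module and is the only form in which coassociativity is used.\<close>
lemma coact_coassoc_lift:
  assumes m: "m \<in> carrier M" and \<phi>: "\<phi> \<in> trilinear_map K M C C P"
  shows "tensor_lift K M C P (\<lambda>m0 m1. tensor_lift K C C P (\<phi> (aut_inv M m0)) (\<Delta> m1)) (\<rho> m) =
    tensor_lift K M C P (\<lambda>m0 m1. tensor_lift K M C P (\<lambda>m00 m01. \<phi> m00 m01 (aut_inv C m1)) (\<rho> m0)) (\<rho> m)"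
proof -
  let ?CC = "tensor K C C" and ?f = "\<lambda>x. tensor_lift K C C P (\<phi> x)"
  note mods = M.is_module C.is_module tensor_is_module[OF C.is_module C.is_module]
  have f: "?f \<in> bilinear_map K M ?CC P"
    by (rule bilinear_mapI)
       (intro tensor_lift_linear[OF C.is_module C.is_module P] linear_map_ident trilinear_map_bilinear[OF \<phi>]
          tensor_lift_linear_in_function[OF C.is_module C.is_module P M.is_module]
          trilinear_map_linear[OF \<phi>]; assumption)+
  have f_pure: "?f x (pure_tensor K C C y z) = \<phi> x y z" if "x \<in> carrier M" "y \<in> carrier C" "z \<in> carrier C" for x y z
    using that by (intro tensor_lift_pure[OF C.is_module C.is_module P] trilinear_map_bilinear[OF \<phi>])
  have "tensor_lift K M C (tensor K M ?CC) (\<lambda>m0 m1. pure_tensor K M ?CC (aut_inv M m0) (\<Delta> m1)) (\<rho> m) =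
      tensor_lift K M C (tensor K M ?CC) (\<lambda>m0 m1. tensor_lift K M C (tensor K M ?CC) (\<lambda>m00 m01.
          pure_tensor K M ?CC m00 (pure_tensor K C C m01 (aut_inv C m1))) (\<rho> m0)) (\<rho> m)"
    unfolding tensor_lift_def using coact_coassoc[OF m] by (simp add: Let_def)
  then have "tensor_lift K M ?CC P ?f
        (tensor_lift K M C (tensor K M ?CC) (\<lambda>m0 m1. pure_tensor K M ?CC (aut_inv M m0) (\<Delta> m1)) (\<rho> m)) =
      tensor_lift K M ?CC P ?f
        (tensor_lift K M C (tensor K M ?CC) (\<lambda>m0 m1. tensor_lift K M C (tensor K M ?CC) (\<lambda>m00 m01.
          pure_tensor K M ?CC m00 (pure_tensor K C C m01 (aut_inv C m1))) (\<rho> m0)) (\<rho> m))"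
    by simp
  moreover have "tensor_lift K M ?CC P ?f
        (tensor_lift K M C (tensor K M ?CC) (\<lambda>m0 m1. pure_tensor K M ?CC (aut_inv M m0) (\<Delta> m1)) (\<rho> m)) =
      tensor_lift K M C P (\<lambda>m0 m1. ?f (aut_inv M m0) (\<Delta> m1)) (\<rho> m)"
    by (rule tensor_lift_sum_of_pure[OF mods(1,3,1,2) P f]) (use m in simp_all)
  moreover have "tensor_lift K M ?CC P ?f
        (tensor_lift K M C (tensor K M ?CC) (\<lambda>m0 m1. tensor_lift K M C (tensor K M ?CC) (\<lambda>m00 m01.
          pure_tensor K M ?CC m00 (pure_tensor K C C m01 (aut_inv C m1))) (\<rho> m0)) (\<rho> m)) =
      tensor_lift K M C P (\<lambda>m0 m1. tensor_lift K M ?CC P ?f (tensor_lift K M C (tensor K M ?CC) (\<lambda>m00 m01.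
          pure_tensor K M ?CC m00 (pure_tensor K C C m01 (aut_inv C m1))) (\<rho> m0))) (\<rho> m)"
    by (rule tensor_lift_tensor_lift[OF mods(1,3,1,2) P f])
       (use m in \<open>simp_all add: tensor_lift_closed pure_tensor_closed mods tensor_is_module\<close>)
  moreover have "\<dots> = tensor_lift K M C P (\<lambda>m0 m1. tensor_lift K M C P (\<lambda>m00 m01.
          ?f m00 (pure_tensor K C C m01 (aut_inv C m1))) (\<rho> m0)) (\<rho> m)"
    by (rule tensor_lift_cong[OF mods(1,2) refl], use m in simp,
        rule tensor_lift_sum_of_pure[OF mods(1,3,1,2) P f])
       (simp_all add: pure_tensor_closed)
  moreover have "\<dots> = tensor_lift K M C P (\<lambda>m0 m1. tensor_lift K M C P (\<lambda>m00 m01.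
          \<phi> m00 m01 (aut_inv C m1)) (\<rho> m0)) (\<rho> m)"
    by (intro tensor_lift_cong[OF mods(1,2) refl] f_pure) (use m in simp_all)
  ultimately show ?thesis by simp
qed

lemma coact_counit_lift:
  assumes m: "m \<in> carrier M" and g: "g \<in> linear_map K M P"
  shows "tensor_lift K M C P (\<lambda>m0 m1. \<epsilon> m1 \<odot>\<^bsub>P\<^esub> g m0) (\<rho> m) = g (aut_inv M m)"
proof -
  have "tensor_lift K M C M (\<lambda>m0 m1. \<epsilon> m1 \<odot>\<^bsub>M\<^esub> m0) (\<rho> m) = aut_inv M m"
    unfolding tensor_lift_def using m by (rule coact_counit)
  then have "g (aut_inv M m) = tensor_lift K M C P (\<lambda>m0 m1. g (\<epsilon> m1 \<odot>\<^bsub>M\<^esub> m0)) (\<rho> m)"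
    using m linear_tensor_lift[OF M.is_module C.is_module M.is_module P g, of "\<rho> m" "\<lambda>m0 m1. \<epsilon> m1 \<odot>\<^bsub>M\<^esub> m0"]
    by simp
  also have "\<dots> = tensor_lift K M C P (\<lambda>m0 m1. \<epsilon> m1 \<odot>\<^bsub>P\<^esub> g m0) (\<rho> m)"
    by (rule tensor_lift_cong) (use m in \<open>simp_all add: linear_map_smult[OF g]\<close>)
  finally show ?thesis by simp
qed

end

end

text \<open>The coalgebra axioms contain the comodule axioms, so the rules above also serve for \<open>\<Delta>\<close>.\<close>
lemma (in hom_coalgebra) regular_comodule: "right_hom_comodule K C \<Delta> \<epsilon> C \<Delta>"
  by (intro right_hom_comodule.intro right_hom_comodule_axioms.intro hom_coalgebra_axioms hom_object_axioms
      comul_linear hom_coassoc counit_right comul_aut)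

sublocale hom_coalgebra \<subseteq> regular: right_hom_comodule K C \<Delta> \<epsilon> C \<Delta>
  by (rule regular_comodule)

context hom_coalgebra
begin

declare counit_aut [simp]

lemma counit_aut_inv [simp]: "c \<in> carrier C \<Longrightarrow> \<epsilon> (aut_inv C c) = \<epsilon> c"
  using counit_aut[of "aut_inv C c"] by simp

lemma counit_left_lift:
  assumes P: "module K P" and c: "c \<in> carrier C" and g: "g \<in> linear_map K C P"
  shows "tensor_lift K C C P (\<lambda>c1 c2. \<epsilon> c1 \<odot>\<^bsub>P\<^esub> g c2) (\<Delta> c) = g (aut_inv C c)"
proof -
  have "tensor_lift K C C C (\<lambda>c1 c2. \<epsilon> c1 \<odot>\<^bsub>C\<^esub> c2) (\<Delta> c) = aut_inv C c"
    unfolding tensor_lift_def using c by (rule counit_left)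
  then have "g (aut_inv C c) = tensor_lift K C C P (\<lambda>c1 c2. g (\<epsilon> c1 \<odot>\<^bsub>C\<^esub> c2)) (\<Delta> c)"
    using c linear_tensor_lift[OF is_module is_module is_module P g, of "\<Delta> c" "\<lambda>c1 c2. \<epsilon> c1 \<odot>\<^bsub>C\<^esub> c2"]
    by simp
  also have "\<dots> = tensor_lift K C C P (\<lambda>c1 c2. \<epsilon> c1 \<odot>\<^bsub>P\<^esub> g c2) (\<Delta> c)"
    by (rule tensor_lift_cong) (use c in \<open>simp_all add: linear_map_smult[OF g]\<close>)
  finally show ?thesis by simp
qed

lemmas comul_aut_lift = regular.coact_aut_lift
lemmas comul_aut_inv_lift = regular.coact_aut_inv_lift
lemmas comul_coassoc_lift = regular.coact_coassoc_lift
lemmas counit_right_lift = regular.coact_counit_lift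

end

context hom_comodule_algebra
begin

lemma coact_mult_lift:
  assumes "module K P" "a \<in> carrier A" "a' \<in> carrier A" "\<phi> \<in> bilinear_map K A B P"
  shows "tensor_lift K A B P \<phi> (\<rho> (a \<otimes>\<^bsub>A\<^esub> a')) =
    tensor_lift K A B P (\<lambda>a0 a1. tensor_lift K A B P (\<lambda>a'0 a'1. \<phi> (a0 \<otimes>\<^bsub>A\<^esub> a'0) (a1 \<otimes>\<^bsub>B\<^esub> a'1)) (\<rho> a')) (\<rho> a)"
proof -
  have "\<rho> (a \<otimes>\<^bsub>A\<^esub> a') = tensor_lift K A B (tensor K A B) (\<lambda>a0 a1. tensor_lift K A B (tensor K A B) (\<lambda>a'0 a'1.
      pure_tensor K A B (a0 \<otimes>\<^bsub>A\<^esub> a'0) (a1 \<otimes>\<^bsub>B\<^esub> a'1)) (\<rho> a')) (\<rho> a)"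
    unfolding tensor_lift_def using coact_mult[OF assms(2,3)] by (simp add: Let_def)
  then show ?thesis
    using assms by (simp add: tensor_lift_double_sum_of_pure)
qed

end

context hom_module_coalgebra
begin

lemma comul_act_lift:
  assumes "module K P" "c \<in> carrier C" "b \<in> carrier B" "\<phi> \<in> bilinear_map K C C P"
  shows "tensor_lift K C C P \<phi> (\<Delta> (act c b)) =
    tensor_lift K C C P (\<lambda>c1 c2. tensor_lift K B B P (\<lambda>b1 b2. \<phi> (act c1 b1) (act c2 b2)) (\<Delta>\<^sub>B b)) (\<Delta> c)"
proof -
  have "\<Delta> (act c b) = tensor_lift K C C (tensor K C C) (\<lambda>c1 c2. tensor_lift K B B (tensor K C C) (\<lambda>b1 b2.
      pure_tensor K C C (act c1 b1) (act c2 b2)) (\<Delta>\<^sub>B b)) (\<Delta> c)"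
    unfolding tensor_lift_def using comul_act[OF assms(2,3)] by (simp add: Let_def)
  then show ?thesis
    using assms by (simp add: tensor_lift_double_sum_of_pure)
qed

end


section \<open>The entwining structure\<close>

text \<open>The data of the theorem: a comodule algebra and a module coalgebra over the same Hom-bialgebra.
  The classical case \<open>\<alpha> = \<beta> = \<gamma> = id\<close> is a Doi-Koppinen structure.\<close>
locale hom_doi_koppinen =
  CA: hom_comodule_algebra K B \<Delta>\<^sub>B \<epsilon>\<^sub>B A \<rho> + MC: hom_module_coalgebra K B \<Delta>\<^sub>B \<epsilon>\<^sub>B C \<Delta> \<epsilon> act
  for K :: "'k ring" and B :: "('k, 'b) hom_object"
    and \<Delta>\<^sub>B :: "'b \<Rightarrow> ('k, 'b, 'b) tensor" and \<epsilon>\<^sub>B :: "'b \<Rightarrow> 'k"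
    and A :: "('k, 'a) hom_object" and \<rho> :: "'a \<Rightarrow> ('k, 'a, 'b) tensor"
    and C :: "('k, 'c) hom_object" and \<Delta> :: "'c \<Rightarrow> ('k, 'c, 'c) tensor" and \<epsilon> :: "'c \<Rightarrow> 'k"
    and act :: "'c \<Rightarrow> 'b \<Rightarrow> 'c"
begin

lemmas lifts = CA.comod.coact_aut_lift CA.comod.coact_aut_inv_lift CA.coact_mult_lift CA.coact_one
  MC.C.comul_aut_lift MC.C.comul_aut_inv_lift MC.comul_act_lift

abbreviation "AC \<equiv> tensor K A C"

lemma psi_pure:
  assumes "c \<in> carrier C" "a \<in> carrier A"
  shows "induced_psi K A C \<rho> act (pure_tensor K C A c a) =
    tensor_lift K A B AC (\<lambda>a0 a1. pure_tensor K A C (aut A a0) (act (aut_inv C c) a1)) (\<rho> a)"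
  unfolding induced_psi_def tensor_lift_def[of K A B, symmetric] tensor_lift_def[of K C A, symmetric]
  using assms by (simp add: sweedler_simps)

lemma psi_linear: "induced_psi K A C \<rho> act \<in> linear_map K (tensor K C A) AC"
  unfolding induced_psi_def[abs_def] tensor_lift_def[of K A B, symmetric] tensor_lift_def[of K C A, symmetric]
  by (simp add: sweedler_simps)

text \<open>Both sides become sums over \<open>\<rho>(a)\<close> and \<open>\<rho>(a')\<close>, because \<open>\<rho>\<close> is multiplicative; the twists then
  match by Hom-associativity of the action of \<open>B\<close> on \<open>C\<close>.\<close>
lemma psi_mult:
  assumes "a \<in> carrier A" "a' \<in> carrier A" "c \<in> carrier C"
  shows "induced_psi K A C \<rho> act (pure_tensor K C A (aut C c) (a \<otimes>\<^bsub>A\<^esub> a')) =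
        tensor_lift K A C AC (\<lambda>a\<^sub>k c\<^sub>k. tensor_lift K A C AC (\<lambda>a'\<^sub>l c\<^sub>k\<^sub>l.
          pure_tensor K A C (a\<^sub>k \<otimes>\<^bsub>A\<^esub> a'\<^sub>l) (aut C c\<^sub>k\<^sub>l))
            (induced_psi K A C \<rho> act (pure_tensor K C A c\<^sub>k a'))) (induced_psi K A C \<rho> act (pure_tensor K C A c a))"
  using assms by (simp add: sweedler_simps lifts psi_pure MC.mod.act_act cong: tensor_lift_cong)

text \<open>The left side involves \<open>\<Delta>(\<gamma>\<^sup>-\<^sup>1(c) a\<^sub>1) = \<gamma>\<^sup>-\<^sup>1(c\<^sub>1) a\<^sub>1\<^sub>1 \<otimes> \<gamma>\<^sup>-\<^sup>1(c\<^sub>2) a\<^sub>1\<^sub>2\<close>, the right side the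
  iterated coaction \<open>a\<^sub>0\<^sub>0 \<otimes> a\<^sub>0\<^sub>1 \<otimes> a\<^sub>1\<close>; coassociativity of \<open>\<rho>\<close> identifies them.\<close>
lemma psi_comul:
  assumes a: "a \<in> carrier A" and c: "c \<in> carrier C"
  defines "CC \<equiv> tensor K C C" and "T \<equiv> tensor K A (tensor K C C)"
  shows "tensor_lift K A C T (\<lambda>a\<^sub>k c\<^sub>k. pure_tensor K A CC (aut_inv A a\<^sub>k) (\<Delta> c\<^sub>k))
          (induced_psi K A C \<rho> act (pure_tensor K C A c a)) =
        tensor_lift K C C T (\<lambda>c1 c2. tensor_lift K A C T (\<lambda>a\<^sub>k c2\<^sub>k. tensor_lift K A C T (\<lambda>a\<^sub>k\<^sub>l c1\<^sub>l.
          pure_tensor K A CC a\<^sub>k\<^sub>l (pure_tensor K C C c1\<^sub>l c2\<^sub>k))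
            (induced_psi K A C \<rho> act (pure_tensor K C A c1 a\<^sub>k)))
              (induced_psi K A C \<rho> act (pure_tensor K C A c2 (aut_inv A a)))) (\<Delta> c)"
proof -
  have T: "module K T" unfolding T_def by (simp add: sweedler_simps)
  have expand: "pure_tensor K A CC x (\<Delta> d) = tensor_lift K C C T (\<lambda>y z. pure_tensor K A CC x (pure_tensor K C C y z)) (\<Delta> d)"
    if "x \<in> carrier A" "d \<in> carrier C" for x d
    unfolding CC_def T_def using that
    by (intro linear_eq_tensor_lift) (simp_all add: sweedler_simps)
  let ?\<phi> = "\<lambda>c1 c2 x b1 b2. pure_tensor K A CC (aut A x) (pure_tensor K C C (act (aut_inv C c1) b1) (act (aut_inv C c2) b2))"
  have "tensor_lift K A C T (\<lambda>a\<^sub>k c\<^sub>k. pure_tensor K A CC (aut_inv A a\<^sub>k) (\<Delta> c\<^sub>k))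
          (induced_psi K A C \<rho> act (pure_tensor K C A c a)) =
      tensor_lift K A B T (\<lambda>a0 a1. tensor_lift K C C T (\<lambda>c1 c2.
        tensor_lift K B B T (?\<phi> c1 c2 (aut_inv A a0)) (\<Delta>\<^sub>B a1)) (\<Delta> c)) (\<rho> a)"
    using a c expand unfolding CC_def T_def
    by (simp add: sweedler_simps lifts psi_pure cong: tensor_lift_cong)
  also have "\<dots> = tensor_lift K C C T (\<lambda>c1 c2. tensor_lift K A B T (\<lambda>a0 a1.
        tensor_lift K B B T (?\<phi> c1 c2 (aut_inv A a0)) (\<Delta>\<^sub>B a1)) (\<rho> a)) (\<Delta> c)"
    using a c unfolding CC_def T_def by (intro tensor_lift_swap) (simp_all add: sweedler_simps)
  also have "\<dots> = tensor_lift K C C T (\<lambda>c1 c2. tensor_lift K A B T (\<lambda>a0 a1.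
        tensor_lift K A B T (\<lambda>a00 a01. ?\<phi> c1 c2 a00 a01 (aut_inv B a1)) (\<rho> a0)) (\<rho> a)) (\<Delta> c)"
    using a c unfolding CC_def T_def
    by (intro tensor_lift_cong CA.comod.coact_coassoc_lift) (simp_all add: sweedler_simps)
  also have "\<dots> = tensor_lift K C C T (\<lambda>c1 c2. tensor_lift K A C T (\<lambda>a\<^sub>k c2\<^sub>k. tensor_lift K A C T (\<lambda>a\<^sub>k\<^sub>l c1\<^sub>l.
          pure_tensor K A CC a\<^sub>k\<^sub>l (pure_tensor K C C c1\<^sub>l c2\<^sub>k))
            (induced_psi K A C \<rho> act (pure_tensor K C A c1 a\<^sub>k)))
              (induced_psi K A C \<rho> act (pure_tensor K C A c2 (aut_inv A a)))) (\<Delta> c)"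
    using a c unfolding CC_def T_def
    by (simp add: sweedler_simps lifts psi_pure cong: tensor_lift_cong)
  finally show ?thesis .
qed

lemma psi_one:
  assumes "c \<in> carrier C"
  shows "induced_psi K A C \<rho> act (pure_tensor K C A c \<one>\<^bsub>A\<^esub>) = pure_tensor K A C \<one>\<^bsub>A\<^esub> c"
  using assms by (simp add: sweedler_simps lifts psi_pure cong: tensor_lift_cong)

text \<open>The scalar \<open>\<epsilon>(c)\<close> is moved next to \<open>a\<^sub>0\<close>, so that the counit law of \<open>\<rho>\<close> can absorb \<open>\<epsilon>\<^sub>B(a\<^sub>1)\<close>.\<close>
lemma psi_counit:
  assumes "a \<in> carrier A" "c \<in> carrier C"
  shows "tensor_lift K A C A (\<lambda>a\<^sub>k c\<^sub>k. \<epsilon> c\<^sub>k \<odot>\<^bsub>A\<^esub> a\<^sub>k) (induced_psi K A C \<rho> act (pure_tensor K C A c a)) = \<epsilon> c \<odot>\<^bsub>A\<^esub> a"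
proof -
  have "tensor_lift K A C A (\<lambda>a\<^sub>k c\<^sub>k. \<epsilon> c\<^sub>k \<odot>\<^bsub>A\<^esub> a\<^sub>k) (induced_psi K A C \<rho> act (pure_tensor K C A c a)) =
      tensor_lift K A B A (\<lambda>a0 a1. (\<epsilon> c \<otimes>\<^bsub>K\<^esub> \<epsilon>\<^sub>B a1) \<odot>\<^bsub>A\<^esub> aut A a0) (\<rho> a)"
    using assms by (simp add: sweedler_simps psi_pure MC.counit_act cong: tensor_lift_cong)
  also have "\<dots> = tensor_lift K A B A (\<lambda>a0 a1. \<epsilon>\<^sub>B a1 \<odot>\<^bsub>A\<^esub> (\<epsilon> c \<odot>\<^bsub>A\<^esub> aut A a0)) (\<rho> a)"
    using assms by (intro tensor_lift_cong) (simp_all flip: CA.A.smult_assoc1 add: CA.B.R.m_comm)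
  also have "\<dots> = \<epsilon> c \<odot>\<^bsub>A\<^esub> a"
    using assms by (subst CA.comod.coact_counit_lift) (simp_all add: sweedler_simps)
  finally show ?thesis .
qed

lemma psi_morphism: "induced_psi K A C \<rho> act \<in> hom_morphism K (tensor K C A) AC"
proof -
  interpret CA': hom_tensor K C A by (intro hom_tensor.intro CA.A.hom_object_axioms MC.C.hom_object_axioms)
  interpret AC: hom_tensor K A C by (intro hom_tensor.intro CA.A.hom_object_axioms MC.C.hom_object_axioms)
  have "aut AC (induced_psi K A C \<rho> act t) = induced_psi K A C \<rho> act (aut (tensor K C A) t)" 
    if "t \<in> carrier (tensor K C A)" for t
    by (rule tensor_linear_ext[OF CA'.MN AC.T linear_map_comp[OF AC.aut_tensor_linear psi_linear]
          linear_map_comp[OF psi_linear CA'.aut_tensor_linear] _ that])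
       (simp add: sweedler_simps lifts psi_pure CA'.aut_tensor_pure AC.aut_tensor_pure aut_tensor[of K A C]
         cong: tensor_lift_cong)
  then show ?thesis by (simp add: hom_morphism_def psi_linear)
qed

context
  fixes M :: "('k, 'm) hom_object" and act\<^sub>M \<rho>\<^sub>M
  assumes mod: "right_hom_module K A M act\<^sub>M" and comod: "right_hom_comodule K C \<Delta> \<epsilon> M \<rho>\<^sub>M"
begin

interpretation M: right_hom_module K A M act\<^sub>M by (rule mod)
interpretation M': right_hom_comodule K C \<Delta> \<epsilon> M \<rho>\<^sub>M by (rule comod)

text \<open>Substituting \<open>\<psi>\<close> in the entwined compatibility condition, the twist \<open>\<alpha>\<^sup>-\<^sup>1\<close> on \<open>a\<close> cancels
  against the twists \<open>\<alpha>\<close> and \<open>\<gamma>\<close>.\<close>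
lemma entwined_compatibility:
  assumes "m \<in> carrier M" "a \<in> carrier A"
  shows "tensor_lift K M C (tensor K M C) (\<lambda>m0 m1. tensor_lift K A C (tensor K M C) (\<lambda>a\<^sub>k m1\<^sub>k.
          pure_tensor K M C (act\<^sub>M m0 a\<^sub>k) (aut C m1\<^sub>k))
            (induced_psi K A C \<rho> act (pure_tensor K C A m1 (aut_inv A a)))) (\<rho>\<^sub>M m) =
     tensor_lift K M C (tensor K M C) (\<lambda>m0 m1. tensor_lift K A B (tensor K M C) (\<lambda>a0 a1.
          pure_tensor K M C (act\<^sub>M m0 a0) (act m1 a1)) (\<rho> a)) (\<rho>\<^sub>M m)"
  using assms by (simp add: sweedler_simps lifts psi_pure cong: tensor_lift_cong)

end

lemma hom_entwining: "hom_entwining K A C \<Delta> \<epsilon> (induced_psi K A C \<rho> act)"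
proof (intro hom_entwining.intro hom_entwining_axioms.intro CA.A.hom_algebra_axioms MC.C.hom_coalgebra_axioms
    psi_morphism)
  fix a a' c assume "a \<in> carrier A" "a' \<in> carrier A" "c \<in> carrier C"
  from psi_mult[OF this, unfolded tensor_lift_def] show
    "let T = AC in
        induced_psi K A C \<rho> act (pure_tensor K C A (aut C c) (a \<otimes>\<^bsub>A\<^esub> a')) =
        sweedler K T (\<lambda>a\<^sub>k c\<^sub>k. sweedler K T (\<lambda>a'\<^sub>l c\<^sub>k\<^sub>l.
          pure_tensor K A C (a\<^sub>k \<otimes>\<^bsub>A\<^esub> a'\<^sub>l) (aut C c\<^sub>k\<^sub>l))
            (induced_psi K A C \<rho> act (pure_tensor K C A c\<^sub>k a'))) (induced_psi K A C \<rho> act (pure_tensor K C A c a))"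
    unfolding Let_def .
qed (auto simp: psi_one psi_comul[unfolded tensor_lift_def] psi_counit[unfolded tensor_lift_def])

lemma entwined_iff:
  "entwined_hom_module K A C \<Delta> \<epsilon> (induced_psi K A C \<rho> act) M act\<^sub>M \<rho>\<^sub>M \<longleftrightarrow>
    right_hom_module K A M act\<^sub>M \<and> right_hom_comodule K C \<Delta> \<epsilon> M \<rho>\<^sub>M \<and>
    (\<forall>m\<in>carrier M. \<forall>a\<in>carrier A. \<rho>\<^sub>M (act\<^sub>M m a) =
       sweedler K (tensor K M C) (\<lambda>m0 m1. sweedler K (tensor K M C) (\<lambda>a0 a1.
          pure_tensor K M C (act\<^sub>M m0 a0) (act m1 a1)) (\<rho> a)) (\<rho>\<^sub>M m))"
  unfolding entwined_hom_module_def entwined_hom_module_axioms_def Let_def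
  using hom_entwining entwined_compatibility[unfolded tensor_lift_def, of M act\<^sub>M \<rho>\<^sub>M] by auto

end


section \<open>The convolution algebra\<close>

context hom_doi_koppinen
begin

text \<open>The product on all functions, without the restriction to \<open>carrier C\<close> that \<open>H\<close> imposes; products can
  then be nested by unfolding.\<close>
definition conv where
  "conv f g c = tensor_lift K C C A (\<lambda>c1 c2. tensor_lift K A B A (\<lambda>f0 f1.
         aut A f0 \<otimes>\<^bsub>A\<^esub> g (act (aut_inv C c1) f1)) (\<rho> (f c2))) (\<Delta> c)"

abbreviation "H \<equiv> hom_convolution_algebra K C \<Delta> \<epsilon> A \<rho> act"

lemma H_simps:
  "carrier H = hom_morphism K C A \<inter> extensional (carrier C)"
  "f \<otimes>\<^bsub>H\<^esub> g = (\<lambda>c\<in>carrier C. conv f g c)"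
  "\<one>\<^bsub>H\<^esub> = (\<lambda>c\<in>carrier C. \<epsilon> c \<odot>\<^bsub>A\<^esub> \<one>\<^bsub>A\<^esub>)"
  "\<zero>\<^bsub>H\<^esub> = (\<lambda>c\<in>carrier C. \<zero>\<^bsub>A\<^esub>)"
  "f \<oplus>\<^bsub>H\<^esub> g = (\<lambda>c\<in>carrier C. f c \<oplus>\<^bsub>A\<^esub> g c)"
  "r \<odot>\<^bsub>H\<^esub> f = (\<lambda>c\<in>carrier C. r \<odot>\<^bsub>A\<^esub> f c)"
  by (simp_all add: hom_convolution_algebra_def conv_def tensor_lift_def)

lemma morphism_linear: "f \<in> hom_morphism K C A \<Longrightarrow> f \<in> linear_map K C A"
  by (simp add: hom_morphism_def)

lemma morphism_comp_linear: "f \<in> hom_morphism K C A \<Longrightarrow> g \<in> linear_map K X C \<Longrightarrow> (\<lambda>x. f (g x)) \<in> linear_map K X A"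
  by (rule linear_map_comp[OF morphism_linear])

lemma morphism_closed: "f \<in> hom_morphism K C A \<Longrightarrow> c \<in> carrier C \<Longrightarrow> f c \<in> carrier A"
  by (rule linear_map_closed[OF morphism_linear])

lemma morphism_aut: "f \<in> hom_morphism K C A \<Longrightarrow> c \<in> carrier C \<Longrightarrow> aut A (f c) = f (aut C c)"
  by (simp add: hom_morphism_def)

lemma morphism_aut_inv: "f \<in> hom_morphism K C A \<Longrightarrow> c \<in> carrier C \<Longrightarrow> aut_inv A (f c) = f (aut_inv C c)"
  by (rule CA.A.aut_inv_unique) (simp_all add: morphism_closed morphism_aut)

lemma coact_morphism_lift:
  assumes f: "f \<in> hom_morphism K C A" and P: "module K P" and c: "c \<in> carrier C" and \<phi>: "\<phi> \<in> bilinear_map K A B P"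
  shows "tensor_lift K A B P \<phi> (\<rho> (f (aut C c))) = tensor_lift K A B P (\<lambda>a0 a1. \<phi> (aut A a0) (aut B a1)) (\<rho> (f c))"
    and "tensor_lift K A B P \<phi> (\<rho> (f (aut_inv C c))) = tensor_lift K A B P (\<lambda>a0 a1. \<phi> (aut_inv A a0) (aut_inv B a1)) (\<rho> (f c))"
  using CA.comod.coact_aut_lift[OF P morphism_closed[OF f c] \<phi>]
    CA.comod.coact_aut_inv_lift[OF P morphism_closed[OF f c] \<phi>]
  by (simp_all add: morphism_aut[OF f c] morphism_aut_inv[OF f c])

lemmas morphism_rules = morphism_comp_linear morphism_closed morphism_aut morphism_aut_inv
  coact_morphism_lift

text \<open>Operations on \<open>A\<close> are linear, so they pass under a Sweedler sum.\<close>
lemma lift_under_operation: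
  assumes "module K X" "module K Y" "t \<in> carrier (tensor K X Y)"
    and "\<And>x y. \<lbrakk>x \<in> carrier X; y \<in> carrier Y\<rbrakk> \<Longrightarrow> \<phi> x y \<in> carrier A"
  shows "aut A (tensor_lift K X Y A \<phi> t) = tensor_lift K X Y A (\<lambda>x y. aut A (\<phi> x y)) t"
    and "a \<in> carrier A \<Longrightarrow> a \<otimes>\<^bsub>A\<^esub> tensor_lift K X Y A \<phi> t = tensor_lift K X Y A (\<lambda>x y. a \<otimes>\<^bsub>A\<^esub> \<phi> x y) t"
    and "a \<in> carrier A \<Longrightarrow> tensor_lift K X Y A \<phi> t \<otimes>\<^bsub>A\<^esub> a = tensor_lift K X Y A (\<lambda>x y. \<phi> x y \<otimes>\<^bsub>A\<^esub> a) t"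
    and "module K P \<Longrightarrow> \<psi> \<in> bilinear_map K A B P \<Longrightarrow> tensor_lift K A B P \<psi> (\<rho> (tensor_lift K X Y A \<phi> t)) =
      tensor_lift K X Y P (\<lambda>x y. tensor_lift K A B P \<psi> (\<rho> (\<phi> x y))) t"
  by (rule linear_tensor_lift[OF assms(1,2) CA.A.is_module _ _ assms(3,4)],
      simp_all add: sweedler_simps)+

lemma conv_morphism:
  assumes f: "f \<in> hom_morphism K C A" and g: "g \<in> hom_morphism K C A"
  shows "conv f g \<in> hom_morphism K C A"
proof -
  have "conv f g \<in> linear_map K C A"
    unfolding conv_def[abs_def]
    by (simp add: sweedler_simps morphism_rules[OF f] morphism_rules[OF g])
  moreover have "aut A (conv f g c) = conv f g (aut C c)" if "c \<in> carrier C" for c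
    using that unfolding conv_def
    by (simp add: sweedler_simps morphism_rules[OF f] morphism_rules[OF g] lift_under_operation lifts cong: tensor_lift_cong)
  ultimately show ?thesis by (simp add: hom_morphism_def)
qed

lemma conv_alternative:
  assumes f: "f \<in> hom_morphism K C A" and g: "g \<in> hom_morphism K C A" and c: "c \<in> carrier C"
  shows "conv f g c = tensor_lift K C C A (\<lambda>c1 c2. tensor_lift K A B A (\<lambda>f0 f1.
            f0 \<otimes>\<^bsub>A\<^esub> aut_inv A (g (act c1 f1))) (\<rho> (aut A (f c2)))) (\<Delta> c)"
  using c unfolding conv_def
  by (simp add: sweedler_simps morphism_rules[OF f] morphism_rules[OF g] lifts cong: tensor_lift_cong)

text \<open>Expanding \<open>f * (g * h)\<close> gives components \<open>c\<^sub>1\<^sub>1, c\<^sub>1\<^sub>2, c\<^sub>2\<close> and, with \<open>F = f(c\<^sub>2)\<close>, components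
  \<open>F\<^sub>0, F\<^sub>1\<^sub>1, F\<^sub>1\<^sub>2\<close>; expanding \<open>(f * g) * h\<close> gives \<open>c\<^sub>1, c\<^sub>2\<^sub>1, c\<^sub>2\<^sub>2\<close> and, with \<open>F = f(c\<^sub>2\<^sub>2)\<close>,
  \<open>F\<^sub>0\<^sub>0, F\<^sub>0\<^sub>1, F\<^sub>1\<close>. Coassociativity of \<open>\<rho>\<close> followed by coassociativity of \<open>\<Delta>\<close> leads from the first
  to the second. In \<open>?\<Phi> u v x y z\<close> the first two arguments stand for components of \<open>c\<close> and the last
  three for those of \<open>F\<close>; \<open>?\<Psi>\<close> puts the third component of \<open>c\<close> into \<open>f\<close>.\<close>
lemma conv_assoc:
  assumes f: "f \<in> hom_morphism K C A" and g: "g \<in> hom_morphism K C A" and h: "h \<in> hom_morphism K C A"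
    and c: "c \<in> carrier C"
  shows "conv (conv f g) h c = conv f (conv g h) c"
proof -
  let ?\<Phi> = "\<lambda>u v x y z. tensor_lift K A B A (\<lambda>G0 G1. aut A (aut A x) \<otimes>\<^bsub>A\<^esub>
      (aut A G0 \<otimes>\<^bsub>A\<^esub> h (act (aut_inv C u) (y \<otimes>\<^bsub>B\<^esub> aut_inv B G1)))) (\<rho> (g (act (aut_inv C v) z)))"
  let ?\<Psi> = "\<lambda>u v w. tensor_lift K A B A (\<lambda>F0 F1. tensor_lift K A B A (\<lambda>F00 F01.
      ?\<Phi> u v F00 (aut_inv B F01) (aut_inv B F1)) (\<rho> F0)) (\<rho> (f (aut C w)))"
  note rules = sweedler_simps morphism_rules[OF f] morphism_rules[OF g] morphism_rules[OF h] lift_under_operation lifts CA.A.mult_assoc MC.mod.act_act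
  have "conv f (conv g h) c = tensor_lift K C C A (\<lambda>c1 c2. tensor_lift K A B A (\<lambda>F0 F1.
      tensor_lift K C C A (\<lambda>c11 c12. tensor_lift K B B A (\<lambda>F11 F12.
        ?\<Phi> c11 c12 (aut_inv A F0) (aut_inv B F11) F12) (\<Delta>\<^sub>B F1)) (\<Delta> c1)) (\<rho> (f c2))) (\<Delta> c)"
    using c unfolding conv_def
    by (simp add: rules cong: tensor_lift_cong)
  also have "\<dots> = tensor_lift K C C A (\<lambda>c1 c2. tensor_lift K C C A (\<lambda>c11 c12.
      tensor_lift K A B A (\<lambda>F0 F1. tensor_lift K B B A (\<lambda>F11 F12.
        ?\<Phi> c11 c12 (aut_inv A F0) (aut_inv B F11) F12) (\<Delta>\<^sub>B F1)) (\<rho> (f c2))) (\<Delta> c1)) (\<Delta> c)"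
    using c by (intro tensor_lift_cong tensor_lift_swap) (simp_all add: sweedler_simps morphism_rules[OF f] morphism_rules[OF g] morphism_rules[OF h])
  also have "\<dots> = tensor_lift K C C A (\<lambda>c1 c2. tensor_lift K C C A (\<lambda>c11 c12.
      tensor_lift K A B A (\<lambda>F0 F1. tensor_lift K A B A (\<lambda>F00 F01.
        ?\<Phi> c11 c12 F00 (aut_inv B F01) (aut_inv B F1)) (\<rho> F0)) (\<rho> (f c2))) (\<Delta> c1)) (\<Delta> c)"
    using c by (intro tensor_lift_cong CA.comod.coact_coassoc_lift) (simp_all add: sweedler_simps morphism_rules[OF f] morphism_rules[OF g] morphism_rules[OF h])
  also have "\<dots> = tensor_lift K C C A (\<lambda>c1 c2. tensor_lift K C C A (\<lambda>c11 c12. ?\<Psi> c11 c12 (aut_inv C c2)) (\<Delta> c1)) (\<Delta> c)"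
    using c by (intro tensor_lift_cong) (simp_all add: sweedler_simps morphism_rules[OF f] morphism_rules[OF g] morphism_rules[OF h])
  also have "\<dots> = tensor_lift K C C A (\<lambda>c1 c2. tensor_lift K C C A (?\<Psi> (aut_inv C c1)) (\<Delta> c2)) (\<Delta> c)"
    using c by (intro MC.C.comul_coassoc_lift[symmetric]) (simp_all add: sweedler_simps morphism_rules[OF f] morphism_rules[OF g] morphism_rules[OF h])
  also have "\<dots> = conv (conv f g) h c"
    using c unfolding conv_def
    by (simp add: rules cong: tensor_lift_cong)
  finally show ?thesis by simp
qed


text \<open>Needed because the product of \<open>H\<close> is a function restricted to \<open>carrier C\<close>, and it is fed into
  another product.\<close>
lemma conv_cong:
  assumes "\<And>c. c \<in> carrier C \<Longrightarrow> f c = f' c" "\<And>c. c \<in> carrier C \<Longrightarrow> g c = g' c"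
    and f: "f' \<in> hom_morphism K C A" and c: "c \<in> carrier C"
  shows "conv f g c = conv f' g' c"
  unfolding conv_def using assms(1,2) c
  by (simp add: sweedler_simps morphism_rules[OF f] cong: tensor_lift_cong)

lemma H_eqI:
  assumes "f \<in> carrier H" "g \<in> carrier H" "\<And>c. c \<in> carrier C \<Longrightarrow> f c = g c"
  shows "f = g"
  using assms by (auto simp: H_simps intro: extensionalityI)

lemma restrict_morphism:
  assumes "f \<in> hom_morphism K C A"
  shows "(\<lambda>c\<in>carrier C. f c) \<in> carrier H"
  using assms linear_map_cong[OF MC.C.is_module, of f A "\<lambda>c\<in>carrier C. f c"]
  by (auto simp: H_simps hom_morphism_def)

lemma H_carrierD: "f \<in> carrier H \<Longrightarrow> f \<in> hom_morphism K C A"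
  by (simp add: H_simps)

lemma H_value_closed: "f \<in> carrier H \<Longrightarrow> c \<in> carrier C \<Longrightarrow> f c \<in> carrier A"
  by (rule morphism_closed[OF H_carrierD])

lemma H_closed:
  shows "\<zero>\<^bsub>H\<^esub> \<in> carrier H"
    and "\<one>\<^bsub>H\<^esub> \<in> carrier H"
    and "f \<in> carrier H \<Longrightarrow> g \<in> carrier H \<Longrightarrow> f \<oplus>\<^bsub>H\<^esub> g \<in> carrier H"
    and "r \<in> carrier K \<Longrightarrow> f \<in> carrier H \<Longrightarrow> r \<odot>\<^bsub>H\<^esub> f \<in> carrier H"
    and "f \<in> carrier H \<Longrightarrow> g \<in> carrier H \<Longrightarrow> f \<otimes>\<^bsub>H\<^esub> g \<in> carrier H"
proof -
  note aut = linear_map_add[OF CA.A.aut_linear] linear_map_smult[OF CA.A.aut_linear]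
    linear_map_zero[OF CA.A.aut_linear CA.A.is_module CA.A.is_module]
  have "(\<lambda>c. \<zero>\<^bsub>A\<^esub>) \<in> hom_morphism K C A"
    by (auto simp: hom_morphism_def linear_map_def aut)
  then show "\<zero>\<^bsub>H\<^esub> \<in> carrier H"
    unfolding H_simps(4) by (rule restrict_morphism)
  have "(\<lambda>c. \<epsilon> c \<odot>\<^bsub>A\<^esub> \<one>\<^bsub>A\<^esub>) \<in> hom_morphism K C A"
    by (simp add: hom_morphism_def aut sweedler_simps)
  then show "\<one>\<^bsub>H\<^esub> \<in> carrier H"
    unfolding H_simps(3) by (rule restrict_morphism)
  assume f: "f \<in> carrier H"
  show "r \<odot>\<^bsub>H\<^esub> f \<in> carrier H" if "r \<in> carrier K"
  proof -
    have "(\<lambda>c. r \<odot>\<^bsub>A\<^esub> f c) \<in> hom_morphism K C A"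
      using that linear_map_scale[OF CA.A.is_module] morphism_rules[OF H_carrierD[OF f]] morphism_linear[OF H_carrierD[OF f]]
      by (simp add: hom_morphism_def aut)
    then show ?thesis unfolding H_simps(6) by (rule restrict_morphism)
  qed
  assume g: "g \<in> carrier H"
  have "(\<lambda>c. f c \<oplus>\<^bsub>A\<^esub> g c) \<in> hom_morphism K C A"
    using linear_map_sum[OF CA.A.is_module _ _ MC.C.is_module] morphism_rules[OF H_carrierD[OF f]]
      morphism_rules[OF H_carrierD[OF g]] morphism_linear[OF H_carrierD[OF f]] morphism_linear[OF H_carrierD[OF g]]
    by (simp add: hom_morphism_def aut)
  then show "f \<oplus>\<^bsub>H\<^esub> g \<in> carrier H" unfolding H_simps(5) by (rule restrict_morphism)
  show "f \<otimes>\<^bsub>H\<^esub> g \<in> carrier H"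
    unfolding H_simps(2) by (rule restrict_morphism[OF conv_morphism[OF H_carrierD[OF f] H_carrierD[OF g]]])
qed

lemma H_values:
  assumes "c \<in> carrier C"
  shows "\<zero>\<^bsub>H\<^esub> c = \<zero>\<^bsub>A\<^esub>" "\<one>\<^bsub>H\<^esub> c = \<epsilon> c \<odot>\<^bsub>A\<^esub> \<one>\<^bsub>A\<^esub>" "(f \<oplus>\<^bsub>H\<^esub> g) c = f c \<oplus>\<^bsub>A\<^esub> g c"
    "(r \<odot>\<^bsub>H\<^esub> f) c = r \<odot>\<^bsub>A\<^esub> f c" "(f \<otimes>\<^bsub>H\<^esub> g) c = conv f g c"
  using assms by (simp_all add: H_simps)

lemma H_module: "module K H"
proof (rule moduleI)
  note cl = H_value_closed H_closed and vals = H_values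
  show "cring K" by (rule CA.B.R.is_cring)
  show "abelian_group H"
  proof (rule abelian_groupI)
    show "\<exists>g\<in>carrier H. g \<oplus>\<^bsub>H\<^esub> f = \<zero>\<^bsub>H\<^esub>" if "f \<in> carrier H" for f
      using that
      by (intro bexI[of _ "(\<ominus>\<^bsub>K\<^esub> \<one>\<^bsub>K\<^esub>) \<odot>\<^bsub>H\<^esub> f"] H_eqI)
         (simp_all add: cl vals CA.A.l_neg flip: module_minus_eq_smult[OF CA.A.is_module])
  qed (auto intro!: H_eqI simp: cl vals CA.A.a_ac)
qed (auto intro!: H_eqI simp: H_closed H_value_closed H_values CA.A.smult_l_distr CA.A.smult_r_distr CA.A.smult_assoc1)

lemma eval_linear: "c \<in> carrier C \<Longrightarrow> (\<lambda>f. f c) \<in> linear_map K H A"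
  by (rule linear_mapI) (simp_all add: H_values H_value_closed)

text \<open>Distributivity and compatibility with scalars in one stroke: \<open>f \<mapsto> f c\<close> is linear on \<open>H\<close>, and the
  convolution formula is linear in each function.\<close>
lemma conv_linear:
  assumes c: "c \<in> carrier C"
  shows "g \<in> carrier H \<Longrightarrow> (\<lambda>f. conv f g c) \<in> linear_map K H A"
    and "f \<in> carrier H \<Longrightarrow> (\<lambda>g. conv f g c) \<in> linear_map K H A"
proof -
  show "(\<lambda>f. conv f g c) \<in> linear_map K H A" if g: "g \<in> carrier H"
    unfolding conv_def using c
    by (simp add: sweedler_simps morphism_rules[OF H_carrierD[OF g]] H_module eval_linear)
  show "(\<lambda>g. conv f g c) \<in> linear_map K H A" if f: "f \<in> carrier H"
    unfolding conv_def using c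
    by (simp add: sweedler_simps morphism_rules[OF H_carrierD[OF f]] H_module eval_linear)
qed

text \<open>\<open>\<epsilon>(\<gamma>\<^sup>-\<^sup>1(c\<^sub>1) f(c\<^sub>2)\<^sub>1) = \<epsilon>(c\<^sub>1) \<epsilon>\<^sub>B(f(c\<^sub>2)\<^sub>1)\<close> turns the right unit law into the counit laws of \<open>\<rho>\<close> and
  \<open>\<Delta>\<close>; for the left one, \<open>\<rho>(1) = 1 \<otimes> 1\<close> and the counit law of \<open>\<Delta>\<close> suffice.\<close>
lemma conv_one:
  assumes "f \<in> carrier H" and c: "c \<in> carrier C"
  shows "conv f \<one>\<^bsub>H\<^esub> c = f c" and "conv \<one>\<^bsub>H\<^esub> f c = f c"
proof -
  have f: "f \<in> hom_morphism K C A" using assms(1) by (rule H_carrierD)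
  note rules = sweedler_simps morphism_rules[OF f]
  have mult_smult: "a \<otimes>\<^bsub>A\<^esub> (r \<odot>\<^bsub>A\<^esub> b) = r \<odot>\<^bsub>A\<^esub> (a \<otimes>\<^bsub>A\<^esub> b)"
    if "a \<in> carrier A" "b \<in> carrier A" "r \<in> carrier K" for a b r
    using that by (intro linear_map_smult[OF bilinear_map_right[OF CA.A.mult_bilinear]])
  have "conv f \<one>\<^bsub>H\<^esub> c = conv f (\<lambda>c. \<epsilon> c \<odot>\<^bsub>A\<^esub> \<one>\<^bsub>A\<^esub>) c"
    using c f by (intro conv_cong) (simp_all add: H_values)
  also have "\<dots> = tensor_lift K C C A (\<lambda>c1 c2. tensor_lift K A B A (\<lambda>f0 f1.
      \<epsilon>\<^sub>B f1 \<odot>\<^bsub>A\<^esub> (\<epsilon> c1 \<odot>\<^bsub>A\<^esub> aut A (aut A f0))) (\<rho> (f c2))) (\<Delta> c)"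
    unfolding conv_def using c
    by (intro tensor_lift_cong)
       (simp_all flip: CA.A.smult_assoc1 add: rules MC.counit_act mult_smult CA.B.R.m_comm)
  also have "\<dots> = tensor_lift K C C A (\<lambda>c1 c2. \<epsilon> c1 \<odot>\<^bsub>A\<^esub> f (aut C c2)) (\<Delta> c)"
    using c by (intro tensor_lift_cong trans[OF CA.comod.coact_counit_lift]) (simp_all add: rules)
  also have "\<dots> = f c"
    using c by (subst MC.C.counit_left_lift) (simp_all add: rules)
  finally show "conv f \<one>\<^bsub>H\<^esub> c = f c" .
  have unit: "tensor_lift K A B A (\<lambda>f0 f1. aut A f0 \<otimes>\<^bsub>A\<^esub> f (act (aut_inv C c1) f1)) (\<rho> (\<epsilon> c2 \<odot>\<^bsub>A\<^esub> \<one>\<^bsub>A\<^esub>)) =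
      \<epsilon> c2 \<odot>\<^bsub>A\<^esub> f (aut C c1)" if "c1 \<in> carrier C" "c2 \<in> carrier C" for c1 c2
  proof -
    have "(\<lambda>a. tensor_lift K A B A (\<lambda>f0 f1. aut A f0 \<otimes>\<^bsub>A\<^esub> f (act (aut_inv C c1) f1)) (\<rho> a)) \<in> linear_map K A A"
      using that by (simp add: rules)
    from linear_map_smult[OF this] that show ?thesis by (simp add: rules CA.coact_one)
  qed
  have "conv \<one>\<^bsub>H\<^esub> f c = tensor_lift K C C A (\<lambda>c1 c2. \<epsilon> c2 \<odot>\<^bsub>A\<^esub> f (aut C c1)) (\<Delta> c)"
    unfolding conv_def using c by (intro tensor_lift_cong) (simp_all add: H_values unit)
  also have "\<dots> = f c"
    using c by (subst MC.C.counit_right_lift) (simp_all add: rules)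
  finally show "conv \<one>\<^bsub>H\<^esub> f c = f c" .
qed

lemma H_associative_algebra: "associative_algebra K H"
proof (intro associative_algebra.intro associative_algebra_axioms.intro H_module)
  interpret H: module K H by (rule H_module)
  note cl = H_value_closed H_closed H_values
  show "ring H"
  proof (rule ringI)
    show "abelian_group H" ..
    show "monoid H"
    proof (rule monoidI)
      fix f g h assume fgh: "f \<in> carrier H" "g \<in> carrier H" "h \<in> carrier H"
      show "f \<otimes>\<^bsub>H\<^esub> g \<otimes>\<^bsub>H\<^esub> h = f \<otimes>\<^bsub>H\<^esub> (g \<otimes>\<^bsub>H\<^esub> h)"
      proof (rule H_eqI)
        fix c assume c: "c \<in> carrier C"
        have "conv (f \<otimes>\<^bsub>H\<^esub> g) h c = conv (conv f g) h c"
          using fgh c by (intro conv_cong conv_morphism) (simp_all add: H_carrierD H_values)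
        also have "\<dots> = conv f (conv g h) c"
          using fgh c by (intro conv_assoc) (simp_all add: H_carrierD)
        also have "\<dots> = conv f (g \<otimes>\<^bsub>H\<^esub> h) c"
          using fgh c by (intro conv_cong) (simp_all add: H_carrierD H_values)
        finally show "(f \<otimes>\<^bsub>H\<^esub> g \<otimes>\<^bsub>H\<^esub> h) c = (f \<otimes>\<^bsub>H\<^esub> (g \<otimes>\<^bsub>H\<^esub> h)) c"
          using c by (simp add: H_values)
      qed (use fgh in \<open>simp_all add: H_closed\<close>)
    qed (auto intro!: H_eqI simp: H_closed H_values conv_one)
  qed (auto intro!: H_eqI simp: H_closed H_values linear_map_add[OF conv_linear(1)] linear_map_add[OF conv_linear(2)])
qed (auto intro!: H_eqI simp: H_closed H_values linear_map_smult[OF conv_linear(1)] linear_map_smult[OF conv_linear(2)])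

end


section \<open>The tensor product of Hom-bimodules\<close>

context left_hom_module
begin

lemma act_closed [simp]: "m \<in> carrier M \<Longrightarrow> a \<in> carrier A \<Longrightarrow> act a m \<in> carrier M"
  using act_bilinear by (rule bilinear_map_closed)

declare one_act [simp] aut_act [simp]

lemma aut_inv_act [simp]:
  "m \<in> carrier M \<Longrightarrow> a \<in> carrier A \<Longrightarrow> aut_inv M (act a m) = act (aut_inv A a) (aut_inv M m)"
  by (rule M.aut_inv_unique) simp_all

lemma act_act: "\<lbrakk>m \<in> carrier M; a \<in> carrier A; b \<in> carrier A\<rbrakk> \<Longrightarrow>
    act a (act b m) = act (aut_inv A a \<otimes>\<^bsub>A\<^esub> b) (aut M m)"
  using act_assoc[of m "aut_inv A a" b] by simp

lemma act_linear [sweedler_simps]: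
  "g \<in> linear_map K X A \<Longrightarrow> m \<in> carrier M \<Longrightarrow> (\<lambda>x. act (g x) m) \<in> linear_map K X M"
  "h \<in> linear_map K X M \<Longrightarrow> a \<in> carrier A \<Longrightarrow> (\<lambda>x. act a (h x)) \<in> linear_map K X M"
  using linear_map_comp[OF bilinear_map_left[OF act_bilinear]]
    linear_map_comp[OF bilinear_map_right[OF act_bilinear]] by blast+

end

text \<open>Oriented so that right actions end up outermost, where the relation of the tensor product over
  \<open>A\<close> moves them to the other factor.\<close>
lemma (in hom_bimodule) lact_ract: "\<lbrakk>m \<in> carrier M; a \<in> carrier A; b \<in> carrier A\<rbrakk> \<Longrightarrow>
    lact M a (ract M m b) = ract M (lact M (aut_inv A a) m) (aut A b)"
  using bimodule_assoc[of m "aut_inv A a" b] by simp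

context balanced_tensor
begin

lemma pure_tensor_over_linear:
  "g \<in> linear_map K X M \<Longrightarrow> n \<in> carrier N \<Longrightarrow>
    (\<lambda>x. pure_tensor_over K A M N (g x) n) \<in> linear_map K X (tensor_over K A M N)"
  "h \<in> linear_map K X N \<Longrightarrow> m \<in> carrier M \<Longrightarrow>
    (\<lambda>x. pure_tensor_over K A M N m (h x)) \<in> linear_map K X (tensor_over K A M N)"
  using linear_map_comp[OF bilinear_map_left[OF pure_tensor_over_bilinear]]
    linear_map_comp[OF bilinear_map_right[OF pure_tensor_over_bilinear]] by blast+

lemmas pure_tensor_over_swap = balanced_map_swap[OF pure_tensor_over_balanced]

end

locale bimodule_tensor = M: hom_bimodule K A M + N: hom_bimodule K A N
  for K :: "'k ring" and A :: "('k, 'a) hom_object"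
    and M :: "('k, 'm, 'a) hom_bimodule" and N :: "('k, 'n, 'a) hom_bimodule"
begin

sublocale balanced_tensor K A M N
  by (intro balanced_tensor.intro hom_tensor.intro balanced_tensor_axioms.intro
      M.left.M.hom_object_axioms N.left.M.hom_object_axioms M.right.act_closed N.left.act_closed)

abbreviation "T \<equiv> tensor_over K A M N"
abbreviation "tens \<equiv> pure_tensor_over K A M N"

lemmas rules = sweedler_simps pure_tensor_over_closed pure_tensor_over_linear pure_tensor_over_swap
  M.lact_ract N.lact_ract tensor_over_is_module M.left.act_act N.left.act_act

text \<open>The automorphism, its inverse and both actions on the tensor product are well defined.\<close>
lemma actions_balanced:
  shows "(\<lambda>m n. tens (aut M m) (aut N n)) \<in> balanced_map K A M N T"
    and "(\<lambda>m n. tens (aut_inv M m) (aut_inv N n)) \<in> balanced_map K A M N T"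
    and "a \<in> carrier A \<Longrightarrow> (\<lambda>m n. tens (lact M (aut_inv A a) m) (aut N n)) \<in> balanced_map K A M N T"
    and "a \<in> carrier A \<Longrightarrow> (\<lambda>m n. tens (aut M m) (ract N n (aut_inv A a))) \<in> balanced_map K A M N T"
  by (rule balanced_mapI; simp add: rules)+

lemma
  shows aut_over_linear: "aut T \<in> linear_map K T T"
    and lact_over_linear: "a \<in> carrier A \<Longrightarrow> lact T a \<in> linear_map K T T"
    and ract_over_linear: "a \<in> carrier A \<Longrightarrow> (\<lambda>t. ract T t a) \<in> linear_map K T T"
  unfolding aut_tensor_over lact_tensor_over ract_tensor_over
  by (intro sweedler_over_linear tensor_over_is_module actions_balanced; assumption)+

lemma
  assumes "m \<in> carrier M" "n \<in> carrier N"
  shows aut_over_pure: "aut T (tens m n) = tens (aut M m) (aut N n)"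
    and lact_over_pure: "a \<in> carrier A \<Longrightarrow> lact T a (tens m n) = tens (lact M (aut_inv A a) m) (aut N n)"
    and ract_over_pure: "a \<in> carrier A \<Longrightarrow> ract T (tens m n) a = tens (aut M m) (ract N n (aut_inv A a))"
  unfolding aut_tensor_over lact_tensor_over ract_tensor_over
  by (intro sweedler_over_pure tensor_over_is_module actions_balanced assms; assumption)+

lemma aut_over_bij: "bij_betw (aut T) (carrier T) (carrier T)"
proof -
  let ?i = "sweedler_over K T (\<lambda>m n. tens (aut_inv M m) (aut_inv N n))"
  have i: "?i \<in> linear_map K T T"
    by (rule sweedler_over_linear[OF tensor_over_is_module actions_balanced(2)])
  note i_pure = sweedler_over_pure[OF tensor_over_is_module actions_balanced(2)]
  show ?thesis
  proof (rule bij_betw_byWitness[of _ ?i])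
    show "\<forall>t\<in>carrier T. ?i (aut T t) = t"
      by (rule ballI, rule tensor_over_linear_ext[OF tensor_over_is_module linear_map_comp[OF i aut_over_linear] linear_map_ident])
         (simp_all add: aut_over_pure i_pure)
    show "\<forall>t\<in>carrier T. aut T (?i t) = t"
      by (rule ballI, rule tensor_over_linear_ext[OF tensor_over_is_module linear_map_comp[OF aut_over_linear i] linear_map_ident])
         (simp_all add: aut_over_pure i_pure)
  qed (use linear_map_closed[OF i] linear_map_closed[OF aut_over_linear] in auto)
qed

lemma tensor_over_is_hom_object: "hom_object K T"
  by (intro hom_object.intro hom_object_axioms.intro tensor_over_is_module aut_over_linear aut_over_bij)

lemma aut_inv_over_pure:
  assumes "m \<in> carrier M" "n \<in> carrier N"
  shows "aut_inv T (tens m n) = tens (aut_inv M m) (aut_inv N n)"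
  by (rule hom_object.aut_inv_unique[OF tensor_over_is_hom_object])
     (simp_all add: aut_over_pure pure_tensor_over_closed assms)

end

section \<open>Comultiplications and counits on a Hom-bimodule\<close>

text \<open>A bimodule with bilinear comultiplication and counit. Bilinearity alone makes the maps in the
  coassociativity and counit laws balanced, so that these laws can be evaluated on pure tensors
  before they are known to hold.\<close>
locale hom_precoring = C: hom_bimodule K A \<C>
  for K :: "'k ring" and A :: "('k, 'a) hom_object" and \<C> :: "('k, 'c, 'a) hom_bimodule" +
  fixes \<Delta> :: "'c \<Rightarrow> ('k, 'c, 'c) tensor_over" and \<epsilon> :: "'c \<Rightarrow> 'a"
  assumes comul_morphism: "\<Delta> \<in> hom_bimodule_morphism K A \<C> (tensor_over K A \<C> \<C>)"
    and counit_morphism: "\<epsilon> \<in> hom_bimodule_morphism K A \<C> (regular_bimodule A)"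
begin

sublocale two: bimodule_tensor K A \<C> \<C>
  by (intro bimodule_tensor.intro C.hom_bimodule_axioms)

abbreviation "CC \<equiv> tensor_over K A \<C> \<C>"

sublocale CC: hom_object K CC by (rule two.tensor_over_is_hom_object)

sublocale three: balanced_tensor K A \<C> CC
  by (intro balanced_tensor.intro hom_tensor.intro balanced_tensor_axioms.intro
      C.left.M.hom_object_axioms CC.hom_object_axioms C.right.act_closed linear_map_closed[OF two.lact_over_linear])

abbreviation "CCC \<equiv> tensor_over K A \<C> CC"
abbreviation "tens3 \<equiv> pure_tensor_over K A \<C> CC"

lemma comul_linear: "\<Delta> \<in> linear_map K \<C> CC"
  using comul_morphism by (simp add: hom_bimodule_morphism_def hom_morphism_def)

lemma comul_closed [simp]: "x \<in> carrier \<C> \<Longrightarrow> \<Delta> x \<in> carrier CC"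
  by (rule linear_map_closed[OF comul_linear])

lemma
  assumes "x \<in> carrier \<C>"
  shows comul_aut: "aut CC (\<Delta> x) = \<Delta> (aut \<C> x)"
    and comul_lact: "a \<in> carrier A \<Longrightarrow> \<Delta> (lact \<C> a x) = lact CC a (\<Delta> x)"
    and comul_ract: "a \<in> carrier A \<Longrightarrow> \<Delta> (ract \<C> x a) = ract CC (\<Delta> x) a"
  using comul_morphism assms by (simp_all add: hom_bimodule_morphism_def hom_morphism_def)

lemma comul_aut_inv: "x \<in> carrier \<C> \<Longrightarrow> aut_inv CC (\<Delta> x) = \<Delta> (aut_inv \<C> x)"
  by (rule CC.aut_inv_unique) (simp_all add: comul_aut)

lemma counit_linear: "\<epsilon> \<in> linear_map K \<C> A"
proof -
  have "\<epsilon> \<in> linear_map K \<C> (regular_bimodule A)"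
    using counit_morphism by (simp add: hom_bimodule_morphism_def hom_morphism_def)
  also have "linear_map K \<C> (regular_bimodule A) = linear_map K \<C> A"
    by (rule linear_map_cong_modules) (simp_all add: regular_bimodule_def hom_object.defs hom_bimodule.defs)
  finally show ?thesis .
qed

lemma counit_closed [simp]: "x \<in> carrier \<C> \<Longrightarrow> \<epsilon> x \<in> carrier A"
  by (rule linear_map_closed[OF counit_linear])

lemma
  assumes "x \<in> carrier \<C>"
  shows counit_aut: "\<epsilon> (aut \<C> x) = aut A (\<epsilon> x)"
    and counit_lact: "a \<in> carrier A \<Longrightarrow> \<epsilon> (lact \<C> a x) = a \<otimes>\<^bsub>A\<^esub> \<epsilon> x"
    and counit_ract: "a \<in> carrier A \<Longrightarrow> \<epsilon> (ract \<C> x a) = \<epsilon> x \<otimes>\<^bsub>A\<^esub> a"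
  using counit_morphism assms
  by (simp_all add: hom_bimodule_morphism_def hom_morphism_def regular_bimodule_def hom_object.defs hom_bimodule.defs)

lemma counit_aut_inv: "x \<in> carrier \<C> \<Longrightarrow> \<epsilon> (aut_inv \<C> x) = aut_inv A (\<epsilon> x)"
  by (rule C.left.A.aut_inv_unique[symmetric]) (simp_all flip: counit_aut)

lemmas rules3 = two.rules three.pure_tensor_over_closed three.pure_tensor_over_linear three.pure_tensor_over_swap
  three.tensor_over_is_module comul_aut comul_lact comul_ract comul_aut_inv
  counit_aut counit_lact counit_ract counit_aut_inv linear_map_comp[OF comul_linear] linear_map_comp[OF counit_linear]

lemma coassoc_left_balanced: "(\<lambda>x1 x2. tens3 x1 (\<Delta> x2)) \<in> balanced_map K A \<C> \<C> CCC"
  by (rule balanced_mapI) (simp_all add: rules3)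

lemma coassoc_right_inner_balanced:
  assumes "x2 \<in> carrier \<C>"
  shows "(\<lambda>x11 x12. tens3 (aut \<C> x11) (pure_tensor_over K A \<C> \<C> x12 (aut_inv \<C> x2))) \<in> balanced_map K A \<C> \<C> CCC"
  by (rule balanced_mapI) (simp_all add: rules3 assms two.lact_over_pure two.aut_inv_over_pure)

abbreviation "coassoc_right x1 x2 \<equiv> sweedler_over K CCC (\<lambda>x11 x12.
    tens3 (aut \<C> x11) (pure_tensor_over K A \<C> \<C> x12 (aut_inv \<C> x2))) (\<Delta> x1)"

text \<open>For fixed \<open>x\<^sub>2\<close> the inner sum is a linear function of \<open>\<Delta>(x\<^sub>1)\<close>. As \<open>\<Delta>(x\<^sub>1 a) = \<Delta>(x\<^sub>1) a\<close> and \<open>\<Delta>\<close>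
  commutes with the automorphisms, the balancing condition can be checked for an arbitrary element
  of the tensor square in place of \<open>\<Delta>(x\<^sub>1)\<close>, and there on pure tensors.\<close>
lemma coassoc_right_balanced: "coassoc_right \<in> balanced_map K A \<C> \<C> CCC"
proof (rule balanced_mapI)
  note inner = two.sweedler_over_linear[OF three.tensor_over_is_module coassoc_right_inner_balanced]
  show "coassoc_right \<in> bilinear_map K \<C> \<C> CCC"
    by (rule bilinear_mapI, rule two.sweedler_over_linear_in_function[OF three.tensor_over_is_module],
        simp_all add: rules3 linear_map_comp[OF inner comul_linear])
  fix x a y assume mem: "x \<in> carrier \<C>" "a \<in> carrier A" "y \<in> carrier \<C>"
  let ?\<Phi> = "\<lambda>y. sweedler_over K CCC (\<lambda>x11 x12. tens3 (aut \<C> x11) (pure_tensor_over K A \<C> \<C> x12 (aut_inv \<C> y)))"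
  have y': "lact \<C> a (aut_inv \<C> y) \<in> carrier \<C>" using mem by simp
  have eval: "?\<Phi> y (two.tens m n) = tens3 (aut \<C> m) (two.tens n (aut_inv \<C> y))"
    if "m \<in> carrier \<C>" "n \<in> carrier \<C>" "y \<in> carrier \<C>" for m n y
    using that by (intro two.sweedler_over_pure[OF three.tensor_over_is_module coassoc_right_inner_balanced])
  have "?\<Phi> y (ract CC t a) = ?\<Phi> (lact \<C> a (aut_inv \<C> y)) (aut CC t)" if "t \<in> carrier CC" for t
  proof (rule two.tensor_over_linear_ext[OF three.tensor_over_is_module
        linear_map_comp[OF inner[OF mem(3)] two.ract_over_linear[OF mem(2)]]
        linear_map_comp[OF inner[OF y'] two.aut_over_linear] _ that])
    fix m n assume mn: "m \<in> carrier \<C>" "n \<in> carrier \<C>"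
    have "?\<Phi> y (ract CC (two.tens m n) a) =
        tens3 (aut \<C> (aut \<C> m)) (two.tens (ract \<C> n (aut_inv A a)) (aut_inv \<C> y))"
      using mn mem by (simp only: two.ract_over_pure) (rule eval, simp_all)
    also have "\<dots> = tens3 (aut \<C> (aut \<C> m)) (two.tens (aut \<C> n) (aut_inv \<C> (lact \<C> a (aut_inv \<C> y))))"
      using mn mem by (simp add: rules3)
    also have "\<dots> = ?\<Phi> (lact \<C> a (aut_inv \<C> y)) (aut CC (two.tens m n))"
      unfolding two.aut_over_pure[OF mn] using mn y' by (intro eval[symmetric]) simp_all
    finally show "?\<Phi> y (ract CC (two.tens m n) a) = ?\<Phi> (lact \<C> a (aut_inv \<C> y)) (aut CC (two.tens m n))" .
  qed
  from this[OF comul_closed[OF mem(1)]] show "coassoc_right (ract \<C> x a) y = coassoc_right (aut \<C> x) (lact \<C> a (aut_inv \<C> y))"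
    using mem by (simp add: comul_ract comul_aut)
qed

lemma counit_maps_balanced:
  "(\<lambda>x1 x2. lact \<C> (\<epsilon> x1) x2) \<in> balanced_map K A \<C> \<C> \<C>"
  "(\<lambda>x1 x2. ract \<C> x1 (\<epsilon> x2)) \<in> balanced_map K A \<C> \<C> \<C>"
  by (rule balanced_mapI; simp add: rules3 C.left.act_act C.right.act_act)+

end


section \<open>The coring\<close>

context hom_doi_koppinen
begin

text \<open>\<open>p a c\<close> stands for \<open>a \<otimes> c\<close> in \<open>\<C>\<close>, and \<open>q x y\<close>, introduced below, for \<open>x \<otimes>\<^sub>A y\<close> in the tensor
  square of \<open>\<C>\<close>.\<close>
abbreviation "\<C> \<equiv> induced_bimodule K A C \<rho> act"
abbreviation "p \<equiv> pure_tensor K A C"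

lemma C_simps:
  "carrier \<C> = carrier AC" "add \<C> = add AC" "zero \<C> = zero AC" "smult \<C> = smult AC" "aut \<C> = aut AC"
  "lact \<C> a t = tensor_lift K A C AC (\<lambda>a' c. p (aut_inv A a \<otimes>\<^bsub>A\<^esub> a') (aut C c)) t"
  "ract \<C> t a = tensor_lift K A C AC (\<lambda>a' c. tensor_lift K A B AC (\<lambda>a0 a1. p (a' \<otimes>\<^bsub>A\<^esub> a0) (act c a1)) (\<rho> a)) t"
  by (simp_all add: induced_bimodule_def Let_def hom_object.defs hom_bimodule.defs tensor_lift_def fun_eq_iff)

text \<open>\<open>\<C>\<close> and \<open>A \<otimes> C\<close> are different records with the same module structure; calculations take place in
  \<open>A \<otimes> C\<close>.\<close>
lemma C_linear_map: "linear_map K \<C> P = linear_map K AC P" "linear_map K P \<C> = linear_map K P AC"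
  by (rule linear_map_cong_modules; simp add: C_simps)+

sublocale AC: hom_tensor K A C
  by (intro hom_tensor.intro CA.A.hom_object_axioms MC.C.hom_object_axioms)

sublocale AC: hom_object K AC by (rule AC.tensor_is_hom_object)

lemma C_module: "module K \<C>"
  by (rule module_cong_modules[OF AC.T]) (simp_all add: C_simps)

lemma C_hom_object: "hom_object K \<C>"
  by (intro hom_object.intro hom_object_axioms.intro C_module)
     (simp_all add: C_linear_map C_simps AC.aut_tensor_linear AC.aut_tensor_bij)

lemmas C_rules = sweedler_simps lifts C_simps C_linear_map aut_tensor[of K A C]
  CA.A.mult_assoc MC.mod.act_act

text \<open>The two actions are unfolded with all their arguments present; an unapplied \<open>lact \<C>\<close> would not
  match their defining equations.\<close>
lemma C_actions_bilinear: "lact \<C> \<in> bilinear_map K A \<C> \<C>" "ract \<C> \<in> bilinear_map K \<C> A \<C>"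
proof -
  have "(\<lambda>a t. lact \<C> a t) \<in> bilinear_map K A \<C> \<C>" "(\<lambda>t a. ract \<C> t a) \<in> bilinear_map K \<C> A \<C>"
    unfolding C_simps by (simp_all add: C_rules)
  then show "lact \<C> \<in> bilinear_map K A \<C> \<C>" "ract \<C> \<in> bilinear_map K \<C> A \<C>" by simp_all
qed

lemma C_bimodule: "hom_bimodule K A \<C>"
  by (intro hom_bimodule.intro left_hom_module.intro right_hom_module.intro hom_bimodule_axioms.intro
    left_hom_module_axioms.intro right_hom_module_axioms.intro C_hom_object CA.A.hom_algebra_axioms C_actions_bilinear)
   (simp_all add: C_rules cong: tensor_lift_cong)

sublocale C: hom_bimodule K A \<C> by (rule C_bimodule)

sublocale two: bimodule_tensor K A \<C> \<C>
  by (intro bimodule_tensor.intro C_bimodule)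

abbreviation "CC \<equiv> tensor_over K A \<C> \<C>"
abbreviation "q \<equiv> pure_tensor_over K A \<C> \<C>"
abbreviation "\<Delta>\<^sub>\<C> \<equiv> induced_comul K A C \<Delta> \<rho> act"
abbreviation "\<epsilon>\<^sub>\<C> \<equiv> induced_counit K A \<epsilon>"

lemma p_closed: "a \<in> carrier A \<Longrightarrow> c \<in> carrier C \<Longrightarrow> p a c \<in> carrier \<C>"
  by (simp add: C_rules)

lemma C_pure:
  assumes "a \<in> carrier A" "c \<in> carrier C"
  shows "aut \<C> (p a c) = p (aut A a) (aut C c)"
    and "aut_inv \<C> (p a c) = p (aut_inv A a) (aut_inv C c)"
    and "b \<in> carrier A \<Longrightarrow> lact \<C> b (p a c) = p (aut_inv A b \<otimes>\<^bsub>A\<^esub> a) (aut C c)"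
    and "b \<in> carrier A \<Longrightarrow> ract \<C> (p a c) b = tensor_lift K A B AC (\<lambda>b0 b1. p (a \<otimes>\<^bsub>A\<^esub> b0) (act c b1)) (\<rho> b)"
proof -
  show "aut_inv \<C> (p a c) = p (aut_inv A a) (aut_inv C c)"
    unfolding C_simps using assms by (rule AC.aut_inv_tensor_pure)
qed (use assms in \<open>simp_all add: C_rules\<close>)

lemma q_linear:
  "g \<in> linear_map K X AC \<Longrightarrow> y \<in> carrier AC \<Longrightarrow> (\<lambda>x. q (g x) y) \<in> linear_map K X CC"
  "h \<in> linear_map K X AC \<Longrightarrow> y \<in> carrier AC \<Longrightarrow> (\<lambda>x. q y (h x)) \<in> linear_map K X CC"
  using two.pure_tensor_over_linear by (simp_all add: C_linear_map C_simps)

lemma q_closed: "x \<in> carrier AC \<Longrightarrow> y \<in> carrier AC \<Longrightarrow> q x y \<in> carrier CC"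
  using two.pure_tensor_over_closed by (simp add: C_simps)

lemmas q_rules = sweedler_simps lifts q_linear q_closed two.tensor_over_is_module MC.mod.act_act CA.A.mult_assoc

lemma comul_pure:
  assumes "a \<in> carrier A" "c \<in> carrier C"
  shows "\<Delta>\<^sub>\<C> (p a c) = tensor_lift K C C CC (\<lambda>c1 c2. q (p (aut_inv A a) c1) (p \<one>\<^bsub>A\<^esub> c2)) (\<Delta> c)"
  unfolding induced_comul_def Let_def tensor_lift_def[of K A C, symmetric] tensor_lift_def[of K C C, symmetric]
  using assms by (simp add: q_rules)

lemma comul_linear: "\<Delta>\<^sub>\<C> \<in> linear_map K AC CC"
  unfolding induced_comul_def[abs_def] Let_def tensor_lift_def[of K A C, symmetric] tensor_lift_def[of K C C, symmetric]
  by (simp add: q_rules)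

lemma counit_pure:
  assumes "a \<in> carrier A" "c \<in> carrier C"
  shows "\<epsilon>\<^sub>\<C> (p a c) = \<epsilon> c \<odot>\<^bsub>A\<^esub> aut A a"
  unfolding induced_counit_def tensor_lift_def[of K A C, symmetric]
  using assms by (simp add: q_rules)

lemma counit_linear: "\<epsilon>\<^sub>\<C> \<in> linear_map K AC A"
  unfolding induced_counit_def tensor_lift_def[of K A C, symmetric]
  by (simp add: q_rules)

lemma C_ext:
  assumes "module K P" "f \<in> linear_map K AC P" "g \<in> linear_map K AC P"
    and "\<And>a c. a \<in> carrier A \<Longrightarrow> c \<in> carrier C \<Longrightarrow> f (p a c) = g (p a c)" "x \<in> carrier \<C>"
  shows "f x = g x"
  using tensor_linear_ext[OF AC.MN assms(1-3)] assms(4,5) by (simp add: C_simps)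

lemma regular_bimodule_simps:
  "linear_map K M (regular_bimodule A) = linear_map K M A" "aut (regular_bimodule A) = aut A"
  "lact (regular_bimodule A) = mult A" "ract (regular_bimodule A) = mult A"
  by (rule linear_map_cong_modules) (simp_all add: regular_bimodule_def hom_object.defs hom_bimodule.defs)

lemma counit_morphism: "\<epsilon>\<^sub>\<C> \<in> hom_bimodule_morphism K A \<C> (regular_bimodule A)"
proof -
  note lin = counit_linear linear_map_comp[OF counit_linear]
  note actions = C.left.M.aut_linear bilinear_map_right[OF C_actions_bilinear(1)] bilinear_map_left[OF C_actions_bilinear(2)]
  have "aut A (\<epsilon>\<^sub>\<C> x) = \<epsilon>\<^sub>\<C> (aut \<C> x)" if "x \<in> carrier \<C>" for x
    by (rule C_ext[OF CA.A.is_module _ _ _ that])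
       (use actions in \<open>simp_all add: q_rules lin C_linear_map C_pure counit_pure linear_map_smult[OF CA.A.aut_linear]\<close>)
  moreover have "\<epsilon>\<^sub>\<C> (lact \<C> a x) = a \<otimes>\<^bsub>A\<^esub> \<epsilon>\<^sub>\<C> x" if "x \<in> carrier \<C>" "a \<in> carrier A" for x a
    by (rule C_ext[OF CA.A.is_module _ _ _ that(1)])
       (use actions that(2) in \<open>simp_all add: q_rules lin C_linear_map C_pure counit_pure
         linear_map_smult[OF bilinear_map_right[OF CA.A.mult_bilinear]]\<close>)
  moreover have "\<epsilon>\<^sub>\<C> (ract \<C> x a) = \<epsilon>\<^sub>\<C> x \<otimes>\<^bsub>A\<^esub> a" if "x \<in> carrier \<C>" and a: "a \<in> carrier A" for x a
  proof (rule C_ext[OF CA.A.is_module _ _ _ that(1)])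
    fix a' c assume a': "a' \<in> carrier A" and c: "c \<in> carrier C"
    have "\<epsilon>\<^sub>\<C> (ract \<C> (p a' c) a) = tensor_lift K A B A (\<lambda>a0 a1. \<epsilon>\<^sub>\<C> (p (a' \<otimes>\<^bsub>A\<^esub> a0) (act c a1))) (\<rho> a)"
      unfolding C_pure(4)[OF a' c a] using a a' c
      by (intro linear_tensor_lift[OF CA.A.is_module CA.B.is_module AC.T CA.A.is_module counit_linear])
         (simp_all add: q_rules)
    also have "\<dots> = tensor_lift K A B A (\<lambda>a0 a1. \<epsilon>\<^sub>B a1 \<odot>\<^bsub>A\<^esub> (\<epsilon> c \<odot>\<^bsub>A\<^esub> (aut A a' \<otimes>\<^bsub>A\<^esub> aut A a0))) (\<rho> a)"
      using a a' c
      by (intro tensor_lift_cong)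
         (simp_all flip: CA.A.smult_assoc1 add: counit_pure MC.counit_act CA.B.R.m_comm)
    also have "\<dots> = \<epsilon> c \<odot>\<^bsub>A\<^esub> (aut A a' \<otimes>\<^bsub>A\<^esub> a)"
      using a a' c by (subst CA.comod.coact_counit_lift) (simp_all add: q_rules)
    also have "\<dots> = \<epsilon>\<^sub>\<C> (p a' c) \<otimes>\<^bsub>A\<^esub> a"
      using a a' c linear_map_smult[OF bilinear_map_left[OF CA.A.mult_bilinear a]] by (simp add: counit_pure)
    finally show "\<epsilon>\<^sub>\<C> (ract \<C> (p a' c) a) = \<epsilon>\<^sub>\<C> (p a' c) \<otimes>\<^bsub>A\<^esub> a" .
  qed (use actions a in \<open>simp_all add: q_rules lin C_linear_map\<close>)
  ultimately show ?thesis
    by (simp add: hom_bimodule_morphism_def hom_morphism_def counit_linear C_linear_map regular_bimodule_simps)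
qed

text \<open>Right linearity is the substantial part. In \<open>\<Delta>((a' \<otimes> c) a)\<close> the module coalgebra axiom produces
  \<open>a\<^sub>0, a\<^sub>1\<^sub>1, a\<^sub>1\<^sub>2\<close>, which coassociativity of \<open>\<rho>\<close> turns into \<open>a\<^sub>0\<^sub>0, a\<^sub>0\<^sub>1, a\<^sub>1\<close>. The first two are then
  the right action of \<open>a\<^sub>0\<close> on the left factor, and the relation over \<open>A\<close> moves \<open>a\<^sub>0\<close> to the right
  factor, where it meets \<open>a\<^sub>1\<close> and forms the right action of \<open>a\<close>.\<close>
lemma comul_morphism: "\<Delta>\<^sub>\<C> \<in> hom_bimodule_morphism K A \<C> CC"
proof -
  note lin = comul_linear linear_map_comp[OF comul_linear] 
  note linT = two.aut_over_linear two.lact_over_linear two.ract_over_linear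
   linear_map_comp[OF two.aut_over_linear] linear_map_comp[OF two.lact_over_linear] linear_map_comp[OF two.ract_over_linear]
  note push = linear_tensor_lift[OF MC.C.is_module MC.C.is_module two.tensor_over_is_module two.tensor_over_is_module two.aut_over_linear]
    linear_tensor_lift[OF MC.C.is_module MC.C.is_module two.tensor_over_is_module two.tensor_over_is_module two.lact_over_linear]
    linear_tensor_lift[OF MC.C.is_module MC.C.is_module two.tensor_over_is_module two.tensor_over_is_module two.ract_over_linear]
  note actions = C.left.M.aut_linear bilinear_map_right[OF C_actions_bilinear(1)] bilinear_map_left[OF C_actions_bilinear(2)]
  have "aut CC (\<Delta>\<^sub>\<C> x) = \<Delta>\<^sub>\<C> (aut \<C> x)" if "x \<in> carrier \<C>" for x
    by (rule C_ext[OF two.tensor_over_is_module _ _ _ that])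
       (use actions in \<open>simp_all add: q_rules lin linT C_linear_map C_pure comul_pure push two.aut_over_pure p_closed cong: tensor_lift_cong\<close>)
  moreover have "\<Delta>\<^sub>\<C> (lact \<C> a x) = lact CC a (\<Delta>\<^sub>\<C> x)" if "x \<in> carrier \<C>" "a \<in> carrier A" for x a
    by (rule C_ext[OF two.tensor_over_is_module _ _ _ that(1)])
       (use actions that(2) in \<open>simp_all add: q_rules lin linT C_linear_map C_pure comul_pure push two.lact_over_pure p_closed cong: tensor_lift_cong\<close>)
  moreover have "\<Delta>\<^sub>\<C> (ract \<C> x a) = ract CC (\<Delta>\<^sub>\<C> x) a" if "x \<in> carrier \<C>" and a: "a \<in> carrier A" for x a
  proof (rule C_ext[OF two.tensor_over_is_module _ _ _ that(1)])
    fix a' c assume a': "a' \<in> carrier A" and c: "c \<in> carrier C"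
    let ?\<Phi> = "\<lambda>c1 c2 x y z. q (p (aut_inv A a' \<otimes>\<^bsub>A\<^esub> x) (act c1 y)) (p \<one>\<^bsub>A\<^esub> (act c2 z))"
    have balance: "q (p a' (aut C c1)) (p x d) =
        tensor_lift K A B CC (\<lambda>x0 x1. q (p (aut_inv A a' \<otimes>\<^bsub>A\<^esub> x0) (act c1 x1)) (p \<one>\<^bsub>A\<^esub> d)) (\<rho> x)"
      if "c1 \<in> carrier C" "d \<in> carrier C" "x \<in> carrier A" for c1 d x
    proof -
      have "q (p a' (aut C c1)) (p x d) = q (aut \<C> (p (aut_inv A a') c1)) (lact \<C> x (aut_inv \<C> (p \<one>\<^bsub>A\<^esub> d)))"
        using that a' by (simp add: C_pure)
      also have "\<dots> = q (ract \<C> (p (aut_inv A a') c1) x) (p \<one>\<^bsub>A\<^esub> d)"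
        using that a' by (intro two.pure_tensor_over_swap[symmetric] p_closed) simp_all
      also have "\<dots> = tensor_lift K A B CC (\<lambda>x0 x1. q (p (aut_inv A a' \<otimes>\<^bsub>A\<^esub> x0) (act c1 x1)) (p \<one>\<^bsub>A\<^esub> d)) (\<rho> x)"
        using that a' by (simp only: C_pure CA.A.aut_inv_closed) 
          (rule linear_tensor_lift[OF CA.A.is_module CA.B.is_module AC.T two.tensor_over_is_module], simp_all add: q_rules)
      finally show ?thesis .
    qed
    have "\<Delta>\<^sub>\<C> (ract \<C> (p a' c) a) = tensor_lift K A B CC (\<lambda>a0 a1. \<Delta>\<^sub>\<C> (p (a' \<otimes>\<^bsub>A\<^esub> a0) (act c a1))) (\<rho> a)"
      unfolding C_pure(4)[OF a' c a] using a a' c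
      by (intro linear_tensor_lift[OF CA.A.is_module CA.B.is_module AC.T two.tensor_over_is_module comul_linear])
         (simp_all add: q_rules)
    also have "\<dots> = tensor_lift K A B CC (\<lambda>a0 a1. tensor_lift K C C CC (\<lambda>c1 c2.
        tensor_lift K B B CC (?\<Phi> c1 c2 (aut_inv A a0)) (\<Delta>\<^sub>B a1)) (\<Delta> c)) (\<rho> a)"
      using a a' c by (simp add: q_rules comul_pure cong: tensor_lift_cong)
    also have "\<dots> = tensor_lift K C C CC (\<lambda>c1 c2. tensor_lift K A B CC (\<lambda>a0 a1.
        tensor_lift K B B CC (?\<Phi> c1 c2 (aut_inv A a0)) (\<Delta>\<^sub>B a1)) (\<rho> a)) (\<Delta> c)"
      using a a' c by (intro tensor_lift_swap) (simp_all add: q_rules)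
    also have "\<dots> = tensor_lift K C C CC (\<lambda>c1 c2. tensor_lift K A B CC (\<lambda>a0 a1.
        tensor_lift K A B CC (\<lambda>a00 a01. ?\<Phi> c1 c2 a00 a01 (aut_inv B a1)) (\<rho> a0)) (\<rho> a)) (\<Delta> c)"
      using a a' c by (intro tensor_lift_cong CA.comod.coact_coassoc_lift) (simp_all add: q_rules)
    also have "\<dots> = tensor_lift K C C CC (\<lambda>c1 c2. tensor_lift K A B CC (\<lambda>a0 a1.
        q (p a' (aut C c1)) (p a0 (act c2 (aut_inv B a1)))) (\<rho> a)) (\<Delta> c)"
      using a a' c by (intro tensor_lift_cong balance[symmetric]) simp_all
    also have "\<dots> = tensor_lift K C C CC (\<lambda>c1 c2. q (p a' (aut C c1)) (ract \<C> (p \<one>\<^bsub>A\<^esub> c2) (aut_inv A a))) (\<Delta> c)"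
    proof (intro tensor_lift_cong)
      fix c1 c2 assume c12: "c1 \<in> carrier C" "c2 \<in> carrier C"
      have "ract \<C> (p \<one>\<^bsub>A\<^esub> c2) (aut_inv A a) = tensor_lift K A B AC (\<lambda>a0 a1. p a0 (act c2 (aut_inv B a1))) (\<rho> a)"
        using a c12 by (simp add: C_pure q_rules cong: tensor_lift_cong)
      then show "tensor_lift K A B CC (\<lambda>a0 a1. q (p a' (aut C c1)) (p a0 (act c2 (aut_inv B a1)))) (\<rho> a) =
          q (p a' (aut C c1)) (ract \<C> (p \<one>\<^bsub>A\<^esub> c2) (aut_inv A a))"
        using a a' c12
        by (simp only:) (rule linear_tensor_lift[OF CA.A.is_module CA.B.is_module AC.T two.tensor_over_is_module, symmetric],
            simp_all add: q_rules)
    qed (use c in simp_all)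
    also have "\<dots> = ract CC (\<Delta>\<^sub>\<C> (p a' c)) a"
      using a a' c by (simp add: q_rules comul_pure push two.ract_over_pure p_closed C_pure(1) cong: tensor_lift_cong)
    finally show "\<Delta>\<^sub>\<C> (ract \<C> (p a' c) a) = ract CC (\<Delta>\<^sub>\<C> (p a' c)) a" .
  qed (use actions a in \<open>simp_all add: q_rules lin linT C_linear_map\<close>)
  ultimately show ?thesis
    by (simp add: hom_bimodule_morphism_def hom_morphism_def comul_linear C_linear_map)
qed

end


context hom_doi_koppinen
begin

sublocale pre: hom_precoring K A \<C> "\<Delta>\<^sub>\<C>" "\<epsilon>\<^sub>\<C>"
  by (intro hom_precoring.intro hom_precoring_axioms.intro C_bimodule comul_morphism counit_morphism)

abbreviation "CCC \<equiv> tensor_over K A \<C> CC"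
abbreviation "q3 \<equiv> pure_tensor_over K A \<C> CC"

lemma q3_linear:
  "g \<in> linear_map K X AC \<Longrightarrow> t \<in> carrier CC \<Longrightarrow> (\<lambda>x. q3 (g x) t) \<in> linear_map K X CCC"
  "h \<in> linear_map K X CC \<Longrightarrow> y \<in> carrier AC \<Longrightarrow> (\<lambda>x. q3 y (h x)) \<in> linear_map K X CCC"
  using pre.three.pure_tensor_over_linear by (simp_all add: C_linear_map C_simps)

lemma q3_closed: "x \<in> carrier AC \<Longrightarrow> y \<in> carrier CC \<Longrightarrow> q3 x y \<in> carrier CCC"
  using pre.three.pure_tensor_over_closed by (simp add: C_simps)

lemmas q3_rules = q_rules q3_linear q3_closed pre.three.tensor_over_is_module

lemma sweedler_over_comul_pure:
  assumes P: "module K P" and \<phi>: "\<phi> \<in> balanced_map K A \<C> \<C> P" and ac: "a \<in> carrier A" "c \<in> carrier C"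
  shows "sweedler_over K P \<phi> (\<Delta>\<^sub>\<C> (p a c)) =
    tensor_lift K C C P (\<lambda>c1 c2. \<phi> (p (aut_inv A a) c1) (p \<one>\<^bsub>A\<^esub> c2)) (\<Delta> c)"
proof -
  have "sweedler_over K P \<phi> (\<Delta>\<^sub>\<C> (p a c)) =
      tensor_lift K C C P (\<lambda>c1 c2. sweedler_over K P \<phi> (q (p (aut_inv A a) c1) (p \<one>\<^bsub>A\<^esub> c2))) (\<Delta> c)"
    unfolding comul_pure[OF ac] using ac
    by (intro linear_tensor_lift[OF MC.C.is_module MC.C.is_module two.tensor_over_is_module P
          two.sweedler_over_linear[OF P \<phi>]]) (simp_all add: q_rules)
  also have "\<dots> = tensor_lift K C C P (\<lambda>c1 c2. \<phi> (p (aut_inv A a) c1) (p \<one>\<^bsub>A\<^esub> c2)) (\<Delta> c)"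
    using ac by (intro tensor_lift_cong two.sweedler_over_pure[OF P \<phi>] p_closed) simp_all
  finally show ?thesis .
qed

lemma sweedler_over_comul_linear:
  assumes "module K P" "\<phi> \<in> balanced_map K A \<C> \<C> P"
  shows "(\<lambda>x. sweedler_over K P \<phi> (\<Delta>\<^sub>\<C> x)) \<in> linear_map K AC P"
  by (rule linear_map_comp[OF two.sweedler_over_linear[OF assms] comul_linear])

text \<open>On \<open>a \<otimes> c\<close> the algebra component stays in the leftmost factor and units fill the others, so the
  claim is coassociativity of \<open>\<Delta>\<close> on \<open>C\<close>, tested against \<open>?\<Phi>\<close>.\<close>
lemma coring_coassoc:
  assumes "x \<in> carrier \<C>"
  shows "sweedler_over K CCC (\<lambda>x1 x2. q3 x1 (\<Delta>\<^sub>\<C> x2)) (\<Delta>\<^sub>\<C> x) =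
    sweedler_over K CCC pre.coassoc_right (\<Delta>\<^sub>\<C> x)"
proof (rule C_ext[OF pre.three.tensor_over_is_module _ _ _ assms])
  note mod = pre.three.tensor_over_is_module
  show "(\<lambda>x. sweedler_over K CCC (\<lambda>x1 x2. q3 x1 (\<Delta>\<^sub>\<C> x2)) (\<Delta>\<^sub>\<C> x)) \<in> linear_map K AC CCC"
    "(\<lambda>x. sweedler_over K CCC pre.coassoc_right (\<Delta>\<^sub>\<C> x)) \<in> linear_map K AC CCC"
    by (rule sweedler_over_comul_linear[OF mod pre.coassoc_left_balanced]
        sweedler_over_comul_linear[OF mod pre.coassoc_right_balanced])+
  fix a c assume a: "a \<in> carrier A" and c: "c \<in> carrier C"
  let ?\<Phi> = "\<lambda>u v w. q3 (p (aut_inv A a) (aut C u)) (q (p \<one>\<^bsub>A\<^esub> v) (p \<one>\<^bsub>A\<^esub> w))"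
  have "sweedler_over K CCC (\<lambda>x1 x2. q3 x1 (\<Delta>\<^sub>\<C> x2)) (\<Delta>\<^sub>\<C> (p a c)) =
      tensor_lift K C C CCC (\<lambda>c1 c2. q3 (p (aut_inv A a) c1) (\<Delta>\<^sub>\<C> (p \<one>\<^bsub>A\<^esub> c2))) (\<Delta> c)"
    by (rule sweedler_over_comul_pure[OF mod pre.coassoc_left_balanced a c])
  also have "\<dots> = tensor_lift K C C CCC (\<lambda>c1 c2. tensor_lift K C C CCC (?\<Phi> (aut_inv C c1)) (\<Delta> c2)) (\<Delta> c)"
  proof (intro tensor_lift_cong)
    fix c1 c2 assume c12: "c1 \<in> carrier C" "c2 \<in> carrier C"
    have "q3 (p (aut_inv A a) c1) (\<Delta>\<^sub>\<C> (p \<one>\<^bsub>A\<^esub> c2)) =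
        tensor_lift K C C CCC (\<lambda>c21 c22. q3 (p (aut_inv A a) c1) (q (p \<one>\<^bsub>A\<^esub> c21) (p \<one>\<^bsub>A\<^esub> c22))) (\<Delta> c2)"
      using a c12 unfolding comul_pure[OF CA.A.one_closed c12(2)] CA.A.aut_inv_one
      by (intro linear_tensor_lift[OF MC.C.is_module MC.C.is_module two.tensor_over_is_module mod])
         (simp_all add: q3_rules)
    then show "q3 (p (aut_inv A a) c1) (\<Delta>\<^sub>\<C> (p \<one>\<^bsub>A\<^esub> c2)) =
        tensor_lift K C C CCC (?\<Phi> (aut_inv C c1)) (\<Delta> c2)"
      using c12 by simp
  qed (use c in simp_all)
  also have "\<dots> = tensor_lift K C C CCC (\<lambda>c1 c2. tensor_lift K C C CCC (\<lambda>c11 c12. ?\<Phi> c11 c12 (aut_inv C c2)) (\<Delta> c1)) (\<Delta> c)"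
    using a c by (intro MC.C.comul_coassoc_lift mod) (simp_all add: q3_rules)
  also have "\<dots> = tensor_lift K C C CCC (\<lambda>c1 c2. pre.coassoc_right (p (aut_inv A a) c1) (p \<one>\<^bsub>A\<^esub> c2)) (\<Delta> c)"
  proof (intro tensor_lift_cong)
    fix c1 c2 assume c12: "c1 \<in> carrier C" "c2 \<in> carrier C"
    have "pre.coassoc_right (p (aut_inv A a) c1) (p \<one>\<^bsub>A\<^esub> c2) =
        tensor_lift K C C CCC (\<lambda>c11 c12. q3 (aut \<C> (p (aut_inv A (aut_inv A a)) c11))
          (q (p \<one>\<^bsub>A\<^esub> c12) (aut_inv \<C> (p \<one>\<^bsub>A\<^esub> c2)))) (\<Delta> c1)"
      using a c12 by (intro sweedler_over_comul_pure[OF mod pre.coassoc_right_inner_balanced] p_closed) simp_all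
    also have "\<dots> = tensor_lift K C C CCC (\<lambda>c11 c12. ?\<Phi> c11 c12 (aut_inv C c2)) (\<Delta> c1)"
      using a c12 by (intro tensor_lift_cong) (simp_all add: C_pure)
    finally show "tensor_lift K C C CCC (\<lambda>c11 c12. ?\<Phi> c11 c12 (aut_inv C c2)) (\<Delta> c1) =
        pre.coassoc_right (p (aut_inv A a) c1) (p \<one>\<^bsub>A\<^esub> c2)" by simp
  qed (use c in simp_all)
  also have "\<dots> = sweedler_over K CCC pre.coassoc_right (\<Delta>\<^sub>\<C> (p a c))"
    by (rule sweedler_over_comul_pure[OF mod pre.coassoc_right_balanced a c, symmetric])
  finally show "sweedler_over K CCC (\<lambda>x1 x2. q3 x1 (\<Delta>\<^sub>\<C> x2)) (\<Delta>\<^sub>\<C> (p a c)) =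
    sweedler_over K CCC pre.coassoc_right (\<Delta>\<^sub>\<C> (p a c))" .
qed

lemma sweedler_over_C: "sweedler_over K \<C> \<phi> t = sweedler_over K AC \<phi> t"
  unfolding sweedler_over_def by (simp add: sweedler_cong_module[of \<C> AC] C_simps)

lemma balanced_map_C: "balanced_map K A \<C> \<C> \<C> = balanced_map K A \<C> \<C> AC"
  by (simp add: balanced_map_def bilinear_map_def C_linear_map)

text \<open>The counit laws of \<open>C\<close>, as \<open>\<epsilon>\<^sub>\<C>(\<alpha>\<^sup>-\<^sup>1(a) \<otimes> c\<^sub>1) (1 \<otimes> c\<^sub>2) = \<epsilon>(c\<^sub>1) (a \<otimes> \<gamma>(c\<^sub>2))\<close> and similarly on the
  right.\<close>
lemma coring_counit:
  assumes "x \<in> carrier \<C>"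
  shows "sweedler_over K \<C> (\<lambda>x1 x2. lact \<C> (\<epsilon>\<^sub>\<C> x1) x2) (\<Delta>\<^sub>\<C> x) = x"
    and "sweedler_over K \<C> (\<lambda>x1 x2. ract \<C> x1 (\<epsilon>\<^sub>\<C> x2)) (\<Delta>\<^sub>\<C> x) = x"
proof -
  note mod = AC.T
  note bal = pre.counit_maps_balanced[unfolded balanced_map_C]
  note p_smult = linear_map_smult[OF bilinear_map_left[OF pure_tensor_bilinear[OF AC.MN]]]
  have l: "lact \<C> (\<epsilon>\<^sub>\<C> (p (aut_inv A a) c1)) (p \<one>\<^bsub>A\<^esub> c2) = \<epsilon> c1 \<odot>\<^bsub>AC\<^esub> p a (aut C c2)"
    if "a \<in> carrier A" "c1 \<in> carrier C" "c2 \<in> carrier C" for a c1 c2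
  proof -
    have "lact \<C> (\<epsilon> c1 \<odot>\<^bsub>A\<^esub> a) (p \<one>\<^bsub>A\<^esub> c2) = \<epsilon> c1 \<odot>\<^bsub>\<C>\<^esub> lact \<C> a (p \<one>\<^bsub>A\<^esub> c2)"
      using that by (intro linear_map_smult[OF bilinear_map_left[OF C_actions_bilinear(1)]] p_closed) simp_all
    then show ?thesis using that by (simp add: counit_pure C_pure C_simps(4))
  qed
  have r: "ract \<C> (p (aut_inv A a) c1) (\<epsilon>\<^sub>\<C> (p \<one>\<^bsub>A\<^esub> c2)) = \<epsilon> c2 \<odot>\<^bsub>AC\<^esub> p a (aut C c1)"
    if "a \<in> carrier A" "c1 \<in> carrier C" "c2 \<in> carrier C" for a c1 c2
  proof -
    have "ract \<C> (p (aut_inv A a) c1) (\<epsilon> c2 \<odot>\<^bsub>A\<^esub> \<one>\<^bsub>A\<^esub>) = \<epsilon> c2 \<odot>\<^bsub>\<C>\<^esub> ract \<C> (p (aut_inv A a) c1) \<one>\<^bsub>A\<^esub>"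
      using that by (intro linear_map_smult[OF bilinear_map_right[OF C_actions_bilinear(2)]] p_closed) simp_all
    then show ?thesis
      using that C.right.act_one[OF p_closed[of "aut_inv A a" c1]] by (simp add: counit_pure C_pure C_simps(4))
  qed
  show "sweedler_over K \<C> (\<lambda>x1 x2. lact \<C> (\<epsilon>\<^sub>\<C> x1) x2) (\<Delta>\<^sub>\<C> x) = x"
    unfolding sweedler_over_C
  proof (rule C_ext[OF mod sweedler_over_comul_linear[OF mod bal(1)] linear_map_ident _ assms])
    fix a c assume ac: "a \<in> carrier A" "c \<in> carrier C"
    have "sweedler_over K AC (\<lambda>x1 x2. lact \<C> (\<epsilon>\<^sub>\<C> x1) x2) (\<Delta>\<^sub>\<C> (p a c)) =
        tensor_lift K C C AC (\<lambda>c1 c2. \<epsilon> c1 \<odot>\<^bsub>AC\<^esub> p a (aut C c2)) (\<Delta> c)"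
      unfolding sweedler_over_comul_pure[OF mod bal(1) ac] using ac by (intro tensor_lift_cong l) simp_all
    also have "\<dots> = p a c"
      using ac by (subst MC.C.counit_left_lift[OF mod]) (simp_all add: q_rules)
    finally show "sweedler_over K AC (\<lambda>x1 x2. lact \<C> (\<epsilon>\<^sub>\<C> x1) x2) (\<Delta>\<^sub>\<C> (p a c)) = p a c" .
  qed
  show "sweedler_over K \<C> (\<lambda>x1 x2. ract \<C> x1 (\<epsilon>\<^sub>\<C> x2)) (\<Delta>\<^sub>\<C> x) = x"
    unfolding sweedler_over_C
  proof (rule C_ext[OF mod sweedler_over_comul_linear[OF mod bal(2)] linear_map_ident _ assms])
    fix a c assume ac: "a \<in> carrier A" "c \<in> carrier C"
    have "sweedler_over K AC (\<lambda>x1 x2. ract \<C> x1 (\<epsilon>\<^sub>\<C> x2)) (\<Delta>\<^sub>\<C> (p a c)) =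
        tensor_lift K C C AC (\<lambda>c1 c2. \<epsilon> c2 \<odot>\<^bsub>AC\<^esub> p a (aut C c1)) (\<Delta> c)"
      unfolding sweedler_over_comul_pure[OF mod bal(2) ac] using ac by (intro tensor_lift_cong r) simp_all
    also have "\<dots> = p a c"
      using ac by (subst MC.C.counit_right_lift[OF mod]) (simp_all add: q_rules)
    finally show "sweedler_over K AC (\<lambda>x1 x2. ract \<C> x1 (\<epsilon>\<^sub>\<C> x2)) (\<Delta>\<^sub>\<C> (p a c)) = p a c" .
  qed
qed

lemma hom_coring: "hom_coring K A \<C> \<Delta>\<^sub>\<C> \<epsilon>\<^sub>\<C>"
proof (intro hom_coring.intro hom_coring_axioms.intro CA.A.hom_algebra_axioms C_bimodule comul_morphism
    counit_morphism coring_counit)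
  fix x assume x: "x \<in> carrier \<C>"
  show "let CC = tensor_over K A \<C> \<C>; T = tensor_over K A \<C> CC in
        sweedler_over K T (\<lambda>x1 x2. pure_tensor_over K A \<C> CC x1 (\<Delta>\<^sub>\<C> x2)) (\<Delta>\<^sub>\<C> x) =
        sweedler_over K T (\<lambda>x1 x2. sweedler_over K T (\<lambda>x11 x12.
          pure_tensor_over K A \<C> CC (aut \<C> x11)
            (pure_tensor_over K A \<C> \<C> x12 (aut_inv \<C> x2))) (\<Delta>\<^sub>\<C> x1)) (\<Delta>\<^sub>\<C> x)"
    unfolding Let_def by (rule coring_coassoc[OF x])
  show "\<Delta>\<^sub>\<C> (aut \<C> x) = sweedler_over K CC (\<lambda>x1 x2. q (aut \<C> x1) (aut \<C> x2)) (\<Delta>\<^sub>\<C> x)"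
    using pre.comul_aut[OF x] by (simp add: aut_tensor_over)
  show "\<epsilon>\<^sub>\<C> (aut \<C> x) = aut A (\<epsilon>\<^sub>\<C> x)" by (rule pre.counit_aut[OF x])
qed

end

theorem proposition4p3:
  fixes K :: "'k ring"
    and B :: "('k, 'b) hom_object"
    and \<Delta>\<^sub>B :: "'b \<Rightarrow> ('k, 'b, 'b) tensor"
    and \<epsilon>\<^sub>B :: "'b \<Rightarrow> 'k"
    and A :: "('k, 'a) hom_object"
    and \<rho>\<^sub>A :: "'a \<Rightarrow> ('k, 'a, 'b) tensor"
    and C :: "('k, 'c) hom_object"
    and \<Delta> :: "'c \<Rightarrow> ('k, 'c, 'c) tensor"
    and \<epsilon> :: "'c \<Rightarrow> 'k"
    and act\<^sub>C :: "'c \<Rightarrow> 'b \<Rightarrow> 'c"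
  assumes "hom_bialgebra K B \<Delta>\<^sub>B \<epsilon>\<^sub>B"
    and "hom_comodule_algebra K B \<Delta>\<^sub>B \<epsilon>\<^sub>B A \<rho>\<^sub>A"
    and "hom_module_coalgebra K B \<Delta>\<^sub>B \<epsilon>\<^sub>B C \<Delta> \<epsilon> act\<^sub>C"
  defines "\<psi> \<equiv> induced_psi K A C \<rho>\<^sub>A act\<^sub>C"
    and "\<C> \<equiv> induced_bimodule K A C \<rho>\<^sub>A act\<^sub>C"
    and "\<Delta>\<^sub>\<C> \<equiv> induced_comul K A C \<Delta> \<rho>\<^sub>A act\<^sub>C"
    and "\<epsilon>\<^sub>\<C> \<equiv> induced_counit K A \<epsilon>"
    and "H \<equiv> hom_convolution_algebra K C \<Delta> \<epsilon> A \<rho>\<^sub>A act\<^sub>C"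
  shows
    "(hom_entwining K A C \<Delta> \<epsilon> \<psi> \<and>
      (\<forall>c\<in>carrier C. \<forall>a\<in>carrier A.
        \<psi> (pure_tensor K C A c a) =
          sweedler K (tensor K A C)
            (\<lambda>a0 a1. pure_tensor K A C (aut A a0) (act\<^sub>C (aut_inv C c) a1)) (\<rho>\<^sub>A a)))
     \<and>
     (\<forall>(M :: ('k, 'm) hom_object) act\<^sub>M \<rho>\<^sub>M.
        entwined_hom_module K A C \<Delta> \<epsilon> \<psi> M act\<^sub>M \<rho>\<^sub>M \<longleftrightarrow>
        right_hom_module K A M act\<^sub>M \<and> right_hom_comodule K C \<Delta> \<epsilon> M \<rho>\<^sub>M \<and>
        (\<forall>m\<in>carrier M. \<forall>a\<in>carrier A.
          \<rho>\<^sub>M (act\<^sub>M m a) =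
            sweedler K (tensor K M C) (\<lambda>m0 m1. sweedler K (tensor K M C) (\<lambda>a0 a1.
              pure_tensor K M C (act\<^sub>M m0 a0) (act\<^sub>C m1 a1)) (\<rho>\<^sub>A a)) (\<rho>\<^sub>M m)))
     \<and>
     (hom_coring K A \<C> \<Delta>\<^sub>\<C> \<epsilon>\<^sub>\<C> \<and>
      hom_object.truncate \<C> = tensor K A C \<and>
      (\<forall>a\<in>carrier A. \<forall>c\<in>carrier C.
        aut \<C> (pure_tensor K A C a c) = pure_tensor K A C (aut A a) (aut C c) \<and>
        \<Delta>\<^sub>\<C> (pure_tensor K A C a c) =
          sweedler K (tensor_over K A \<C> \<C>) (\<lambda>c1 c2.
            pure_tensor_over K A \<C> \<C>
              (pure_tensor K A C (aut_inv A a) c1) (pure_tensor K A C \<one>\<^bsub>A\<^esub> c2)) (\<Delta> c) \<and>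
        \<epsilon>\<^sub>\<C> (pure_tensor K A C a c) = \<epsilon> c \<odot>\<^bsub>A\<^esub> aut A a) \<and>
      (\<forall>a\<in>carrier A. \<forall>a'\<in>carrier A. \<forall>c\<in>carrier C.
        lact \<C> a (pure_tensor K A C a' c) =
          pure_tensor K A C (aut_inv A a \<otimes>\<^bsub>A\<^esub> a') (aut C c) \<and>
        ract \<C> (pure_tensor K A C a' c) a =
          sweedler K (tensor K A C)
            (\<lambda>a0 a1. pure_tensor K A C (a' \<otimes>\<^bsub>A\<^esub> a0) (act\<^sub>C c a1)) (\<rho>\<^sub>A a)))
     \<and>
     (associative_algebra K H \<and>
      (\<forall>f\<in>carrier H. \<forall>g\<in>carrier H. \<forall>c\<in>carrier C.
        (f \<otimes>\<^bsub>H\<^esub> g) c =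
          sweedler K A (\<lambda>c1 c2. sweedler K A (\<lambda>f0 f1.
            aut A f0 \<otimes>\<^bsub>A\<^esub> g (act\<^sub>C (aut_inv C c1) f1)) (\<rho>\<^sub>A (f c2))) (\<Delta> c) \<and>
        (f \<otimes>\<^bsub>H\<^esub> g) c =
          sweedler K A (\<lambda>c1 c2. sweedler K A (\<lambda>f0 f1.
            f0 \<otimes>\<^bsub>A\<^esub> aut_inv A (g (act\<^sub>C c1 f1))) (\<rho>\<^sub>A (aut A (f c2)))) (\<Delta> c)))"
proof -
  interpret D: hom_doi_koppinen K B \<Delta>\<^sub>B \<epsilon>\<^sub>B A \<rho>\<^sub>A C \<Delta> \<epsilon> act\<^sub>C
    by (intro hom_doi_koppinen.intro assms(2,3))
  have truncate: "hom_object.truncate \<C> = tensor K A C"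
    unfolding \<C>_def induced_bimodule_def Let_def
    by (cases "tensor K A C") (simp add: hom_object.defs hom_bimodule.defs)
  show ?thesis
    unfolding truncate
    unfolding \<psi>_def \<C>_def \<Delta>\<^sub>\<C>_def \<epsilon>\<^sub>\<C>_def H_def
  proof (intro conjI ballI allI)
    show "hom_entwining K A C \<Delta> \<epsilon> (induced_psi K A C \<rho>\<^sub>A act\<^sub>C)" by (rule D.hom_entwining)
    show "hom_coring K A D.\<C> D.\<Delta>\<^sub>\<C> D.\<epsilon>\<^sub>\<C>" by (rule D.hom_coring)
    show "associative_algebra K D.H" by (rule D.H_associative_algebra)
    fix f g c assume mem: "f \<in> carrier D.H" "g \<in> carrier D.H" "c \<in> carrier C"
    show "(f \<otimes>\<^bsub>D.H\<^esub> g) c =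
        sweedler K A (\<lambda>c1 c2. sweedler K A (\<lambda>f0 f1.
          aut A f0 \<otimes>\<^bsub>A\<^esub> g (act\<^sub>C (aut_inv C c1) f1)) (\<rho>\<^sub>A (f c2))) (\<Delta> c)"
      using mem(3) by (simp add: D.H_values D.conv_def tensor_lift_def)
    show "(f \<otimes>\<^bsub>D.H\<^esub> g) c =
        sweedler K A (\<lambda>c1 c2. sweedler K A (\<lambda>f0 f1.
          f0 \<otimes>\<^bsub>A\<^esub> aut_inv A (g (act\<^sub>C c1 f1))) (\<rho>\<^sub>A (aut A (f c2)))) (\<Delta> c)"
      using D.conv_alternative[OF D.H_carrierD[OF mem(1)] D.H_carrierD[OF mem(2)] mem(3)] mem(3)
      by (simp add: D.H_values tensor_lift_def)
  qed (simp_all add: D.entwined_iff D.psi_pure[unfolded tensor_lift_def] D.C_pure[unfolded tensor_lift_def]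
      D.comul_pure[unfolded tensor_lift_def] D.counit_pure)
qed

end
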